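(* (a) If $n\equiv 2 \pmod 3$ and $n\ge 8$, then $r_n \ge (n-1)r_{n-2}-1 \ge (n-1)(n-3)-1$. (b) If $m,n$ are positive integers with $m+n\equiv 0 \pmod 3$ and $m\le n\le 2m-3$, then $r_{m,n}\ge n$. (c) If $m,n$ are positive integers with $m+n\equiv 2 \pmod 3$ and $m\le n\le 2m-7$, then $r_{m,n}\ge n(n-1)-1$.
   Context: $[n]=\{1,\dots,n\}$, $[n]'=\{1',\dots,n'\}$. The matching complex $M_n$ is the abstract simplicial complex whose vertices are the edges of the complete graph on $[n]$ and whose faces are the sets of pairwise disjoint edges (matchings). The chessboard complex $M_{m,n}$ is the abstract simplicial complex whose vertices are the edges of the complete bipartite graph with parts $[m]$ and $[n]'$ and whose faces are the sets of pairwise disjoint edges. $\nu_n = \lfloor \frac{n+1}{3}\rfloor - 1$ and $\nu_{m,n} = \min\{m,n,\lfloor \frac{m+n+1}{3}\rfloor\}-1$. $\tilde H_*$ denotes reduced simplicial homology with integer coefficients. The rank of a finitely generated abelian group means here the smallest size of a generating set. $r_n=\operatorname{rank}(\tilde H_{\nu_n}(M_n))$ and $r_{m,n}=\operatorname{rank}(\tilde H_{\nu_{m,n}}(M_{m,n}))$. *)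

theory Defs
  imports
    "HOL-Algebra.Coset"
    "HOL-Algebra.Generated_Groups"
    "HOL-Combinatorics.Permutations"
    "HOL-Number_Theory.Cong"
    "HOL-Library.Disjoint_Sets"
begin

text \<open>
  An abstract simplicial complex is given by its set of faces, the empty face included.

  An oriented \<open>p\<close>-chain is an integer-valued function on the orderings of the \<open>p\<close>-faces (lists
  without repetition) that is finitely supported and changes by the sign of the permutation when
  the vertices are permuted. The oriented simplex \<open>[x\<^sub>0, \<dots>, x\<^sub>p]\<close> is the chain that has the value
  \<open>sign \<pi>\<close> on the list \<open>x\<close> permuted by \<open>\<pi>\<close> and vanishes on the other lists. The dimension is an
  integer; the empty list is the simplex of dimension \<open>-1\<close>, so this is the augmented chain complex.
\<close>

definition alternating :: "('a list \<Rightarrow> int) \<Rightarrow> bool"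
  where "alternating c \<longleftrightarrow>
    (\<forall>xs \<pi>. \<pi> permutes {..<length xs} \<longrightarrow> c (permute_list \<pi> xs) = sign \<pi> * c xs)"

definition oriented_chains :: "'a set set \<Rightarrow> int \<Rightarrow> ('a list \<Rightarrow> int) set"
  where "oriented_chains K p =
    {c. finite {xs. c xs \<noteq> 0} \<and>
        (\<forall>xs. c xs \<noteq> 0 \<longrightarrow> distinct xs \<and> set xs \<in> K \<and> int (length xs) = p + 1) \<and>
        alternating c}"

definition chain_group :: "'a set set \<Rightarrow> int \<Rightarrow> ('a list \<Rightarrow> int) monoid"
  where "chain_group K p =
    \<lparr>carrier = oriented_chains K p, monoid.mult = (\<lambda>c d xs. c xs + d xs), one = (\<lambda>xs. 0)\<rparr>"

text \<open>
  The usual formula \<open>\<partial>[x\<^sub>0, \<dots>, x\<^sub>p] = (\<Sum>i\<le>p. (-1)^i [x\<^sub>0, \<dots>, x\<^sub>i\<^sub>-\<^sub>1, x\<^sub>i\<^sub>+\<^sub>1, \<dots>, x\<^sub>p])\<close>, read off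
  coefficientwise: \<open>[y\<^sub>0, \<dots>, y\<^sub>p\<^sub>-\<^sub>1]\<close> occurs with coefficient 1 in the boundary of
  \<open>[v, y\<^sub>0, \<dots>, y\<^sub>p\<^sub>-\<^sub>1]\<close>. Lemma \<open>boundary_oriented_simplex\<close> below derives the formula.
\<close>

definition boundary :: "('a list \<Rightarrow> int) \<Rightarrow> ('a list \<Rightarrow> int)"
  where "boundary c = (\<lambda>ys. \<Sum>v | c (v # ys) \<noteq> 0. c (v # ys))"

definition cycles :: "'a set set \<Rightarrow> int \<Rightarrow> ('a list \<Rightarrow> int) set"
  where "cycles K p = kernel (chain_group K p) (chain_group K (p - 1)) boundary"

definition boundaries :: "'a set set \<Rightarrow> int \<Rightarrow> ('a list \<Rightarrow> int) set"
  where "boundaries K p = boundary ` carrier (chain_group K (p + 1))"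

definition reduced_simplicial_homology :: "'a set set \<Rightarrow> int \<Rightarrow> ('a list \<Rightarrow> int) set monoid"
  where "reduced_simplicial_homology K p =
    (chain_group K p)\<lparr>carrier := cycles K p\<rparr> Mod boundaries K p"

definition matchings :: "'a set set \<Rightarrow> 'a set set set"
  where "matchings E = {F. F \<subseteq> E \<and> disjoint F}"

definition matching_complex :: "nat \<Rightarrow> nat set set set"
  where "matching_complex n = matchings {{i, j} | i j. i \<in> {1..n} \<and> j \<in> {1..n} \<and> i \<noteq> j}"

definition chessboard_complex :: "nat \<Rightarrow> nat \<Rightarrow> (nat + nat) set set set"
  where "chessboard_complex m n = matchings {{Inl i, Inr j} | i j. i \<in> {1..m} \<and> j \<in> {1..n}}"

definition matching_nu :: "nat \<Rightarrow> int"
  where "matching_nu n = int ((n + 1) div 3) - 1"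

definition chessboard_nu :: "nat \<Rightarrow> nat \<Rightarrow> int"
  where "chessboard_nu m n = int (min m (min n ((m + n + 1) div 3))) - 1"

text \<open>Only meaningful for finitely generated groups.\<close>

definition generator_rank :: "('a, 'b) monoid_scheme \<Rightarrow> nat"
  where "generator_rank G =
    (LEAST k. \<exists>S. S \<subseteq> carrier G \<and> finite S \<and> card S = k \<and> generate G S = carrier G)"

definition matching_rank :: "nat \<Rightarrow> nat"
  where "matching_rank n =
    generator_rank (reduced_simplicial_homology (matching_complex n) (matching_nu n))"

definition chessboard_rank :: "nat \<Rightarrow> nat \<Rightarrow> nat"
  where "chessboard_rank m n =
    generator_rank (reduced_simplicial_homology (chessboard_complex m n) (chessboard_nu m n))"

lemma alternating_swap:
  assumes "alternating c"
  shows "c (as @ y # x # bs) = - c (as @ x # y # bs)"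
proof -
  let ?n = "length as" and ?xs = "as @ x # y # bs"
  let ?t = "transpose ?n (Suc ?n)"
  have t: "?t permutes {..<length ?xs}"
    by (rule permutes_swap_id) auto
  have "permute_list ?t ?xs = as @ y # x # bs"
    by (rule nth_equalityI)
      (auto simp: permute_list_nth[OF t] nth_append transpose_def nth_Cons' split: if_splits)
  then show ?thesis
    using assms t by (auto simp: alternating_def sign_swap_id dest!: spec[of _ ?xs] spec[of _ ?t])
qed

lemma alternating_move:
  assumes "alternating c"
  shows "c (x # as @ bs) = (-1) ^ length as * c (as @ x # bs)"
proof (induction as arbitrary: bs rule: rev_induct)
  case (snoc a as)
  then show ?case
    using alternating_swap[OF assms, of as a x bs] by simp
qed simp

lemma permute_list_Cons:
  assumes "\<pi> permutes {..<length xs}"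
  obtains \<sigma> where "\<sigma> permutes {..<length (x # xs)}" "sign \<sigma> = sign \<pi>"
    "permute_list \<sigma> (x # xs) = x # permute_list \<pi> xs"
proof -
  let ?\<sigma> = "map_permutation {..<length xs} Suc \<pi>"
  have "?\<sigma> permutes Suc ` {..<length xs}"
    by (intro map_permutation_permutes bij_betw_imageI assms) auto
  then have \<sigma>: "?\<sigma> permutes {..<length (x # xs)}"
    by (rule permutes_subset) auto
  have 0: "?\<sigma> 0 = 0"
    using \<open>?\<sigma> permutes Suc ` {..<length xs}\<close> by (auto simp: permutes_def)
  have S: "?\<sigma> (Suc i) = Suc (\<pi> i)" if "i < length xs" for i
    using that by (subst map_permutation_apply) auto
  have "permute_list ?\<sigma> (x # xs) = x # permute_list \<pi> xs"
    by (rule nth_equalityI)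
      (auto simp: permute_list_nth[OF \<sigma>] permute_list_nth[OF assms] 0 S less_Suc_eq_0_disj
        simp del: permute_list_map)
  moreover have "sign ?\<sigma> = sign \<pi>"
    by (rule sign_map_permutation) (use assms in auto)
  ultimately show thesis
    using \<sigma> that by blast
qed

lemma alternating_boundary:
  assumes "alternating c"
  shows "alternating (boundary c)"
  unfolding alternating_def
proof (intro allI impI)
  fix xs :: "'a list" and \<pi> assume \<pi>: "\<pi> permutes {..<length xs}"
  have "c (v # permute_list \<pi> xs) = sign \<pi> * c (v # xs)" for v
    using permute_list_Cons[OF \<pi>, of v] assms unfolding alternating_def by metis
  then show "boundary c (permute_list \<pi> xs) = sign \<pi> * boundary c xs"
    by (simp add: boundary_def sum_distrib_left)
qed

definition oriented_simplex :: "'a list \<Rightarrow> ('a list \<Rightarrow> int)"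
  where "oriented_simplex xs =
    (\<lambda>ys. \<Sum>\<pi> | \<pi> permutes {..<length xs} \<and> permute_list \<pi> xs = ys. sign \<pi>)"

lemma alternating_oriented_simplex: "alternating (oriented_simplex xs)"
  unfolding alternating_def
proof (intro allI impI)
  fix ys :: "'a list" and \<pi> assume \<pi>: "\<pi> permutes {..<length ys}"
  show "oriented_simplex xs (permute_list \<pi> ys) = sign \<pi> * oriented_simplex xs ys"
  proof (cases "length ys = length xs")
    case True
    with \<pi> have \<pi>': "\<pi> permutes {..<length xs}" by simp
    have inj: "permute_list \<sigma> xs = ys" if "permute_list (\<sigma> \<circ> \<pi>) xs = permute_list \<pi> ys" for \<sigma>
    proof -
      have "permute_list \<pi> (permute_list \<sigma> xs) = permute_list \<pi> ys"
        using that permute_list_compose[OF \<pi>', of \<sigma>] by simp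
      then have "permute_list (inv_into UNIV \<pi>) (permute_list \<pi> (permute_list \<sigma> xs))
          = permute_list (inv_into UNIV \<pi>) (permute_list \<pi> ys)" by simp
      moreover have "permute_list (inv_into UNIV \<pi>) (permute_list \<pi> zs) = zs" if "length zs = length xs" for zs :: "'a list"
        using permute_list_compose[of "inv_into UNIV \<pi>" zs \<pi>] permutes_inv[OF \<pi>'] permutes_inv_o[OF \<pi>'] that by simp
      ultimately show ?thesis using True by simp
    qed
    have "oriented_simplex xs (permute_list \<pi> ys) =
        (\<Sum>\<sigma> | \<sigma> permutes {..<length xs} \<and> permute_list \<sigma> xs = ys. sign (\<sigma> \<circ> \<pi>))"
      unfolding oriented_simplex_def
      by (rule sum.reindex_bij_witness[of _ "\<lambda>\<sigma>. \<sigma> \<circ> \<pi>" "\<lambda>\<sigma>. \<sigma> \<circ> inv_into UNIV \<pi>"])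
        (use \<pi>' in \<open>auto simp: comp_assoc permutes_inv_o permute_list_compose
            intro!: permutes_compose permutes_inv inj\<close>)
    also have "\<dots> = (\<Sum>\<sigma> | \<sigma> permutes {..<length xs} \<and> permute_list \<sigma> xs = ys. sign \<pi> * sign \<sigma>)"
      by (intro sum.cong refl)
        (use \<pi>' in \<open>auto simp: sign_compose permutes_imp_permutation[OF finite_lessThan]\<close>)
    finally show ?thesis
      by (simp add: oriented_simplex_def sum_distrib_left)
  next
    case False
    then have "permute_list \<sigma> xs \<noteq> permute_list \<pi> ys" "permute_list \<sigma> xs \<noteq> ys" for \<sigma>
      by (metis length_permute_list)+
    then show ?thesis
      by (simp add: oriented_simplex_def)
  qed
qed

lemma oriented_simplex_eq_0: "mset xs \<noteq> mset ys \<Longrightarrow> oriented_simplex xs ys = 0"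
  unfolding oriented_simplex_def by (rule sum.neutral) auto

lemma oriented_simplex_self:
  assumes "distinct xs"
  shows "oriented_simplex xs xs = 1"
proof -
  have "{\<pi>. \<pi> permutes {..<length xs} \<and> permute_list \<pi> xs = xs} = {id}"
  proof (intro equalityI subsetI; clarsimp)
    fix \<pi> assume \<pi>: "\<pi> permutes {..<length xs}" and *: "permute_list \<pi> xs = xs"
    show "\<pi> = id"
    proof
      fix i
      show "\<pi> i = id i"
      proof (cases "i < length xs")
        case True
        then have "xs ! \<pi> i = xs ! i"
          using permute_list_nth[OF \<pi> True] * by simp
        then show ?thesis
          using True assms permutes_in_image[OF \<pi>, of i] by (simp add: nth_eq_iff_index_eq)
      qed (use \<pi> in \<open>auto simp: permutes_def\<close>)
    qed
  qed
  then show ?thesis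
    by (simp add: oriented_simplex_def)
qed

lemma boundary_oriented_simplex:
  assumes "distinct xs"
  shows "boundary (oriented_simplex xs) =
    (\<lambda>ys. \<Sum>i<length xs. (-1) ^ i * oriented_simplex (take i xs @ drop (Suc i) xs) ys)"
proof
  fix ys :: "'a list"
  let ?e = "oriented_simplex xs"
  have del: "xs ! i # take i xs @ drop (Suc i) xs \<noteq> [] \<and>
      mset xs = add_mset (xs ! i) (mset (take i xs @ drop (Suc i) xs))" if "i < length xs" for i
    using id_take_nth_drop[OF that] by (metis mset.simps(2) mset_append list.distinct(1) union_mset_add_mset_right)
  have "boundary ?e ys = (\<Sum>v\<in>set xs. ?e (v # ys))"
    unfolding boundary_def
    by (rule sum.mono_neutral_left)
      (auto, metis list.set_intros(1) oriented_simplex_eq_0 mset_eq_setD)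
  also have "\<dots> = (\<Sum>i<length xs. ?e (xs ! i # ys))"
    using bij_betw_nth[OF assms refl refl] by (intro sum.reindex_bij_betw[symmetric]) simp
  also have "\<dots> = (\<Sum>i<length xs. (-1) ^ i * oriented_simplex (take i xs @ drop (Suc i) xs) ys)"
  proof (rule sum.cong[OF refl])
    fix i assume "i \<in> {..<length xs}"
    then have i: "i < length xs" by simp
    let ?d = "take i xs @ drop (Suc i) xs"
    show "?e (xs ! i # ys) = (-1) ^ i * oriented_simplex ?d ys"
    proof (cases "mset ys = mset ?d")
      case True
      then obtain \<pi> where \<pi>: "\<pi> permutes {..<length ?d}" "permute_list \<pi> ?d = ys"
        using mset_eq_permutation by metis
      obtain \<sigma> where \<sigma>: "\<sigma> permutes {..<length (xs ! i # ?d)}" "sign \<sigma> = sign \<pi>"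
        "permute_list \<sigma> (xs ! i # ?d) = xs ! i # ys"
        using permute_list_Cons[OF \<pi>(1), of "xs ! i"] \<pi>(2) by metis
      have "?e (xs ! i # ys) = sign \<pi> * ?e (xs ! i # ?d)"
        using alternating_oriented_simplex[of xs] \<sigma> unfolding alternating_def by metis
      also have "?e (xs ! i # ?d) = (-1) ^ i"
        using alternating_move[OF alternating_oriented_simplex[of xs], of "xs ! i" "take i xs" "drop (Suc i) xs"]
          id_take_nth_drop[OF i] oriented_simplex_self[OF assms] i by simp
      finally have "?e (xs ! i # ys) = sign \<pi> * (-1) ^ i" .
      moreover have "distinct ?d"
        using assms by (subst (asm) id_take_nth_drop[OF i]) auto
      then have "oriented_simplex ?d ys = sign \<pi>"
        using alternating_oriented_simplex[of ?d] \<pi> oriented_simplex_self[of ?d]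
        unfolding alternating_def by (metis mult.right_neutral)
      ultimately show ?thesis by simp
    next
      case False
      then have "mset xs \<noteq> mset (xs ! i # ys)"
        using del[OF i] by auto
      then show ?thesis
        using False oriented_simplex_eq_0 by (metis mult_zero_right)
    qed
  qed
  finally show "boundary ?e ys =
    (\<Sum>i<length xs. (-1) ^ i * oriented_simplex (take i xs @ drop (Suc i) xs) ys)" .
qed

lemma finite_extensions:
  fixes c :: "'a list \<Rightarrow> int"
  assumes "finite {xs. c xs \<noteq> 0}"
  shows "finite {v. c (v # ys) \<noteq> 0}"
  using finite_vimageI[OF assms, of "\<lambda>v. v # ys"] by (simp add: vimage_def inj_def)

lemma boundary_eq_sum:
  assumes "finite V" "\<And>v. c (v # ys) \<noteq> 0 \<Longrightarrow> v \<in> V"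
  shows "boundary c ys = (\<Sum>v\<in>V. c (v # ys))"
  unfolding boundary_def by (rule sum.mono_neutral_left) (use assms in auto)

lemma boundary_add:
  assumes "finite {xs. c xs \<noteq> 0}" "finite {xs. d xs \<noteq> 0}"
  shows "boundary (\<lambda>xs. c xs + d xs) = (\<lambda>xs. boundary c xs + boundary d xs)"
proof
  fix ys :: "'a list"
  let ?V = "{v. c (v # ys) \<noteq> 0} \<union> {v. d (v # ys) \<noteq> 0}"
  have V: "finite ?V"
    using assms by (simp add: finite_extensions)
  have "boundary c ys = (\<Sum>v\<in>?V. c (v # ys))" "boundary d ys = (\<Sum>v\<in>?V. d (v # ys))"
    "boundary (\<lambda>xs. c xs + d xs) ys = (\<Sum>v\<in>?V. c (v # ys) + d (v # ys))"
    by (rule boundary_eq_sum[OF V]; auto)+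
  then show "boundary (\<lambda>xs. c xs + d xs) ys = boundary c ys + boundary d ys"
    by (simp add: sum.distrib)
qed

lemma boundary_nonzeroD: "boundary c ys \<noteq> 0 \<Longrightarrow> \<exists>v. c (v # ys) \<noteq> 0"
  unfolding boundary_def by (meson mem_Collect_eq sum.not_neutral_contains_not_neutral)

lemma boundary_boundary:
  assumes "finite {xs. c xs \<noteq> 0}" "alternating c"
  shows "boundary (boundary c) = (\<lambda>xs. 0)"
proof
  fix ys :: "'a list"
  define V where "V = (\<Union>xs\<in>{xs. c xs \<noteq> 0}. set xs)"
  have V: "finite V" and mem: "\<And>xs v. c xs \<noteq> 0 \<Longrightarrow> v \<in> set xs \<Longrightarrow> v \<in> V"
    using assms(1) by (auto simp: V_def)
  have "boundary c xs = (\<Sum>v\<in>V. c (v # xs))" for xs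
    by (rule boundary_eq_sum[OF V]) (auto intro: mem)
  moreover have "boundary (boundary c) ys = (\<Sum>v\<in>V. boundary c (v # ys))"
    by (rule boundary_eq_sum[OF V]) (fastforce dest!: boundary_nonzeroD intro: mem)
  ultimately have *: "boundary (boundary c) ys = (\<Sum>v\<in>V. \<Sum>w\<in>V. c (w # v # ys))"
    by simp
  also have "\<dots> = (\<Sum>v\<in>V. \<Sum>w\<in>V. c (v # w # ys))"
    by (rule sum.swap)
  also have "\<dots> = (\<Sum>v\<in>V. \<Sum>w\<in>V. - c (w # v # ys))"
    by (intro sum.cong refl) (metis append_Nil alternating_swap[OF assms(2)])
  also have "\<dots> = - boundary (boundary c) ys"
    by (simp only: * sum_negf)
  finally show "boundary (boundary c) ys = 0" by simp
qed

lemma boundary_oriented_chains: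
  assumes c: "c \<in> oriented_chains K p" and K: "\<And>F G. F \<in> K \<Longrightarrow> G \<subseteq> F \<Longrightarrow> G \<in> K"
  shows "boundary c \<in> oriented_chains K (p - 1)"
proof -
  have "{ys. boundary c ys \<noteq> 0} \<subseteq> tl ` {xs. c xs \<noteq> 0}"
    by (force dest: boundary_nonzeroD)
  then have "finite {ys. boundary c ys \<noteq> 0}"
    using c by (auto simp: oriented_chains_def intro: finite_surj)
  moreover have "distinct ys \<and> set ys \<in> K \<and> int (length ys) = p - 1 + 1" if "boundary c ys \<noteq> 0" for ys
  proof -
    obtain v where "c (v # ys) \<noteq> 0"
      using \<open>boundary c ys \<noteq> 0\<close> boundary_nonzeroD by blast
    then have "distinct (v # ys)" "set (v # ys) \<in> K" "int (length (v # ys)) = p + 1"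
      using c by (auto simp: oriented_chains_def simp del: distinct.simps list.set list.size)
    then show ?thesis
      using K[of "set (v # ys)" "set ys"] by auto
  qed
  ultimately show ?thesis
    using c alternating_boundary[of c] by (auto simp: oriented_chains_def)
qed

lemma oriented_chains_add:
  assumes "c \<in> oriented_chains K p" "d \<in> oriented_chains K p"
  shows "(\<lambda>xs. c xs + d xs) \<in> oriented_chains K p"
proof -
  have "finite {xs. c xs + d xs \<noteq> 0}"
    by (rule finite_subset[of _ "{xs. c xs \<noteq> 0} \<union> {xs. d xs \<noteq> 0}"])
      (use assms in \<open>auto simp: oriented_chains_def\<close>)
  moreover have "distinct xs \<and> set xs \<in> K \<and> int (length xs) = p + 1" if "c xs + d xs \<noteq> 0" for xs
  proof -
    have "c xs \<noteq> 0 \<or> d xs \<noteq> 0" using that by auto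
    then show ?thesis using assms unfolding oriented_chains_def by blast
  qed
  moreover have "alternating (\<lambda>xs. c xs + d xs)"
    using assms by (simp add: oriented_chains_def alternating_def distrib_left)
  ultimately show ?thesis
    unfolding oriented_chains_def by blast
qed

lemma comm_group_chain_group: "comm_group (chain_group K p)"
proof (rule comm_groupI)
  fix c assume "c \<in> carrier (chain_group K p)"
  then have "(\<lambda>xs. - c xs) \<in> carrier (chain_group K p)"
    by (simp add: chain_group_def oriented_chains_def alternating_def)
  then show "\<exists>d\<in>carrier (chain_group K p). d \<otimes>\<^bsub>chain_group K p\<^esub> c = \<one>\<^bsub>chain_group K p\<^esub>"
    by (rule bexI[rotated]) (simp add: chain_group_def)
next
  show "\<one>\<^bsub>chain_group K p\<^esub> \<in> carrier (chain_group K p)"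
    by (simp add: chain_group_def oriented_chains_def alternating_def)
qed (simp_all add: chain_group_def oriented_chains_add ac_simps)

lemma comm_group_reduced_simplicial_homology:
  assumes K: "\<And>F G. F \<in> K \<Longrightarrow> G \<subseteq> F \<Longrightarrow> G \<in> K"
  shows "comm_group (reduced_simplicial_homology K p)"
proof -
  have hom: "group_hom (chain_group K q) (chain_group K (q - 1)) boundary" for q
  proof -
    have "boundary \<in> hom (chain_group K q) (chain_group K (q - 1))"
      by (rule homI)
        (auto simp: chain_group_def boundary_oriented_chains[OF _ K],
          auto simp: oriented_chains_def intro: boundary_add)
    then show ?thesis
      by (simp add: group_hom_def group_hom_axioms_def comm_group_chain_group comm_group.axioms(2))
  qed
  have Z: "subgroup (cycles K p) (chain_group K p)"
    unfolding cycles_def by (rule group_hom.subgroup_kernel[OF hom])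
  interpret C: comm_group "chain_group K p"
    by (rule comm_group_chain_group)
  interpret Z: comm_group "(chain_group K p)\<lparr>carrier := cycles K p\<rparr>"
    using C.comm_monoid_axioms C.subgroup_imp_group[OF Z] subgroup.subset[OF Z]
    by (intro group.group_comm_groupI) (auto intro: C.m_comm)
  have B: "subgroup (boundaries K p) (chain_group K p)"
    using group_hom.img_is_subgroup[OF hom[of "p + 1"]] by (simp add: boundaries_def)
  have "boundaries K p \<subseteq> cycles K p"
    using subgroup.subset[OF B] boundary_boundary
    by (auto simp: boundaries_def cycles_def kernel_def chain_group_def oriented_chains_def)
  then have "subgroup (boundaries K p) ((chain_group K p)\<lparr>carrier := cycles K p\<rparr>)"
    using C.subgroup_incl[OF B Z] by simp
  then show ?thesis
    unfolding reduced_simplicial_homology_def by (rule Z.abelian_FactGroup)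
qed

lemma matchings_subset: "F \<in> matchings E \<Longrightarrow> G \<subseteq> F \<Longrightarrow> G \<in> matchings E"
  unfolding matchings_def using pairwise_subset by blast

end

theory Submission
  imports Defs "HOL-Library.Function_Algebras" HOL.Modules
begin

text \<open>
  All three bounds come from one mechanism. Let \<open>K\<close> be the complex of matchings of a graph, and let
  \<open>e\<close> range over the edges at a fixed point \<open>i\<close>. No two of these edges occur in a common face, so
  contracting with \<open>e\<close> maps the cycles of \<open>K\<close> to the cycles of the link of \<open>e\<close>, and the links all lie
  in the complex \<open>L\<close> of matchings that avoid \<open>i\<close>. A family of cycles in the links comes from a
  cycle of \<open>K\<close> as soon as its sum bounds in \<open>L\<close>. If the classes of the links have only multiples of
  one class of \<open>L\<close> as their images, then this obstruction costs at most one generator, so that the rank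
  of \<open>K\<close> is essentially the sum of the ranks of the links, minus one (\<open>rank_of_links\<close>).

  To compare ranks of integral homology groups, a rank \<open>r\<close> is replaced by an \<open>r\<close>-element dual
  system modulo some \<open>p\<close>: cycles together with functionals modulo \<open>p\<close> that vanish on the boundaries and
  take the values of the identity matrix. Dual systems bound the rank from below by counting
  (\<open>dual_system_le_rank\<close>), and one of size \<open>r\<close> always exists (\<open>rank_dual_system\<close>). Dual systems
  of the links with the same modulus add up, whereas ranks of finitely generated abelian groups need not.

  The cycles are joins of \<open>0\<close>-spheres: a path \<open>a b c\<close> contributes the difference of its two edges, and a
  list of points, cut into triples, gives a path cycle. For the complete graph on \<open>3k\<close> or
  \<open>3k + 1\<close> points the path cycles generate the homology in the degree of joins of \<open>k\<close> spheres, and below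
  that degree the homology vanishes (\<open>path_cycles_generate\<close>, \<open>matching_homology_vanishing\<close>). On
  \<open>3k + 1\<close> points with \<open>k \<ge> 2\<close>, exchanging two points changes the class of a path cycle only by a
  sign (\<open>path_cycle_transpose\<close>); so the homology is cyclic (\<open>matching_homology_cyclic\<close>), which is
  the condition on \<open>L\<close> in part (a).

  Finally, path cycles on \<open>3k + 1\<close> points are not boundaries, not even modulo 3: there is a functional
  modulo 3 that sends every path cycle to the sign of its list of points (\<open>functional_exists\<close>). It
  starts with the three-component complex on four points, and induction on \<open>k\<close> works because the signs
  of the two ways to complete a path cycle on \<open>3k\<close> points match. A bipartite graph is a
  subgraph of a complete one, so the functional restricts to chessboard complexes. Applied in the
  links of the edges at a point it gives a dual system with one path cycle for each edge
  (\<open>star_dual_system\<close>): this is part (b) and the second inequality of (a). Applied in each of the \<open>n\<close>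
  links at a left point of a chessboard complex it gives \<open>n(n - 1)\<close> classes, and these have the same image up
  to sign by an explicit sequence of moves (\<open>two_path_state_all\<close>): this is part (c).
\<close>

section \<open>The exterior algebra of chains\<close>

lemma sum_fun_apply: "(\<Sum>i\<in>I. f i) x = (\<Sum>i\<in>I. f i x)"
  for f :: "'i \<Rightarrow> 'x \<Rightarrow> int"
  by (induction I rule: infinite_finite_induct) auto

lemma alternating_move_at:
  assumes "\<And>as x y bs. c (as @ y # x # bs) = - c (as @ x # y # bs)"
  shows "c (as @ x # bs @ cs) = (-1) ^ length bs * (c (as @ bs @ x # cs) :: int)"
proof (induction bs arbitrary: as)
  case (Cons b bs)
  then show ?case
    using assms[of as x b "bs @ cs"] Cons[of "as @ [b]"] by simp
qed simp

text \<open>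
  Adjacent transpositions generate the symmetric group, and all operations on chains below act on lists
  from the front, where adjacent exchanges are easy to follow.
\<close>

lemma alternatingI:
  assumes c: "\<And>as x y bs. c (as @ y # x # bs) = - c (as @ x # y # bs)"
  shows "alternating c"
  unfolding alternating_def
proof (intro allI impI)
  have swap: "c (as @ y # bs @ x # cs) = - c (as @ x # bs @ y # cs)" for as x bs y cs
  proof -
    have "c (as @ y # bs @ x # cs) = (-1) ^ length bs * c (as @ bs @ y # x # cs)"
      using alternating_move_at[of c, OF c, of as y bs "x # cs"] by simp
    also have "\<dots> = - ((-1) ^ length bs * c (as @ bs @ x # y # cs))"
      using c[of "as @ bs" x y cs] by simp
    also have "(-1) ^ length bs * c (as @ bs @ x # y # cs) = c (as @ x # bs @ y # cs)"
      using alternating_move_at[of c, OF c, of as x bs "y # cs"] by simp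
    finally show ?thesis .
  qed
  have transp: "c (permute_list (transpose a b) xs) = - c xs" if ab: "a < b" "b < length xs" for a b xs
  proof -
    obtain as x r where 1: "xs = as @ x # r" "length as = a"
      using ab id_take_nth_drop[of a xs] by (intro that[of "take a xs" "xs ! a" "drop (Suc a) xs"]) auto
    have "b - Suc a < length r"
      using ab 1 by simp
    then obtain bs y cs where 2: "r = bs @ y # cs" "length bs = b - Suc a"
      using id_take_nth_drop[of "b - Suc a" r]
      by (intro that[of "take (b - Suc a) r" "r ! (b - Suc a)" "drop (Suc (b - Suc a)) r"]) auto
    have t: "transpose a b permutes {..<length xs}"
      using ab by (intro permutes_swap_id) auto
    have b: "b = length as + Suc (length bs)"
      using ab 1 2 by simp
    have "permute_list (transpose a b) xs = as @ y # bs @ x # cs"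
    proof (rule nth_equalityI)
      fix i assume "i < length (permute_list (transpose a b) xs)"
      then have "permute_list (transpose a b) xs ! i = xs ! transpose a b i"
        by (intro permute_list_nth[OF t]) simp
      then show "permute_list (transpose a b) xs ! i = (as @ y # bs @ x # cs) ! i"
        unfolding 1(1) 2(1) b 1(2)[symmetric]
        by (cases i "length as + Suc (length bs)" rule: linorder_cases)
          (auto simp: nth_append transpose_def nth_Cons')
    qed (use 1 2 in auto)
    then show ?thesis
      using swap[of as y bs x cs] 1(1) 2(1) by simp
  qed
  fix xs :: "'a list" and \<pi> assume "\<pi> permutes {..<length xs}"
  then have "\<forall>ys. length ys = length xs \<longrightarrow> c (permute_list \<pi> ys) = sign \<pi> * c ys"
    using finite_lessThan
  proof (induction rule: permutes_induct)
    case (swap a b p)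
    have "sign (transpose a b \<circ> p) = - sign p"
      using swap by (subst sign_compose)
        (auto simp: sign_swap_id permutation_swap_id intro: permutes_imp_permutation[OF finite_lessThan])
    moreover have "c (permute_list (transpose a b) ys) = - c ys" if "length ys = length xs" for ys
      using swap transp[of a b ys] transp[of b a ys] that by (cases a b rule: linorder_cases) (auto simp: transpose_commute)
    ultimately have "c (permute_list (transpose a b \<circ> p) ys) = sign (transpose a b \<circ> p) * c ys"
      if "length ys = length xs" for ys
      using swap(3-5) that by (subst permute_list_compose) simp_all
    then show ?case
      by blast
  qed simp
  then show "c (permute_list \<pi> xs) = sign \<pi> * c xs"
    by blast
qed

text \<open>
  Contraction with a vertex and exterior multiplication by a vertex. The recursion for \<open>cone\<close> is the
  rule \<open>contract x (cone v c) = [x = v] c - cone v (contract x c)\<close>, so that \<open>cone v c\<close> is the signed sum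
  over the positions of \<open>v\<close>. The boundary is the sum of all contractions, and every boundary
  computation below is a computation with the anticommutation rules of these operators.
\<close>

definition contract :: "'a \<Rightarrow> ('a list \<Rightarrow> int) \<Rightarrow> 'a list \<Rightarrow> int"
  where "contract v c = (\<lambda>xs. c (v # xs))"

fun cone :: "'a \<Rightarrow> ('a list \<Rightarrow> int) \<Rightarrow> 'a list \<Rightarrow> int"
  where "cone v c [] = 0"
  | "cone v c (x # xs) = (if x = v then c xs else 0) - cone v (contract x c) xs"

lemma contract_apply [simp]: "contract v c xs = c (v # xs)"
  by (simp add: contract_def)

lemma contract_add: "contract v (c + d) = contract v c + contract v d"
  by (simp add: fun_eq_iff)

lemma cone_add: "cone v (c + d) = cone v c + cone v d"
proof
  show "cone v (c + d) xs = (cone v c + cone v d) xs" for xs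
    by (induction xs arbitrary: c d) (auto simp: contract_add)
qed

interpretation contract: additive "contract v"
  by standard (rule contract_add)

interpretation cone: additive "cone v"
  by standard (rule cone_add)

definition smul :: "int \<Rightarrow> ('a list \<Rightarrow> int) \<Rightarrow> 'a list \<Rightarrow> int" (infixr "\<odot>" 75)
  where "a \<odot> c = (\<lambda>xs. a * c xs)"

lemma smul_apply [simp]: "(a \<odot> c) xs = a * c xs"
  by (simp add: smul_def)

lemma smul_simps [simp]: "1 \<odot> c = c" "0 \<odot> c = 0" "a \<odot> 0 = 0" "(-a) \<odot> c = - (a \<odot> c)" "a \<odot> b \<odot> c = (a * b) \<odot> c"
  by (auto simp: fun_eq_iff)

lemma smul_distribs: "a \<odot> (c + d) = a \<odot> c + a \<odot> d" "a \<odot> (c - d) = a \<odot> c - a \<odot> d"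
  "(a + b) \<odot> c = a \<odot> c + b \<odot> c" "(a - b) \<odot> c = a \<odot> c - b \<odot> c" "a \<odot> (- c) = - (a \<odot> c)"
  by (auto simp: fun_eq_iff algebra_simps)

lemma smul_sum: "a \<odot> (\<Sum>i\<in>I. f i) = (\<Sum>i\<in>I. a \<odot> f i)"
  by (auto simp: fun_eq_iff sum_fun_apply sum_distrib_left)

lemma contract_smul: "contract v (a \<odot> c) = a \<odot> contract v c"
  by (simp add: fun_eq_iff)

lemma cone_smul: "cone v (a \<odot> c) = a \<odot> cone v c"
proof
  show "cone v (a \<odot> c) xs = (a \<odot> cone v c) xs" for xs
    by (induction xs arbitrary: c) (auto simp: contract_smul algebra_simps)
qed

lemma contract_cone: "contract x (cone v c) = (if x = v then c else 0) - cone v (contract x c)"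
  by (auto simp: fun_eq_iff)

lemma cone_cone: "cone v (cone w c) = - cone w (cone v c)"
proof
  show "cone v (cone w c) xs = (- cone w (cone v c)) xs" for xs
    by (induction xs arbitrary: c) (auto simp: contract_cone cone.diff cone.zero)
qed

lemma alternating_contract_contract: "alternating c \<Longrightarrow> contract x (contract y c) = - contract y (contract x c)"
  using alternating_swap[of c "[]" x y] by (intro ext) simp

lemma alternating_contract: "alternating c \<Longrightarrow> alternating (contract v c)"
  by (rule alternatingI) (metis append_Cons alternating_swap contract_apply)

lemma alternating_cone:
  assumes "alternating c"
  shows "alternating (cone v c)"
proof (rule alternatingI)
  show "cone v c (as @ y # x # bs) = - cone v c (as @ x # y # bs)" for as x y bs
    using assms
  proof (induction as arbitrary: c)
    case Nil
    have "contract y (cone v c) = (if y = v then c else 0) - cone v (contract y c)" for y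
      by (rule contract_cone)
    then have "contract x (contract y (cone v c)) = - contract y (contract x (cone v c))"
      by (simp add: contract_cone contract.diff contract.zero alternating_contract_contract[OF Nil, of x y] cone.minus)
    then show ?case
      by (simp add: fun_eq_iff del: cone.simps)
  next
    case (Cons a as)
    have "cone v (contract a c) (as @ y # x # bs) = - cone v (contract a c) (as @ x # y # bs)"
      by (intro Cons.IH alternating_contract Cons.prems)
    moreover have "c (as @ y # x # bs) = - c (as @ x # y # bs)"
      by (rule alternating_swap[OF Cons.prems])
    ultimately show ?case
      by simp
  qed
qed

lemma alternating_simps:
  "alternating 0"
  "alternating c \<Longrightarrow> alternating d \<Longrightarrow> alternating (c + d)"
  "alternating c \<Longrightarrow> alternating d \<Longrightarrow> alternating (c - d)"
  "alternating c \<Longrightarrow> alternating (- c)"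
  "alternating c \<Longrightarrow> alternating (a \<odot> c)"
  by (simp_all add: alternating_def ring_distribs mult.left_commute)

lemma cone_nonzeroD: "cone v c xs \<noteq> 0 \<Longrightarrow> \<exists>ys. c ys \<noteq> 0 \<and> mset xs = add_mset v (mset ys)"
proof (induction xs arbitrary: c)
  case (Cons x xs)
  show ?case
  proof (cases "x = v \<and> c xs \<noteq> 0")
    case False
    with Cons.prems have "cone v (contract x c) xs \<noteq> 0"
      by (auto split: if_splits)
    from Cons.IH[OF this] obtain ys where "c (x # ys) \<noteq> 0" "mset xs = add_mset v (mset ys)"
      by auto
    then show ?thesis
      by (intro exI[of _ "x # ys"]) auto
  qed auto
qed simp

abbreviation fsupp :: "('a list \<Rightarrow> int) \<Rightarrow> bool"
  where "fsupp c \<equiv> finite {xs. c xs \<noteq> 0}"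

lemma boundary_eq:
  assumes "finite U" "\<And>xs. c xs \<noteq> 0 \<Longrightarrow> set xs \<subseteq> U"
  shows "boundary c = (\<Sum>v\<in>U. contract v c)"
proof
  show "boundary c xs = (\<Sum>v\<in>U. contract v c) xs" for xs
    unfolding sum_fun_apply contract_apply by (rule boundary_eq_sum) (use assms in fastforce)+
qed

lemma boundary_contract:
  assumes "fsupp c" "alternating c"
  shows "boundary (contract v c) = - contract v (boundary c)"
proof -
  let ?U = "\<Union>(set ` {xs. c xs \<noteq> 0})"
  have 1: "boundary c = (\<Sum>w\<in>?U. contract w c)"
    by (rule boundary_eq) (use assms in auto)
  have 2: "boundary (contract v c) = (\<Sum>w\<in>?U. contract w (contract v c))"
    by (rule boundary_eq) (use assms in force)+
  show ?thesis
    unfolding 1 2 contract.sum by (simp add: alternating_contract_contract[OF assms(2), of _ v] sum_negf)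
qed

lemma boundary_cone:
  assumes "fsupp c"
  shows "boundary (cone v c) = c - cone v (boundary c)"
proof -
  let ?U = "insert v (\<Union>(set ` {xs. c xs \<noteq> 0}))"
  have U: "finite ?U"
    using assms by auto
  have 1: "boundary c = (\<Sum>w\<in>?U. contract w c)"
    by (rule boundary_eq) (use assms in auto)
  have "boundary (cone v c) = (\<Sum>w\<in>?U. contract w (cone v c))"
  proof (rule boundary_eq[OF U])
    fix xs assume "cone v c xs \<noteq> 0"
    then obtain ys where "c ys \<noteq> 0" "mset xs = add_mset v (mset ys)"
      using cone_nonzeroD by metis
    then show "set xs \<subseteq> ?U"
      using mset_eq_setD[of xs "v # ys"] by auto
  qed
  also have "\<dots> = (\<Sum>w\<in>?U. if w = v then c else 0) - (\<Sum>w\<in>?U. cone v (contract w c))"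
    by (simp add: contract_cone sum_subtractf del: sum.insert)
  also have "(\<Sum>w\<in>?U. if w = v then c else 0) = c"
    by (subst sum.delta[OF U]) auto
  finally show ?thesis
    unfolding 1 cone.sum .
qed

lemma boundary_plus: "fsupp c \<Longrightarrow> fsupp d \<Longrightarrow> boundary (c + d) = boundary c + boundary d"
  using boundary_add[of c d] by (simp add: plus_fun_def)

lemma boundary_zero: "boundary 0 = 0"
  by (auto simp: boundary_def fun_eq_iff)

lemma boundary_uminus: "boundary (- c) = - boundary c"
  by (auto simp: boundary_def fun_eq_iff sum_negf)

lemma boundary_smul: "boundary (a \<odot> c) = a \<odot> boundary c"
  by (cases "a = 0") (auto simp: boundary_def fun_eq_iff sum_distrib_left)

text \<open>
  Chains are indexed by the number \<open>s\<close> of vertices instead of the dimension \<open>s - 1\<close>, so that inductions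
  run over natural numbers.
\<close>

definition chains :: "'a set set \<Rightarrow> nat \<Rightarrow> ('a list \<Rightarrow> int) set"
  where "chains K s = oriented_chains K (int s - 1)"

lemma chainsD:
  assumes "c \<in> chains K s"
  shows "fsupp c" "alternating c" "c xs \<noteq> 0 \<Longrightarrow> distinct xs" "c xs \<noteq> 0 \<Longrightarrow> set xs \<in> K"
    "c xs \<noteq> 0 \<Longrightarrow> length xs = s"
  using assms by (force simp: chains_def oriented_chains_def)+

lemma chainsI:
  assumes "finite K" "\<And>F. F \<in> K \<Longrightarrow> finite F" "alternating c"
    "\<And>xs. c xs \<noteq> 0 \<Longrightarrow> distinct xs \<and> set xs \<in> K \<and> length xs = s"
  shows "c \<in> chains K s"
proof -
  have "{xs. c xs \<noteq> 0} \<subseteq> {xs. set xs \<subseteq> \<Union>K \<and> length xs = s}"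
    using assms(4) by blast
  then have "fsupp c"
    by (rule finite_subset) (use assms in \<open>auto intro!: finite_lists_length_eq\<close>)
  then show ?thesis
    using assms by (auto simp: chains_def oriented_chains_def)
qed

lemma chains_zero: "0 \<in> chains K s"
  by (auto simp: chains_def oriented_chains_def alternating_simps)

lemma chains_add: "c \<in> chains K s \<Longrightarrow> d \<in> chains K s \<Longrightarrow> c + d \<in> chains K s"
  unfolding chains_def plus_fun_def by (rule oriented_chains_add)

lemma chains_smul: "c \<in> chains K s \<Longrightarrow> a \<odot> c \<in> chains K s"
  by (auto simp: chains_def oriented_chains_def alternating_simps elim: rev_finite_subset)

lemma chains_uminus: "c \<in> chains K s \<Longrightarrow> - c \<in> chains K s"
  using chains_smul[of c K s "-1"] by simp

lemma chains_diff: "c \<in> chains K s \<Longrightarrow> d \<in> chains K s \<Longrightarrow> c - d \<in> chains K s"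
  using chains_add[OF _ chains_uminus, of c K s d] by simp

lemma chains_sum: "(\<And>i. i \<in> I \<Longrightarrow> f i \<in> chains K s) \<Longrightarrow> (\<Sum>i\<in>I. f i) \<in> chains K s"
  by (induction I rule: infinite_finite_induct) (auto simp: chains_zero chains_add)

lemma chains_mono: "c \<in> chains K s \<Longrightarrow> K \<subseteq> K' \<Longrightarrow> c \<in> chains K' s"
  by (auto simp: chains_def oriented_chains_def)

lemma boundary_chain_add: "c \<in> chains K s \<Longrightarrow> d \<in> chains K t \<Longrightarrow> boundary (c + d) = boundary c + boundary d"
  by (simp add: boundary_plus chainsD)

lemma boundary_chain_diff: "c \<in> chains K s \<Longrightarrow> d \<in> chains K t \<Longrightarrow> boundary (c - d) = boundary c - boundary d"
  using boundary_chain_add[of c K s "- d" t] chains_uminus[of d K t] by (simp add: boundary_uminus)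

lemma boundary_chain_sum: "(\<And>i. i \<in> I \<Longrightarrow> f i \<in> chains K s) \<Longrightarrow> boundary (\<Sum>i\<in>I. f i) = (\<Sum>i\<in>I. boundary (f i))"
proof (induction I rule: infinite_finite_induct)
  case (insert i I)
  then show ?case
    using boundary_chain_add[OF insert(4) chains_sum, of i I f] by (auto simp: plus_fun_def)
qed (auto simp: boundary_zero)

lemma boundary_chain_contract: "c \<in> chains K s \<Longrightarrow> boundary (contract v c) = - contract v (boundary c)"
  by (simp add: boundary_contract chainsD)

lemma boundary_chain_cone: "c \<in> chains K s \<Longrightarrow> boundary (cone v c) = c - cone v (boundary c)"
  by (simp add: boundary_cone chainsD)

lemma boundary_boundary_chain: "c \<in> chains K s \<Longrightarrow> boundary (boundary c) = 0"
  using boundary_boundary[of c] by (simp add: chainsD zero_fun_def)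

definition Cyc :: "'a set set \<Rightarrow> nat \<Rightarrow> ('a list \<Rightarrow> int) set"
  where "Cyc K s = {c \<in> chains K s. boundary c = 0}"

definition Bd :: "'a set set \<Rightarrow> nat \<Rightarrow> ('a list \<Rightarrow> int) set"
  where "Bd K s = boundary ` chains K (Suc s)"

lemma Cyc_zero: "0 \<in> Cyc K s"
  and Cyc_add: "c \<in> Cyc K s \<Longrightarrow> d \<in> Cyc K s \<Longrightarrow> c + d \<in> Cyc K s"
  and Cyc_diff: "c \<in> Cyc K s \<Longrightarrow> d \<in> Cyc K s \<Longrightarrow> c - d \<in> Cyc K s"
  and Cyc_uminus: "c \<in> Cyc K s \<Longrightarrow> - c \<in> Cyc K s"
  and Cyc_smul: "c \<in> Cyc K s \<Longrightarrow> a \<odot> c \<in> Cyc K s"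
  by (auto simp: Cyc_def chains_zero chains_add chains_diff chains_uminus chains_smul boundary_zero boundary_chain_add boundary_chain_diff
      boundary_uminus boundary_smul)

lemma Cyc_sum: "(\<And>i. i \<in> I \<Longrightarrow> f i \<in> Cyc K s) \<Longrightarrow> (\<Sum>i\<in>I. f i) \<in> Cyc K s"
  by (induction I rule: infinite_finite_induct) (auto simp: Cyc_zero Cyc_add)

lemma Cyc_mono: "c \<in> Cyc K s \<Longrightarrow> K \<subseteq> K' \<Longrightarrow> c \<in> Cyc K' s"
  by (auto simp: Cyc_def chains_mono)

lemma Bd_mono: "c \<in> Bd K s \<Longrightarrow> K \<subseteq> K' \<Longrightarrow> c \<in> Bd K' s"
  by (auto simp: Bd_def chains_mono)

lemma Bd_zero: "0 \<in> Bd K s"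
  unfolding Bd_def by (metis boundary_zero chains_zero imageI)

lemma Bd_add: "c \<in> Bd K s \<Longrightarrow> d \<in> Bd K s \<Longrightarrow> c + d \<in> Bd K s"
  unfolding Bd_def using boundary_chain_add[symmetric] chains_add by (fastforce simp del: plus_fun_apply)

lemma Bd_smul: "c \<in> Bd K s \<Longrightarrow> a \<odot> c \<in> Bd K s"
  unfolding Bd_def by (force simp: boundary_smul[symmetric] intro: chains_smul)

lemma Bd_uminus: "c \<in> Bd K s \<Longrightarrow> - c \<in> Bd K s"
  using Bd_smul[of c K s "-1"] by simp

lemma Bd_diff: "c \<in> Bd K s \<Longrightarrow> d \<in> Bd K s \<Longrightarrow> c - d \<in> Bd K s"
  using Bd_add[OF _ Bd_uminus, of c K s d] by simp

lemma Bd_sum: "(\<And>i. i \<in> I \<Longrightarrow> f i \<in> Bd K s) \<Longrightarrow> (\<Sum>i\<in>I. f i) \<in> Bd K s"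
  by (induction I rule: infinite_finite_induct) (auto simp: Bd_zero Bd_add)

lemma Bd_in_Cyc:
  assumes "\<And>F G. F \<in> K \<Longrightarrow> G \<subseteq> F \<Longrightarrow> G \<in> K" "c \<in> Bd K s"
  shows "c \<in> Cyc K s"
proof -
  obtain d where d: "d \<in> chains K (Suc s)" "c = boundary d"
    using assms(2) by (auto simp: Bd_def)
  then have "c \<in> chains K s"
    using boundary_oriented_chains[of d K "int (Suc s) - 1"] assms(1) by (simp add: chains_def)
  then show ?thesis
    using d boundary_boundary_chain by (auto simp: Cyc_def)
qed

section \<open>Homology rank and dual systems\<close>

text \<open>
  Additivity is only required modulo \<open>p\<close> because the functionals are read off from integer coefficients
  that are unique modulo \<open>p\<close>.
\<close>

definition functional :: "'a set set \<Rightarrow> nat \<Rightarrow> int \<Rightarrow> (('a list \<Rightarrow> int) \<Rightarrow> int) \<Rightarrow> bool"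
  where "functional K s p f \<longleftrightarrow>
    (\<forall>c\<in>Cyc K s. \<forall>d\<in>Cyc K s. [f (c + d) = f c + f d] (mod p)) \<and> (\<forall>b\<in>Bd K s. [f b = 0] (mod p))"

text \<open>
  A dual system is a surjection of the homology group onto \<open>(\<int>/p)\<^sup>I\<close>, given together with preimages of the
  unit vectors.
\<close>

definition dual_system where
  "dual_system K s p I x f \<longleftrightarrow> (\<forall>i\<in>I. x i \<in> Cyc K s) \<and> (\<forall>i\<in>I. functional K s p (f i)) \<and>
    (\<forall>i\<in>I. \<forall>j\<in>I. [f i (x j) = of_bool (i = j)] (mod p))"

lemma dual_systemD:
  "dual_system K s p I x f \<Longrightarrow> i \<in> I \<Longrightarrow> j \<in> I \<Longrightarrow> [f i (x j) = of_bool (i = j)] (mod p)"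
  by (simp add: dual_system_def)

text \<open>
  A family of representatives, rather than a set of classes, avoids any statement about which
  representatives are homologous.
\<close>

definition spans :: "'a set set \<Rightarrow> nat \<Rightarrow> nat \<Rightarrow> (nat \<Rightarrow> 'a list \<Rightarrow> int) \<Rightarrow> bool"
  where "spans K s r x \<longleftrightarrow>
    (\<forall>i<r. x i \<in> Cyc K s) \<and> (\<forall>c\<in>Cyc K s. \<exists>a. c - (\<Sum>i<r. a i \<odot> x i) \<in> Bd K s)"

definition finite_complex :: "'a set set \<Rightarrow> bool"
  where "finite_complex K \<longleftrightarrow> finite K \<and> (\<forall>F\<in>K. finite F) \<and> (\<forall>F\<in>K. \<forall>G\<subseteq>F. G \<in> K)"

lemma functional_add:
  "functional K s p f \<Longrightarrow> c \<in> Cyc K s \<Longrightarrow> d \<in> Cyc K s \<Longrightarrow> [f (c + d) = f c + f d] (mod p)"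
  and functional_Bd: "functional K s p f \<Longrightarrow> b \<in> Bd K s \<Longrightarrow> [f b = 0] (mod p)"
  by (auto simp: functional_def)

lemma functional_uminus:
  assumes "functional K s p f" "c \<in> Cyc K s"
  shows "[f (- c) = - f c] (mod p)"
proof -
  have "[f c + f (- c) = f (c + - c)] (mod p)"
    using functional_add[OF assms(1,2) Cyc_uminus[OF assms(2)]] by (rule cong_sym)
  also have "[f (c + - c) = 0] (mod p)"
    using functional_Bd[OF assms(1) Bd_zero] by simp
  finally show ?thesis
    by (simp add: cong_iff_dvd_diff algebra_simps)
qed

lemma functional_diff:
  assumes "functional K s p f" "c \<in> Cyc K s" "d \<in> Cyc K s"
  shows "[f (c - d) = f c - f d] (mod p)"
  using cong_trans[OF functional_add[OF assms(1,2) Cyc_uminus[OF assms(3)]]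
      cong_add[OF cong_refl functional_uminus[OF assms(1,3)]]] by simp

lemma functional_smul:
  assumes f: "functional K s p f" "c \<in> Cyc K s"
  shows "[f (a \<odot> c) = a * f c] (mod p)"
proof (induction a rule: int_induct[where k=0])
  case base
  have "[f (0 \<odot> c) = 0 * f c] (mod p)"
    using functional_Bd[OF f(1) Bd_zero] by simp
  then show ?case .
next
  case (step1 i)
  have "[f (i \<odot> c + c) = i * f c + f c] (mod p)"
    by (rule cong_trans[OF functional_add[OF f(1) Cyc_smul[OF f(2)] f(2)] cong_add[OF step1(2) cong_refl]])
  then have "[f ((i + 1) \<odot> c) = (i + 1) * f c] (mod p)"
    by (simp add: smul_distribs algebra_simps)
  then show ?case .
next
  case (step2 i)
  have "[f (i \<odot> c - c) = i * f c - f c] (mod p)"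
    by (rule cong_trans[OF functional_diff[OF f(1) Cyc_smul[OF f(2)] f(2)] cong_diff[OF step2(2) cong_refl]])
  then have "[f ((i - 1) \<odot> c) = (i - 1) * f c] (mod p)"
    by (simp add: smul_distribs algebra_simps)
  then show ?case .
qed

lemma functional_sum:
  assumes "functional K s p f" "\<And>i. i \<in> I \<Longrightarrow> x i \<in> Cyc K s"
  shows "[f (\<Sum>i\<in>I. x i) = (\<Sum>i\<in>I. f (x i))] (mod p)"
  using assms(2)
proof (induction I rule: infinite_finite_induct)
  case (insert i I)
  have "[f (x i + (\<Sum>i\<in>I. x i)) = f (x i) + (\<Sum>i\<in>I. f (x i))] (mod p)"
    using insert
    by (intro cong_trans[OF functional_add[OF assms(1)] cong_add[OF cong_refl]] Cyc_sum) auto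
  then have "[f (\<Sum>i\<in>insert i I. x i) = (\<Sum>i\<in>insert i I. f (x i))] (mod p)"
    using insert(1,2) by simp
  then show ?case .
next
  case (infinite I)
  then have "[f (\<Sum>i\<in>I. x i) = (\<Sum>i\<in>I. f (x i))] (mod p)"
    using functional_Bd[OF assms(1) Bd_zero] by simp
  then show ?case .
next
  case empty
  have "[f (\<Sum>i\<in>{}. x i) = (\<Sum>i\<in>{}. f (x i))] (mod p)"
    using functional_Bd[OF assms(1) Bd_zero] by simp
  then show ?case .
qed

lemma functional_lincomb:
  assumes "functional K s p f" "\<And>i. i \<in> I \<Longrightarrow> x i \<in> Cyc K s"
  shows "[f (\<Sum>i\<in>I. a i \<odot> x i) = (\<Sum>i\<in>I. a i * f (x i))] (mod p)"
  by (rule cong_trans[OF functional_sum[OF assms(1)] cong_sum])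
    (auto intro: Cyc_smul functional_smul assms)

lemma functional_cong_Bd:
  assumes "functional K s p f" "c \<in> Cyc K s" "d \<in> Cyc K s" "c - d \<in> Bd K s"
  shows "[f c = f d] (mod p)"
  using cong_trans[OF cong_sym[OF functional_diff[OF assms(1-3)]] functional_Bd[OF assms(1,4)]]
  by (simp add: cong_iff_dvd_diff)

text \<open>
  The \<open>p\<^sup>r\<close> combinations of \<open>r\<close> vectors with coefficients modulo \<open>p\<close> have to cover all \<open>p^card I\<close> residue
  vectors. Counting works for composite \<open>p\<close> too, where dimensions are not available.
\<close>

lemma mod_span_count:
  fixes v :: "nat \<Rightarrow> 'i \<Rightarrow> int"
  assumes p: "p \<ge> 2" and I: "finite I"
    and unit: "\<And>j. j \<in> I \<Longrightarrow> \<exists>a. \<forall>i\<in>I. [(\<Sum>k<r. a k * v k i) = of_bool (i = j)] (mod p)"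
  shows "card I \<le> r"
proof -
  obtain A where A: "\<And>i j. i \<in> I \<Longrightarrow> j \<in> I \<Longrightarrow> [(\<Sum>k<r. A j k * v k i) = of_bool (i = j)] (mod p)"
    using unit by metis
  let ?\<Psi> = "\<lambda>a. restrict (\<lambda>i. (\<Sum>k<r. a k * v k i) mod p) I"
  have "(I \<rightarrow>\<^sub>E {0..<p}) \<subseteq> ?\<Psi> ` ({..<r} \<rightarrow>\<^sub>E {0..<p})"
  proof
    fix e assume e: "e \<in> (I \<rightarrow>\<^sub>E {0..<p})"
    let ?a = "restrict (\<lambda>k. (\<Sum>j\<in>I. e j * A j k) mod p) {..<r}"
    have "(\<Sum>k<r. ?a k * v k i) mod p = e i" if i: "i \<in> I" for i
    proof -
      have "[(\<Sum>k<r. ?a k * v k i) = (\<Sum>k<r. (\<Sum>j\<in>I. e j * A j k) * v k i)] (mod p)"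
        by (intro cong_sum cong_mult) (auto simp: cong_def)
      also have "(\<Sum>k<r. (\<Sum>j\<in>I. e j * A j k) * v k i) = (\<Sum>j\<in>I. e j * (\<Sum>k<r. A j k * v k i))"
        by (simp add: sum_distrib_left sum_distrib_right mult.assoc sum.swap[of _ "{..<r}"])
      also have "[\<dots> = (\<Sum>j\<in>I. e j * of_bool (i = j))] (mod p)"
        by (intro cong_sum cong_mult A i) auto
      also have "(\<Sum>j\<in>I. e j * of_bool (i = j)) = e i"
        using I i by (simp add: of_bool_def if_distrib sum.delta' cong: if_cong)
      finally show ?thesis
        using e i by (auto simp: cong_def PiE_def Pi_def)
    qed
    then have "e = ?\<Psi> ?a"
      using e by (intro ext) (auto simp: PiE_def extensional_def)
    moreover have "?a \<in> ({..<r} \<rightarrow>\<^sub>E {0..<p})"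
      using p by auto
    ultimately show "e \<in> ?\<Psi> ` ({..<r} \<rightarrow>\<^sub>E {0..<p})"
      by blast
  qed
  then have "card (I \<rightarrow>\<^sub>E {0..<p}) \<le> card ({..<r} \<rightarrow>\<^sub>E {0..<p})"
    by (rule surj_card_le[rotated]) (auto intro: finite_PiE)
  then have "nat p ^ card I \<le> nat p ^ r"
    using I by (simp add: card_PiE)
  then show ?thesis
    by (subst (asm) power_increasing_iff) (use p in auto)
qed

text \<open>
  The rank of a group is a least number of generators, which says something only if there are finite
  generating sets. By induction on the support: the values at one list form a subgroup of the
  integers, and an element whose value there is the least positive one, together with generators of the
  subgroup of elements that vanish there, generates everything.
\<close>

lemma finitely_generated_subgroup:
  fixes Z :: "('a list \<Rightarrow> int) set"
  assumes "finite X" "0 \<in> Z" "\<And>c d. c \<in> Z \<Longrightarrow> d \<in> Z \<Longrightarrow> c + d \<in> Z" "\<And>a c. c \<in> Z \<Longrightarrow> a \<odot> c \<in> Z"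
    "\<And>c xs. c \<in> Z \<Longrightarrow> xs \<notin> X \<Longrightarrow> c xs = 0"
  shows "\<exists>r x. (\<forall>i<r. x i \<in> Z) \<and> (\<forall>c\<in>Z. \<exists>a. c = (\<Sum>i<r::nat. a i \<odot> x i))"
  using assms
proof (induction X arbitrary: Z rule: finite_induct)
  case empty
  have "c = 0" if "c \<in> Z" for c
    using empty(4)[OF that] by (auto simp: fun_eq_iff)
  then have "\<forall>c\<in>Z. \<exists>a. c = (\<Sum>i<0::nat. a i \<odot> (undefined::nat \<Rightarrow> 'a list \<Rightarrow> int) i)"
    by simp
  then show ?case
    by blast
next
  case (insert y X)
  show ?case
  proof (cases "\<forall>c\<in>Z. c y = 0")
    case True
    have zero: "c xs = 0" if "c \<in> Z" "xs \<notin> X" for c xs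
      using True insert.prems(4)[of c xs] that by (cases "xs = y") auto
    show ?thesis
      by (rule insert.IH) (fact insert.prems(1-3) zero)+
  next
    case False
    define P where "P n \<longleftrightarrow> n > 0 \<and> (\<exists>c\<in>Z. c y = int n)" for n
    obtain c where "c \<in> Z" "c y \<noteq> 0"
      using False by auto
    then have "P (nat \<bar>c y\<bar>)"
      unfolding P_def
    proof (intro conjI bexI)
      show "sgn (c y) \<odot> c \<in> Z"
        by (rule insert.prems(3)) fact
    qed (use \<open>c y \<noteq> 0\<close> in \<open>auto simp: sgn_if\<close>)
    then have "P (LEAST n. P n)" and least: "\<And>n. P n \<Longrightarrow> (LEAST n. P n) \<le> n"
      by (auto intro: LeastI Least_le)
    from this(1) have "(LEAST n. P n) > 0 \<and> (\<exists>c\<in>Z. c y = int (LEAST n. P n))"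
      by (simp only: P_def)
    then obtain c0 where "(LEAST n. P n) > 0" "c0 \<in> Z" "c0 y = int (LEAST n. P n)"
      by blast
    then have c0: "c0 \<in> Z" "c0 y > 0" "c0 y = int (LEAST n. P n)"
      by simp_all
    let ?Z = "{c \<in> Z. c y = 0}"
    have "\<exists>r x. (\<forall>i<r. x i \<in> ?Z) \<and> (\<forall>c\<in>?Z. \<exists>a. c = (\<Sum>i<r::nat. a i \<odot> x i))"
    proof (rule insert.IH)
      show "c xs = 0" if "c \<in> ?Z" "xs \<notin> X" for c xs
        using that insert.prems(4)[of c xs] by (cases "xs = y") auto
    qed (use insert.prems(1-3) in auto)
    then obtain r x where x: "\<forall>i<r. x i \<in> ?Z"
      "\<forall>c\<in>?Z. \<exists>a. c = (\<Sum>i<r::nat. a i \<odot> x i)"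
      by (elim exE conjE)
    have "\<exists>a. c = (\<Sum>i<Suc r. a i \<odot> (x(r := c0)) i)" if c: "c \<in> Z" for c
    proof -
      let ?q = "c y div c0 y"
      let ?d = "c + (- ?q) \<odot> c0"
      have d: "?d \<in> Z"
        using c c0 insert.prems by blast
      have dy: "?d y = c y mod c0 y"
        by (simp add: minus_div_mult_eq_mod)
      have "?d y = 0"
      proof (rule ccontr)
        assume "?d y \<noteq> 0"
        moreover have "0 \<le> ?d y" "?d y < c0 y"
          unfolding dy using c0(2) by auto
        ultimately have "P (nat (?d y))"
          using d unfolding P_def by (intro conjI bexI[of _ ?d]) auto
        from least[OF this] c0(3) \<open>0 \<le> ?d y\<close> \<open>?d y < c0 y\<close> show False
          by simp
      qed
      with d have "?d \<in> ?Z"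
        by simp
      from bspec[OF x(2) this] obtain a where a: "?d = (\<Sum>i<r. a i \<odot> x i)" ..
      have "c = ?d + ?q \<odot> c0"
        by (simp add: fun_eq_iff)
      also have "\<dots> = (\<Sum>i<Suc r. (a(r := ?q)) i \<odot> (x(r := c0)) i)"
        unfolding a by simp
      finally show ?thesis
        by (rule exI[where x="a(r := ?q)"])
    qed
    then have "\<forall>c\<in>Z. \<exists>a. c = (\<Sum>i<Suc r. a i \<odot> (x(r := c0)) i)" ..
    moreover have "\<forall>i<Suc r. (x(r := c0)) i \<in> Z"
      using x(1) c0(1) by (simp add: less_Suc_eq)
    ultimately have "(\<forall>i<Suc r. (x(r := c0)) i \<in> Z) \<and> (\<forall>c\<in>Z. \<exists>a. c = (\<Sum>i<Suc r. a i \<odot> (x(r := c0)) i))"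
      by (rule conjI[rotated])
    then show ?thesis
      by (intro exI[where x="Suc r"] exI[where x="x(r := c0)"])
  qed
qed

lemma ex_spans:
  assumes "finite_complex K"
  shows "\<exists>r x. spans K s r x"
proof -
  let ?X = "{xs. set xs \<subseteq> \<Union>K \<and> length xs = s}"
  have 1: "finite ?X"
    using assms by (intro finite_lists_length_eq) (auto simp: finite_complex_def)
  have 2: "c xs = 0" if "c \<in> Cyc K s" "xs \<notin> ?X" for c xs
    using that chainsD[of c K s] unfolding Cyc_def by blast
  have "\<exists>r x. (\<forall>i<r. x i \<in> Cyc K s) \<and> (\<forall>c\<in>Cyc K s. \<exists>a. c = (\<Sum>i<r::nat. a i \<odot> x i))"
    by (rule finitely_generated_subgroup[of ?X, OF 1]) (auto intro: Cyc_zero Cyc_add Cyc_smul dest: 2)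
  then obtain r x where x: "\<forall>i<r. x i \<in> Cyc K s" "\<forall>c\<in>Cyc K s. \<exists>a. c = (\<Sum>i<r::nat. a i \<odot> x i)"
    by blast
  have "\<exists>a. c - (\<Sum>i<r. a i \<odot> x i) \<in> Bd K s" if "c \<in> Cyc K s" for c
  proof -
    from bspec[OF x(2) that] obtain a where "c = (\<Sum>i<r. a i \<odot> x i)" ..
    then show ?thesis
      by (intro exI[of _ a]) (simp add: Bd_zero)
  qed
  then show ?thesis
    unfolding spans_def using x(1) by blast
qed

lemma image_range_eq_iff:
  assumes "\<And>a. g a \<in> Z"
  shows "f ` range g = f ` Z \<longleftrightarrow> (\<forall>c\<in>Z. \<exists>a. f c = f (g a))"
  using assms by (auto simp: image_iff set_eq_iff)

lemma conj_imp_eq: "P \<Longrightarrow> Q = (P \<and> Q)"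
  by simp

abbreviation homology_rank :: "'a set set \<Rightarrow> nat \<Rightarrow> nat"
  where "homology_rank K s \<equiv> generator_rank (reduced_simplicial_homology K (int s - 1))"

text \<open>
  The homology group is a quotient of locale-style groups; the following lemmas express its generating sets
  by families of cycles.
\<close>

context
  fixes K :: "'a set set" and s :: nat
  assumes K: "finite_complex K"
begin

abbreviation "G \<equiv> (chain_group K (int s - 1))\<lparr>carrier := cycles K (int s - 1)\<rparr>"

lemma carrier_G: "carrier G = Cyc K s"
  by (auto simp: cycles_def kernel_def Cyc_def chain_group_def chains_def zero_fun_def)

lemma mult_G: "c \<otimes>\<^bsub>G\<^esub> d = c + d"
  by (simp add: chain_group_def plus_fun_def)

lemma one_G: "\<one>\<^bsub>G\<^esub> = 0"
  by (simp add: chain_group_def zero_fun_def)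

lemma comm_group_G: "comm_group G"
proof (rule comm_groupI)
  fix c assume "c \<in> carrier G"
  then show "\<exists>d\<in>carrier G. d \<otimes>\<^bsub>G\<^esub> c = \<one>\<^bsub>G\<^esub>"
    unfolding carrier_G mult_G one_G by (intro bexI[of _ "- c"]) (auto intro: Cyc_uminus)
qed (simp_all only: carrier_G mult_G one_G Cyc_add Cyc_zero ac_simps add_0 add_0_right)

interpretation G: comm_group G
  by (rule comm_group_G)

lemma inv_G: "c \<in> Cyc K s \<Longrightarrow> inv\<^bsub>G\<^esub> c = - c"
  by (rule G.inv_equality) (auto simp only: carrier_G mult_G one_G Cyc_uminus, simp)

lemma boundaries_eq: "boundaries K (int s - 1) = Bd K s"
  by (simp add: boundaries_def Bd_def chains_def chain_group_def)

lemma Bd_Cyc: "c \<in> Bd K s \<Longrightarrow> c \<in> Cyc K s"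
  using K by (intro Bd_in_Cyc) (auto simp: finite_complex_def)

lemma normal_Bd: "normal (Bd K s) G"
proof (rule G.subgroup_imp_normal, rule G.subgroupI)
  show "Bd K s \<noteq> {}"
    using Bd_zero by blast
  show "inv\<^bsub>G\<^esub> c \<in> Bd K s" if "c \<in> Bd K s" for c
    using that by (subst inv_G) (auto intro: Bd_uminus Bd_Cyc)
qed (auto simp only: carrier_G mult_G Bd_Cyc Bd_add)

abbreviation cls :: "('a list \<Rightarrow> int) \<Rightarrow> ('a list \<Rightarrow> int) set"
  where "cls c \<equiv> Bd K s #>\<^bsub>G\<^esub> c"

lemma cls: "group_hom G (reduced_simplicial_homology K (int s - 1)) cls"
  unfolding reduced_simplicial_homology_def boundaries_eq
  using normal.r_coset_hom_Mod[OF normal_Bd] normal.factorgroup_is_group[OF normal_Bd] G.group_axioms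
  by (simp add: group_hom_def group_hom_axioms_def)

lemma cls_eq_iff:
  assumes "c \<in> Cyc K s" "d \<in> Cyc K s"
  shows "cls c = cls d \<longleftrightarrow> c - d \<in> Bd K s"
proof -
  have mem: "b \<in> cls c \<longleftrightarrow> b - c \<in> Bd K s" for b c
  proof
    assume "b \<in> cls c"
    then show "b - c \<in> Bd K s"
      by (auto simp only: r_coset_def mult_G UN_iff insert_iff empty_iff add_diff_cancel_right')
  next
    assume "b - c \<in> Bd K s"
    moreover have "b = (b - c) + c"
      by simp
    ultimately show "b \<in> cls c"
      unfolding r_coset_def mult_G by blast
  qed
  show ?thesis
  proof
    assume "cls c = cls d"
    moreover have "c \<in> cls c"
      unfolding mem using Bd_zero by simp
    ultimately show "c - d \<in> Bd K s"
      using mem by simp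
  next
    assume cd: "c - d \<in> Bd K s"
    have "b - c \<in> Bd K s \<longleftrightarrow> b - d \<in> Bd K s" for b
    proof -
      have "b - d = (b - c) + (c - d)" "b - c = (b - d) - (c - d)"
        by simp_all
      then show ?thesis
        using Bd_add[OF _ cd, of "b - c"] Bd_diff[OF _ cd, of "b - d"] by metis
    qed
    then show "cls c = cls d"
      unfolding set_eq_iff mem by blast
  qed
qed

lemma carrier_H: "carrier (reduced_simplicial_homology K (int s - 1)) = cls ` Cyc K s"
  unfolding reduced_simplicial_homology_def boundaries_eq FactGroup_def RCOSETS_def
  using carrier_G by auto

lemma generate_G:
  assumes "\<And>i. i < r \<Longrightarrow> x i \<in> Cyc K s"
  shows "generate G (x ` {..<r::nat}) = range (\<lambda>a. \<Sum>i<r. a i \<odot> x i)" (is "?L = ?R")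
proof
  have sub: "x ` {..<r} \<subseteq> carrier G"
    using assms unfolding carrier_G by auto
  have Z: "c \<in> Cyc K s" if "c \<in> ?L" for c
    using G.generate_in_carrier[OF sub that] unfolding carrier_G .
  have smul: "a \<odot> c \<in> ?L" if c: "c \<in> ?L" for a c
  proof (induction a rule: int_induct[where k=0])
    case base
    have "0 \<odot> c \<in> ?L"
      using generate.one[of G "x ` {..<r}"] unfolding one_G by simp
    then show ?case .
  next
    case (step1 i)
    then have "(i + 1) \<odot> c \<in> ?L"
      using generate.eng[OF step1(2) c] unfolding mult_G by (simp add: smul_distribs)
    then show ?case .
  next
    case (step2 i)
    have "- c \<in> ?L"
      using G.generate_m_inv_closed[OF sub c] inv_G[OF Z[OF c]] by simp
    then have "i \<odot> c + (- c) \<in> ?L"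
      using generate.eng[OF step2(2), of "- c"] unfolding mult_G by simp
    then have "(i - 1) \<odot> c \<in> ?L"
      by (simp add: smul_distribs)
    then show ?case .
  qed
  have "(\<Sum>i\<in>J. a i \<odot> x i) \<in> ?L" if "finite J" "J \<subseteq> {..<r}" for J a
    using that
  proof (induction J rule: finite_induct)
    case empty
    have "(\<Sum>i\<in>{}. a i \<odot> x i) \<in> ?L"
      using generate.one[of G "x ` {..<r}"] unfolding one_G by simp
    then show ?case .
  next
    case (insert j J)
    have "x j \<in> ?L"
      using insert.prems by (intro generate.incl) auto
    then have "a j \<odot> x j + (\<Sum>i\<in>J. a i \<odot> x i) \<in> ?L"
      using generate.eng[OF smul, of "x j" "\<Sum>i\<in>J. a i \<odot> x i"] insert unfolding mult_G by blast
    then have "(\<Sum>i\<in>insert j J. a i \<odot> x i) \<in> ?L"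
      using insert(1,2) by simp
    then show ?case .
  qed
  then show "?R \<subseteq> ?L"
    by auto
  show "?L \<subseteq> ?R"
  proof
    fix c assume "c \<in> ?L"
    then show "c \<in> ?R"
    proof (induction rule: generate.induct)
      case one
      have "\<one>\<^bsub>G\<^esub> = (\<Sum>i<r. 0 \<odot> x i)"
        unfolding one_G by simp
      then show ?case
        by (rule image_eqI[where x="\<lambda>_. 0"]) simp
    next
      case (incl h)
      then obtain j where j: "j < r" "h = x j"
        by auto
      have "(\<Sum>i<r. of_bool (i = j) \<odot> x i) = (\<Sum>i<r. if i = j then x i else 0)"
        by (intro sum.cong) auto
      also have "\<dots> = h"
        using j by simp
      finally have "h = (\<Sum>i<r. of_bool (i = j) \<odot> x i)" ..
      then show ?case
        by (rule image_eqI[where x="\<lambda>i. of_bool (i = j)"]) simp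
    next
      case (inv h)
      then obtain j where j: "j < r" "h = x j"
        by auto
      have "(\<Sum>i<r. (- of_bool (i = j)) \<odot> x i) = (\<Sum>i<r. if i = j then - x i else 0)"
        by (intro sum.cong) auto
      also have "\<dots> = - h"
        using j by simp
      finally have "inv\<^bsub>G\<^esub> h = (\<Sum>i<r. (- of_bool (i = j)) \<odot> x i)"
        using inv_G[of h] assms[of j] j by simp
      then show ?case
        by (rule image_eqI[where x="\<lambda>i. - of_bool (i = j)"]) simp
    next
      case (eng h1 h2)
      from eng(3) obtain a where "h1 = (\<Sum>i<r. a i \<odot> x i)" ..
      moreover from eng(4) obtain b where "h2 = (\<Sum>i<r. b i \<odot> x i)" ..
      ultimately have "h1 \<otimes>\<^bsub>G\<^esub> h2 = (\<Sum>i<r. (a i + b i) \<odot> x i)"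
        unfolding mult_G by (simp add: smul_distribs sum.distrib)
      then show ?case
        by (rule image_eqI[where x="\<lambda>i. a i + b i"]) simp
    qed
  qed
qed

lemma spans_iff_generate:
  assumes "\<And>i. i < r \<Longrightarrow> x i \<in> Cyc K s"
  shows "spans K s r x \<longleftrightarrow>
    generate (reduced_simplicial_homology K (int s - 1)) (cls ` x ` {..<r}) =
    carrier (reduced_simplicial_homology K (int s - 1))"
proof -
  have sub: "x ` {..<r} \<subseteq> carrier G"
    using assms unfolding carrier_G by auto
  have lin: "(\<Sum>i<r. a i \<odot> x i) \<in> Cyc K s" for a
    by (intro Cyc_sum Cyc_smul assms) auto
  have 1: "generate (reduced_simplicial_homology K (int s - 1)) (cls ` x ` {..<r}) =
      cls ` range (\<lambda>a. \<Sum>i<r. a i \<odot> x i)"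
    using group_hom.generate_img[OF cls sub] generate_G[of r x, OF assms] by simp
  have 2: "cls ` range (\<lambda>a. \<Sum>i<r. a i \<odot> x i) = cls ` Cyc K s \<longleftrightarrow>
      (\<forall>c\<in>Cyc K s. \<exists>a. cls c = cls (\<Sum>i<r. a i \<odot> x i))"
    by (rule image_range_eq_iff) (rule lin)
  have 3: "(\<forall>c\<in>Cyc K s. \<exists>a. cls c = cls (\<Sum>i<r. a i \<odot> x i)) \<longleftrightarrow>
      (\<forall>c\<in>Cyc K s. \<exists>a. c - (\<Sum>i<r. a i \<odot> x i) \<in> Bd K s)"
    by (rule ball_cong[OF refl], rule arg_cong[where f=Ex], rule ext, rule cls_eq_iff, assumption, rule lin)
  have 4: "(\<forall>c\<in>Cyc K s. \<exists>a. c - (\<Sum>i<r. a i \<odot> x i) \<in> Bd K s) \<longleftrightarrow> spans K s r x"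
  proof -
    have "\<forall>i<r. x i \<in> Cyc K s"
      using assms by simp
    then show ?thesis
      unfolding spans_def by (rule conj_imp_eq)
  qed
  show ?thesis
    by (simp only: 1 carrier_H 2 3 4)
qed

lemma spans_classes:
  assumes "spans K s r x"
  defines "S \<equiv> cls ` x ` {..<r}"
  shows "S \<subseteq> carrier (reduced_simplicial_homology K (int s - 1)) \<and> finite S \<and> card S = card S \<and>
    generate (reduced_simplicial_homology K (int s - 1)) S =
    carrier (reduced_simplicial_homology K (int s - 1))"
proof (intro conjI)
  have x: "\<And>i. i < r \<Longrightarrow> x i \<in> Cyc K s"
    using assms by (auto simp: spans_def)
  show "S \<subseteq> carrier (reduced_simplicial_homology K (int s - 1))"
    unfolding carrier_H S_def using x by (intro image_mono) auto
  show "generate (reduced_simplicial_homology K (int s - 1)) S =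
    carrier (reduced_simplicial_homology K (int s - 1))"
    unfolding S_def using spans_iff_generate[OF x] assms(1) by (rule iffD1)
qed (auto simp: S_def)

lemma rank_le:
  assumes "spans K s r x"
  shows "homology_rank K s \<le> r"
proof -
  let ?S = "cls ` x ` {..<r}"
  have "homology_rank K s \<le> card ?S"
    unfolding generator_rank_def by (rule Least_le, rule exI, rule spans_classes[OF assms])
  also have "\<dots> \<le> card {..<r}"
    by (intro order_trans[OF card_image_le card_image_le]) auto
  finally show ?thesis
    by simp
qed

lemma rank_attained: "\<exists>x. spans K s (homology_rank K s) x"
proof -
  let ?H = "reduced_simplicial_homology K (int s - 1)"
  let ?P = "\<lambda>k. \<exists>S. S \<subseteq> carrier ?H \<and> finite S \<and> card S = k \<and> generate ?H S = carrier ?H"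
  obtain r x where rx: "spans K s r x"
    using ex_spans[OF K] by blast
  have "?P (card (cls ` x ` {..<r}))"
    by (rule exI, rule spans_classes[OF rx])
  then have "?P (homology_rank K s)"
    unfolding generator_rank_def by (rule LeastI)
  then obtain S where S: "S \<subseteq> carrier ?H" "finite S" "card S = homology_rank K s" "generate ?H S = carrier ?H"
    by blast
  then obtain h where h: "bij_betw h {..<homology_rank K s} S"
    using ex_bij_betw_nat_finite[of S] by (metis atLeast0LessThan)
  have "\<exists>c\<in>Cyc K s. cls c = h i" if "i < homology_rank K s" for i
    using bij_betwE[OF h] that S(1) unfolding carrier_H by blast
  then obtain y where y: "\<And>i. i < homology_rank K s \<Longrightarrow> y i \<in> Cyc K s" "\<And>i. i < homology_rank K s \<Longrightarrow> cls (y i) = h i"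
    by metis
  have "cls ` y ` {..<homology_rank K s} = h ` {..<homology_rank K s}"
    unfolding image_image by (rule image_cong[OF refl]) (rule y(2), simp only: lessThan_iff)
  also have "\<dots> = S"
    using h by (rule bij_betw_imp_surj_on)
  finally have "spans K s (homology_rank K s) y"
    using S(4) by (subst spans_iff_generate[OF y(1)]) auto
  then show ?thesis
    by (rule exI[where x=y])
qed

end

lemma dual_system_le_rank:
  assumes "finite_complex K" "p \<ge> 2" "finite I" "dual_system K s p I x f"
  shows "card I \<le> homology_rank K s"
proof -
  obtain y where y: "spans K s (homology_rank K s) y"
    using rank_attained[OF assms(1)] by blast
  show ?thesis
  proof (rule mod_span_count[OF assms(2,3)])
    fix j assume j: "j \<in> I"
    then have xj: "x j \<in> Cyc K s"
      using assms(4) by (auto simp: dual_system_def)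
    then obtain a where a: "x j - (\<Sum>k<homology_rank K s. a k \<odot> y k) \<in> Bd K s"
      using y by (auto simp: spans_def)
    have "[(\<Sum>k<homology_rank K s. a k * f i (y k)) = of_bool (i = j)] (mod p)" if i: "i \<in> I" for i
    proof -
      have f: "functional K s p (f i)"
        using assms(4) i by (auto simp: dual_system_def)
      have "[(\<Sum>k<homology_rank K s. a k * f i (y k)) = f i (\<Sum>k<homology_rank K s. a k \<odot> y k)] (mod p)"
        by (rule cong_sym, rule functional_lincomb[OF f]) (use y in \<open>auto simp: spans_def\<close>)
      also have "[f i (\<Sum>k<homology_rank K s. a k \<odot> y k) = f i (x j)] (mod p)"
        by (rule cong_sym, rule functional_cong_Bd[OF f xj _ a])
          (use y in \<open>auto simp: spans_def intro!: Cyc_sum Cyc_smul\<close>)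
      also have "[f i (x j) = of_bool (i = j)] (mod p)"
        using assms(4) i j by (auto simp: dual_system_def)
      finally show ?thesis .
    qed
    then show "\<exists>a. \<forall>i\<in>I. [(\<Sum>k<homology_rank K s. a k * f i (y k)) = of_bool (i = j)] (mod p)"
      by blast
  qed
qed

definition lincomb :: "nat \<Rightarrow> (nat \<Rightarrow> 'a list \<Rightarrow> int) \<Rightarrow> (nat \<Rightarrow> int) \<Rightarrow> 'a list \<Rightarrow> int"
  where "lincomb r x a = (\<Sum>i<r. a i \<odot> x i)"

lemma spans_lincomb: "spans K s r x \<longleftrightarrow> (\<forall>i<r. x i \<in> Cyc K s) \<and> (\<forall>c\<in>Cyc K s. \<exists>a. c - lincomb r x a \<in> Bd K s)"
  by (simp only: spans_def lincomb_def)

lemma lincomb_add: "lincomb r x (\<lambda>i. a i + b i) = lincomb r x a + lincomb r x b"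
  and lincomb_diff: "lincomb r x (\<lambda>i. a i - b i) = lincomb r x a - lincomb r x b"
  and lincomb_mult: "lincomb r x (\<lambda>i. q * a i) = q \<odot> lincomb r x a"
  by (simp_all add: lincomb_def smul_distribs sum.distrib sum_subtractf smul_sum)

lemma lincomb_unit: "j < r \<Longrightarrow> lincomb r x (\<lambda>i. of_bool (i = j)) = x j"
proof -
  assume j: "j < r"
  have "lincomb r x (\<lambda>i. of_bool (i = j)) = (\<Sum>i<r. if i = j then x i else 0)"
    unfolding lincomb_def by (intro sum.cong) auto
  then show ?thesis
    using j by simp
qed

lemma lincomb_Cyc: "spans K s r x \<Longrightarrow> lincomb r x a \<in> Cyc K s"
  unfolding lincomb_def spans_def by (intro Cyc_sum Cyc_smul) auto

lemma lincomb_replace: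
  assumes ij: "i < r" "j < r" "i \<noteq> j"
  shows "lincomb r (x(i := x i + q \<odot> x j)) a = lincomb r x (a(j := a j + q * a i))"
proof -
  have split: "lincomb r y b = b i \<odot> y i + (b j \<odot> y j + (\<Sum>k\<in>{..<r} - {i} - {j}. b k \<odot> y k))" for y :: "nat \<Rightarrow> 'b list \<Rightarrow> int" and b
    unfolding lincomb_def using ij by (subst sum.remove[of _ i]; simp; subst sum.remove[of _ j]; simp)
  have "(\<Sum>k\<in>{..<r} - {i} - {j}. a k \<odot> (x(i := x i + q \<odot> x j)) k) =
      (\<Sum>k\<in>{..<r} - {i} - {j}. (a(j := a j + q * a i)) k \<odot> x k)"
    by (intro sum.cong) auto
  then show ?thesis
    unfolding split[of "x(i := x i + q \<odot> x j)"] split[of x] using ij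
    by (simp add: smul_distribs algebra_simps)
qed

text \<open>
  The elementary transformations of a generating family.
\<close>

lemma spans_replace:
  assumes x: "spans K s r x" and ij: "i < r" "j < r" "i \<noteq> j"
  shows "spans K s r (x(i := x i + q \<odot> x j))"
  unfolding spans_lincomb
proof (intro conjI allI impI ballI)
  show "(x(i := x i + q \<odot> x j)) k \<in> Cyc K s" if "k < r" for k
    using x ij that by (auto simp: spans_def intro: Cyc_add Cyc_smul)
  fix c assume "c \<in> Cyc K s"
  then have "\<exists>a. c - lincomb r x a \<in> Bd K s"
    using x by (simp add: spans_lincomb)
  then obtain a where a: "c - lincomb r x a \<in> Bd K s" ..
  have "lincomb r (x(i := x i + q \<odot> x j)) (a(j := a j - q * a i)) = lincomb r x a"
    unfolding lincomb_replace[OF ij] using ij by (intro arg_cong[where f="lincomb r x"]) auto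
  then have "c - lincomb r (x(i := x i + q \<odot> x j)) (a(j := a j - q * a i)) \<in> Bd K s"
    using a by simp
  then show "\<exists>b. c - lincomb r (x(i := x i + q \<odot> x j)) b \<in> Bd K s"
    by (rule exI[where x="a(j := a j - q * a i)"])
qed

text \<open>
  A relation with a unit coefficient makes that generator redundant.
\<close>

lemma spans_remove:
  assumes x: "spans K s r x" and a: "lincomb r x a \<in> Bd K s" "i < r" "\<bar>a i\<bar> = 1"
  shows "\<exists>y. spans K s (r - 1) y"
proof -
  have "finite ({..<r} - {i})" "card ({..<r} - {i}) = r - 1"
    using a by auto
  then obtain h where h: "bij_betw h {..<r - 1} ({..<r} - {i})"
    using ex_bij_betw_nat_finite[of "{..<r} - {i}"] by (auto simp: atLeast0LessThan)
  have "spans K s (r - 1) (\<lambda>k. x (h k))"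
    unfolding spans_lincomb
  proof (intro conjI allI impI ballI)
    show "x (h k) \<in> Cyc K s" if "k < r - 1" for k
      using x bij_betwE[OF h] that by (auto simp: spans_def)
    fix c assume "c \<in> Cyc K s"
    then have "\<exists>b. c - lincomb r x b \<in> Bd K s"
      using x by (simp add: spans_lincomb)
    then obtain b where b: "c - lincomb r x b \<in> Bd K s" ..
    define b' where "b' k = b k - (b i * a i) * a k" for k
    have "b' i = 0"
      using a(3) by (auto simp: b'_def abs_if algebra_simps split: if_splits)
    have "c - lincomb r x b' = (c - lincomb r x b) + (b i * a i) \<odot> lincomb r x a"
      unfolding b'_def lincomb_diff lincomb_mult by simp
    then have "c - lincomb r x b' \<in> Bd K s"
      using Bd_add[OF b Bd_smul[OF a(1)]] by (simp only:)
    moreover have "lincomb r x b' = lincomb (r - 1) (\<lambda>k. x (h k)) (\<lambda>k. b' (h k))"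
    proof -
      have "lincomb r x b' = (\<Sum>k\<in>{..<r} - {i}. b' k \<odot> x k)"
        unfolding lincomb_def using a(2) \<open>b' i = 0\<close> by (subst sum.remove[of _ i]) auto
      also have "\<dots> = (\<Sum>k<r - 1. b' (h k) \<odot> x (h k))"
        by (rule sum.reindex_bij_betw[OF h, symmetric])
      finally show ?thesis
        by (simp only: lincomb_def)
    qed
    ultimately have "c - lincomb (r - 1) (\<lambda>k. x (h k)) (\<lambda>k. b' (h k)) \<in> Bd K s"
      by simp
    then show "\<exists>b. c - lincomb (r - 1) (\<lambda>k. x (h k)) b \<in> Bd K s"
      by (rule exI[where x="\<lambda>k. b' (h k)"])
  qed
  then show ?thesis
    by (rule exI[where x="\<lambda>k. x (h k)"])
qed

text \<open>
  If \<open>p\<close> divides all coefficients of all relations, then the coefficients of a cycle with respect to the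
  generators are unique modulo \<open>p\<close>; they are the functionals of the dual system.
\<close>

lemma dual_of_divisible:
  assumes x: "spans K s r x" and p: "\<And>a i. lincomb r x a \<in> Bd K s \<Longrightarrow> i < r \<Longrightarrow> p dvd a i"
    and K: "finite_complex K"
  shows "\<exists>f. dual_system K s p {..<r} x f"
proof -
  define A where "A c = (SOME a. c - lincomb r x a \<in> Bd K s)" for c
  have A: "c - lincomb r x (A c) \<in> Bd K s" if "c \<in> Cyc K s" for c
  proof -
    have "\<exists>a. c - lincomb r x a \<in> Bd K s"
      using x that by (simp add: spans_lincomb)
    then show ?thesis
      unfolding A_def by (rule someI_ex)
  qed
  have A_eq: "[A c i = a i] (mod p)" if c: "c \<in> Cyc K s" "c - lincomb r x a \<in> Bd K s" "i < r" for c a i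
  proof -
    have "lincomb r x (\<lambda>i. A c i - a i) \<in> Bd K s"
      using Bd_diff[OF c(2) A[OF c(1)]] by (simp add: lincomb_diff)
    from p[OF this c(3)] show ?thesis
      by (simp add: cong_iff_dvd_diff)
  qed
  have "dual_system K s p {..<r} x (\<lambda>i c. A c i)"
    unfolding dual_system_def functional_def
  proof (intro conjI ballI)
    show "x i \<in> Cyc K s" if "i \<in> {..<r}" for i
      using x that by (simp add: spans_def)
    show "[A (c + d) i = A c i + A d i] (mod p)" if "i \<in> {..<r}" "c \<in> Cyc K s" "d \<in> Cyc K s" for i c d
    proof (rule A_eq)
      show "c + d - lincomb r x (\<lambda>i. A c i + A d i) \<in> Bd K s"
        using Bd_add[OF A[OF that(2)] A[OF that(3)]] by (simp add: lincomb_add algebra_simps)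
      show "c + d \<in> Cyc K s"
        by (rule Cyc_add[OF that(2,3)])
    qed (use that in auto)
    show "[A b i = 0] (mod p)" if "i \<in> {..<r}" "b \<in> Bd K s" for i b
    proof (rule A_eq)
      show "b \<in> Cyc K s"
        using that(2) K by (intro Bd_in_Cyc) (auto simp: finite_complex_def)
      show "b - lincomb r x (\<lambda>i. 0) \<in> Bd K s"
        using that(2) by (simp add: lincomb_def)
    qed (use that in auto)
    show "[A (x j) i = of_bool (i = j)] (mod p)" if "i \<in> {..<r}" "j \<in> {..<r}" for i j
    proof (rule A_eq)
      show "x j - lincomb r x (\<lambda>i. of_bool (i = j)) \<in> Bd K s"
        using that by (simp add: lincomb_unit Bd_zero)
    qed (use x that in \<open>auto simp: spans_def\<close>)
  qed
  then show ?thesis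
    by (rule exI[where x="\<lambda>i c. A c i"])
qed

text \<open>
  Among all relations between the members of generating families of the minimal size \<open>r\<close>, let \<open>m\<close> be the least
  absolute value of a nonzero coefficient, attained in some relation of some family. Division with
  remainder in that relation, realised by replacing a generator, shows that \<open>m\<close> divides its other
  coefficients; division by it shows the same for all other relations of the family. If \<open>m\<close> were 1, the family
  could be shortened, so \<open>m\<close> is a possible \<open>p\<close>. If there are no relations at all, any \<open>p\<close> will do.
\<close>

theorem rank_dual_system:
  assumes K: "finite_complex K"
  shows "\<exists>p\<ge>2. \<exists>x f. dual_system K s p {..<homology_rank K s} x f"
proof -
  define r where "r = homology_rank K s"
  define R where "R m \<longleftrightarrow> 0 < m \<and> (\<exists>x a i. spans K s r x \<and> lincomb r x a \<in> Bd K s \<and> i < r \<and> \<bar>a i\<bar> = int m)" for m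
  show ?thesis
  proof (cases "\<exists>m. R m")
    case False
    obtain x where x: "spans K s r x"
      using rank_attained[OF K] unfolding r_def by blast
    have "2 dvd a i" if "lincomb r x a \<in> Bd K s" "i < r" for a i
    proof -
      have "a i = 0"
      proof (rule ccontr)
        assume "a i \<noteq> 0"
        then have "R (nat \<bar>a i\<bar>)"
          unfolding R_def using x that by (intro conjI exI[where x=x] exI[where x=a] exI[where x=i]) auto
        with False show False
          by blast
      qed
      then show ?thesis
        by simp
    qed
    then have "\<exists>f. dual_system K s 2 {..<r} x f"
      by (rule dual_of_divisible[OF x _ K])
    then show ?thesis
      unfolding r_def by (intro exI[where x=2]) auto
  next
    case True
    define m where "m = (LEAST m. R m)"
    have Rm: "R m"
      unfolding m_def using True by (rule LeastI_ex)
    have least: "m \<le> n" if "R n" for n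
      unfolding m_def using that by (rule Least_le)
    have small: "b i = 0" if "spans K s r x" "lincomb r x b \<in> Bd K s" "i < r" "\<bar>b i\<bar> < int m" for x b i
    proof (rule ccontr)
      assume "b i \<noteq> 0"
      then have "R (nat \<bar>b i\<bar>)"
        unfolding R_def using that by (intro conjI exI[where x=x] exI[where x=b] exI[where x=i]) auto
      from least[OF this] that(4) \<open>b i \<noteq> 0\<close> show False
        by simp
    qed
    have row: "int m dvd a j" if x: "spans K s r x" and a: "lincomb r x a \<in> Bd K s" "i < r" "\<bar>a i\<bar> = int m" "j < r" for x a i j
    proof (cases "i = j")
      case True
      then show ?thesis
        using a(3) by (metis abs_dvd_iff dvd_refl)
    next
      case False
      define q where "q = a j div a i"
      define a' where "a' = a(j := a j mod a i)"
      have "lincomb r (x(i := x i + q \<odot> x j)) a' = lincomb r x a"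
        unfolding lincomb_replace[OF a(2) a(4) False]
        using False by (intro arg_cong[where f="lincomb r x"]) (auto simp: a'_def q_def)
      then have "lincomb r (x(i := x i + q \<odot> x j)) a' \<in> Bd K s"
        using a(1) by simp
      moreover have "\<bar>a' j\<bar> < int m"
        using a(3) Rm abs_mod_less[of "a i" "a j"] by (auto simp: a'_def R_def)
      ultimately have "a' j = 0"
        using small[OF spans_replace[OF x a(2) a(4) False]] a(4) by blast
      then have "a i dvd a j"
        by (auto simp: a'_def)
      then show ?thesis
        using a(3) by (metis abs_dvd_iff)
    qed
    obtain x a i where x: "spans K s r x" and a: "lincomb r x a \<in> Bd K s" "i < r" "\<bar>a i\<bar> = int m"
      using Rm unfolding R_def by blast
    have "int m dvd b j" if b: "lincomb r x b \<in> Bd K s" "j < r" for b j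
    proof -
      define q where "q = b i div a i"
      define b1 where "b1 k = b k - q * a k" for k
      have b1: "lincomb r x b1 \<in> Bd K s"
        unfolding b1_def lincomb_diff lincomb_mult by (intro Bd_diff Bd_smul a b)
      have "b1 i = b i mod a i"
        by (simp add: b1_def q_def minus_div_mult_eq_mod)
      then have "\<bar>b1 i\<bar> < int m"
        using a(3) Rm abs_mod_less[of "a i" "b i"] by (auto simp: R_def)
      then have "b1 i = 0"
        using small[OF x b1 a(2)] by simp
      have "lincomb r x (\<lambda>k. b1 k + a k) \<in> Bd K s"
        unfolding lincomb_add by (intro Bd_add a b1)
      moreover have "\<bar>b1 i + a i\<bar> = int m"
        using a(3) \<open>b1 i = 0\<close> by simp
      ultimately have "int m dvd b1 j + a j"
        using row[OF x _ a(2) _ b(2), of "\<lambda>k. b1 k + a k"] by simp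
      moreover have "int m dvd a j"
        using row[OF x a b(2)] .
      moreover have "b j = (b1 j + a j) + (q - 1) * a j"
        by (simp add: b1_def algebra_simps)
      ultimately show ?thesis
        by (metis dvd_add dvd_mult)
    qed
    then have dual: "\<exists>f. dual_system K s (int m) {..<r} x f"
      by (rule dual_of_divisible[OF x _ K])
    have "m \<noteq> 1"
    proof
      assume "m = 1"
      then obtain y where y: "spans K s (r - 1) y"
        using spans_remove[OF x a(1,2)] a(3) by auto
      have "r \<le> r - 1"
        using rank_le[OF K y] by (simp add: r_def)
      with a(2) show False
        by simp
    qed
    then have "int m \<ge> 2"
      using Rm by (auto simp: R_def)
    then show ?thesis
      using dual unfolding r_def by (intro exI[where x="int m"]) auto
  qed
qed

section \<open>Matching complexes\<close>

definition matchings_on :: "'a set set \<Rightarrow> 'a set \<Rightarrow> 'a set set set"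
  where "matchings_on E V = matchings {e \<in> E. e \<subseteq> V}"

lemma matchings_on_iff: "F \<in> matchings_on E V \<longleftrightarrow> (\<forall>e\<in>F. e \<in> E \<and> e \<subseteq> V) \<and> disjoint F"
  by (auto simp: matchings_on_def matchings_def)

lemma matchings_on_mono: "V \<subseteq> W \<Longrightarrow> matchings_on E V \<subseteq> matchings_on E W"
  unfolding matchings_on_iff subset_iff by blast

lemma finite_complex_matchings_on:
  assumes "finite V"
  shows "finite_complex (matchings_on E V)"
  unfolding finite_complex_def
proof (intro conjI ballI allI impI)
  have "matchings_on E V \<subseteq> Pow (Pow V)"
    by (intro subsetI PowI) (meson matchings_on_iff in_mono)
  then show "finite (matchings_on E V)"
    by (rule finite_subset) (use assms in auto)
  show "finite F" if "F \<in> matchings_on E V" for F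
    by (rule finite_subset[of _ "Pow V"]) (use that assms in \<open>auto simp: matchings_on_iff\<close>)
  show "G \<in> matchings_on E V" if "F \<in> matchings_on E V" "G \<subseteq> F" for F G
    using that by (auto simp: matchings_on_def intro: matchings_subset)
qed

lemma matchings_on_chainsI:
  assumes "finite V" "alternating c"
    "\<And>xs. c xs \<noteq> 0 \<Longrightarrow> distinct xs \<and> set xs \<in> matchings_on E V \<and> length xs = s"
  shows "c \<in> chains (matchings_on E V) s"
  using finite_complex_matchings_on[OF assms(1), of E] assms by (intro chainsI) (auto simp: finite_complex_def)

lemma cone_chains:
  assumes V: "finite V" and v: "v \<in> E" "v \<subseteq> V" "v \<noteq> {}" and c: "c \<in> chains (matchings_on E (V - v)) s"
  shows "cone v c \<in> chains (matchings_on E V) (Suc s)"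
proof (rule matchings_on_chainsI[OF V])
  show "alternating (cone v c)"
    using c by (intro alternating_cone chainsD)
  fix xs assume "cone v c xs \<noteq> 0"
  then obtain ys where ys: "c ys \<noteq> 0" "mset xs = mset (v # ys)"
    using cone_nonzeroD by fastforce
  have *: "distinct ys" "set ys \<in> matchings_on E (V - v)" "length ys = s"
    using chainsD[OF c] ys by auto
  have "v \<notin> set ys"
    using *(2) v(3) by (auto simp: matchings_on_iff)
  then have "distinct (v # ys)"
    using * by simp
  then have "distinct xs"
    using ys(2) by (metis mset_eq_imp_distinct_iff)
  moreover have "set xs = insert v (set ys)"
    using mset_eq_setD[OF ys(2)] by simp
  moreover have "insert v (set ys) \<in> matchings_on E V"
    using *(2) v by (force simp: matchings_on_iff pairwise_insert disjnt_def)
  moreover have "length xs = Suc s"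
    using mset_eq_length[OF ys(2)] * by simp
  ultimately show "distinct xs \<and> set xs \<in> matchings_on E V \<and> length xs = Suc s"
    by simp
qed

lemma contract_chains:
  assumes V: "finite V" and c: "c \<in> chains (matchings_on E V) (Suc s)"
  shows "contract v c \<in> chains (matchings_on E (V - v)) s"
proof (rule matchings_on_chainsI)
  show "alternating (contract v c)"
    using c by (intro alternating_contract chainsD)
  fix xs assume "contract v c xs \<noteq> 0"
  then have *: "distinct (v # xs)" "set (v # xs) \<in> matchings_on E V" "length (v # xs) = Suc s"
    using chainsD(3-5)[OF c, of "v # xs"] by simp_all
  then have "set xs \<in> matchings_on E (V - v)"
    by (force simp: matchings_on_iff pairwise_insert disjnt_def)
  then show "distinct xs \<and> set xs \<in> matchings_on E (V - v) \<and> length xs = s"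
    using * by simp
qed (use V in auto)

lemma contract_outside:
  assumes "c \<in> chains (matchings_on E V) s" "\<not> v \<subseteq> V"
  shows "contract v c = 0"
proof -
  have "c (v # xs) = 0" for xs
    using chainsD(4)[OF assms(1), of "v # xs"] assms(2) by (auto simp: matchings_on_iff)
  then show ?thesis
    by (simp add: fun_eq_iff)
qed

lemma contract_chains_0: "c \<in> chains K 0 \<Longrightarrow> contract v c = 0"
  using chainsD(5)[of c K 0 "v # _"] by (fastforce simp: fun_eq_iff)

text \<open>
  A simplex that contains the vertex \<open>v\<close> can be rotated so that it starts with \<open>v\<close>; it is then seen by the
  contraction with \<open>v\<close>.
\<close>

lemma chains_restrict:
  assumes V: "finite V" and c: "c \<in> chains (matchings_on E V) s"
    and lk0: "\<And>v. v \<in> E \<Longrightarrow> v \<subseteq> V \<Longrightarrow> v \<inter> X \<noteq> {} \<Longrightarrow> contract v c = 0"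
  shows "c \<in> chains (matchings_on E (V - X)) s"
proof (rule matchings_on_chainsI)
  fix xs assume xs: "c xs \<noteq> 0"
  then have *: "distinct xs" "set xs \<in> matchings_on E V" "length xs = s"
    using chainsD[OF c] by auto
  have "v \<inter> X = {}" if v: "v \<in> set xs" for v
  proof (rule ccontr)
    assume "v \<inter> X \<noteq> {}"
    then have "contract v c = 0"
      using * v by (intro lk0) (auto simp: matchings_on_iff)
    obtain as bs where "xs = as @ v # bs"
      using split_list[OF v] by blast
    then have "contract v c (as @ bs) \<noteq> 0"
      using alternating_move[OF chainsD(2)[OF c], of v as bs] xs by simp
    then show False
      using \<open>contract v c = 0\<close> by simp
  qed
  then show "distinct xs \<and> set xs \<in> matchings_on E (V - X) \<and> length xs = s"
    using * by (auto simp: matchings_on_iff)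
qed (use V chainsD[OF c] in auto)

text \<open>
  The join with the reduced \<open>0\<close>-cycle formed by the two edges of the path \<open>a b c\<close>. It anticommutes with
  the boundary and with the other joins, so it preserves cycles and boundaries.
\<close>

definition join_path :: "'a \<Rightarrow> 'a \<Rightarrow> 'a \<Rightarrow> ('a set list \<Rightarrow> int) \<Rightarrow> 'a set list \<Rightarrow> int"
  where "join_path a b c x = cone {a, b} x - cone {b, c} x"

lemma join_path_add: "join_path a b c (x + y) = join_path a b c x + join_path a b c y"
  by (simp add: join_path_def cone_add)

interpretation join_path: additive "join_path a b c"
  by standard (rule join_path_add)

lemma join_path_smul: "join_path a b c (m \<odot> x) = m \<odot> join_path a b c x"
  by (simp add: join_path_def cone_smul smul_distribs)

lemma join_path_anticommute: "join_path a b c (join_path d e f x) = - join_path d e f (join_path a b c x)"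
  by (simp add: join_path_def cone.diff cone_cone[of "{a, b}"] cone_cone[of "{b, c}"])

lemma join_path_rev: "join_path c b a x = - join_path a b c x"
  by (simp add: join_path_def insert_commute)

lemma matchings_on_Diff_mono: "x \<in> chains (matchings_on E (V - W)) s \<Longrightarrow> X \<subseteq> W \<Longrightarrow> x \<in> chains (matchings_on E (V - X)) s"
  by (rule chains_mono) (auto intro!: matchings_on_mono)

lemma join_path_chains:
  assumes "finite V" "{a, b} \<in> E" "{b, c} \<in> E" "a \<in> V" "b \<in> V" "c \<in> V"
    "x \<in> chains (matchings_on E (V - {a, b, c})) s"
  shows "join_path a b c x \<in> chains (matchings_on E V) (Suc s)"
  unfolding join_path_def using assms by (intro chains_diff cone_chains) (auto intro: matchings_on_Diff_mono)

lemma fsupp_cone: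
  assumes "fsupp c"
  shows "fsupp (cone v c)"
proof -
  let ?B = "\<Union>ys\<in>{ys. c ys \<noteq> 0}. {xs. set xs \<subseteq> set (v # ys) \<and> length xs = length (v # ys)}"
  have "finite ?B"
    using assms by (intro finite_UN_I finite_lists_length_eq) auto
  moreover have "{xs. cone v c xs \<noteq> 0} \<subseteq> ?B"
  proof
    fix xs assume "xs \<in> {xs. cone v c xs \<noteq> 0}"
    then obtain ys where ys: "c ys \<noteq> 0" "mset xs = mset (v # ys)"
      using cone_nonzeroD by fastforce
    then show "xs \<in> ?B"
      using mset_eq_setD[OF ys(2)] mset_eq_length[OF ys(2)] by auto
  qed
  ultimately show ?thesis
    by (rule rev_finite_subset)
qed

lemma boundary_join_path:
  assumes "fsupp x"
  shows "boundary (join_path a b c x) = - join_path a b c (boundary x)"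
proof -
  have "boundary (join_path a b c x) = boundary (cone {a, b} x) + boundary (- cone {b, c} x)"
    using assms boundary_plus[of "cone {a, b} x" "- cone {b, c} x"] by (simp add: join_path_def fsupp_cone)
  then show ?thesis
    using assms by (simp add: boundary_uminus boundary_cone join_path_def)
qed

lemma join_path_Cyc:
  assumes "finite V" "{a, b} \<in> E" "{b, c} \<in> E" "a \<in> V" "b \<in> V" "c \<in> V"
    "x \<in> Cyc (matchings_on E (V - {a, b, c})) s"
  shows "join_path a b c x \<in> Cyc (matchings_on E V) (Suc s)"
proof -
  have x: "x \<in> chains (matchings_on E (V - {a, b, c})) s" "boundary x = 0"
    using assms(7) by (auto simp: Cyc_def)
  then have "boundary (join_path a b c x) = 0"
    using boundary_join_path[OF chainsD(1)[OF x(1)]] by (simp add: join_path.zero)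
  then show ?thesis
    using join_path_chains[OF assms(1-6) x(1)] by (simp add: Cyc_def)
qed

lemma join_path_Bd:
  assumes "finite V" "{a, b} \<in> E" "{b, c} \<in> E" "a \<in> V" "b \<in> V" "c \<in> V"
    "x \<in> Bd (matchings_on E (V - {a, b, c})) s"
  shows "join_path a b c x \<in> Bd (matchings_on E V) (Suc s)"
proof -
  obtain d where d: "d \<in> chains (matchings_on E (V - {a, b, c})) (Suc s)" "x = boundary d"
    using assms(7) by (auto simp: Bd_def)
  then have "join_path a b c x = boundary (- join_path a b c d)"
    using boundary_join_path[OF chainsD(1)[OF d(1)]] by (simp add: boundary_uminus)
  moreover have "- join_path a b c d \<in> chains (matchings_on E V) (Suc (Suc s))"
    by (intro chains_uminus join_path_chains assms d)
  ultimately show ?thesis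
    by (auto simp: Bd_def)
qed

definition unit_chain :: "'a list \<Rightarrow> int"
  where "unit_chain = (\<lambda>xs. if xs = [] then 1 else 0)"

lemma chains_0_eq: "c \<in> chains K 0 \<Longrightarrow> c = c [] \<odot> unit_chain"
  using chainsD(5)[of c K 0] by (fastforce simp: unit_chain_def fun_eq_iff)

lemma boundary_chains_0: "c \<in> chains K 0 \<Longrightarrow> boundary c = 0"
  using chainsD(5)[of c K 0] by (fastforce simp: fun_eq_iff boundary_def intro!: sum.neutral)

lemma unit_chain_in_chains: "finite V \<Longrightarrow> unit_chain \<in> chains (matchings_on E V) 0"
  by (rule matchings_on_chainsI) (auto simp: unit_chain_def matchings_on_iff intro!: alternatingI split: if_splits)

lemma unit_chain_Cyc: "finite V \<Longrightarrow> unit_chain \<in> Cyc (matchings_on E V) 0"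
  using unit_chain_in_chains boundary_chains_0[OF unit_chain_in_chains] by (auto simp: Cyc_def)

lemma chains_0_matchings_on: "finite W \<Longrightarrow> c \<in> chains K 0 \<Longrightarrow> c \<in> chains (matchings_on E W) 0"
  by (subst chains_0_eq) (auto intro: chains_smul unit_chain_in_chains)

text \<open>
  One or two points that remain at the end of the list are left uncovered; in most lists below the last
  point is such a hole.
\<close>

fun path_cycle :: "'a list \<Rightarrow> 'a set list \<Rightarrow> int"
  where "path_cycle (a # b # c # l) = join_path a b c (path_cycle l)"
  | "path_cycle _ = unit_chain"

fun path_edges :: "'a set set \<Rightarrow> 'a list \<Rightarrow> bool"
  where "path_edges E (a # b # c # l) \<longleftrightarrow> {a, b} \<in> E \<and> {b, c} \<in> E \<and> path_edges E l"
  | "path_edges E _ \<longleftrightarrow> True"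

lemma path_cycle_Cyc:
  assumes "finite V" "distinct l" "set l \<subseteq> V" "path_edges E l"
  shows "path_cycle l \<in> Cyc (matchings_on E V) (length l div 3)"
  using assms
proof (induction l arbitrary: V rule: path_cycle.induct)
  case (1 a b c l)
  have "path_cycle l \<in> Cyc (matchings_on E (V - {a, b, c})) (length l div 3)"
    using 1 by (intro 1) auto
  then have "join_path a b c (path_cycle l) \<in> Cyc (matchings_on E V) (Suc (length l div 3))"
    using 1 by (intro join_path_Cyc) auto
  moreover have "length (a # b # c # l) div 3 = Suc (length l div 3)"
    by simp
  ultimately show ?case
    unfolding path_cycle.simps by metis
qed (simp_all add: unit_chain_Cyc)

abbreviation pairs :: "'a set set"
  where "pairs \<equiv> {e. card e = 2}"

text \<open>The matching complex of the complete graph on a set of points.\<close>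

abbreviation MK :: "'a set \<Rightarrow> 'a set set set"
  where "MK \<equiv> matchings_on pairs"

lemma path_edges_pairs: "distinct l \<Longrightarrow> path_edges pairs l"
  by (induction l rule: path_cycle.induct) (auto simp: card_insert_if)

lemma pairs_mem:
  assumes "e \<in> pairs" "i \<in> e"
  obtains u where "e = {i, u}" "u \<noteq> i"
  using assms by (auto simp: card_2_iff)

section \<open>Vanishing and generation for complete graphs\<close>

text \<open>
  Modulo boundaries a cycle can be pushed into the neighbourhood of one edge \<open>{i, j}\<close>. The
  part of \<open>c\<close> on faces that cover \<open>i\<close> and \<open>j\<close> by different edges \<open>{i, u}\<close>, \<open>{j, v}\<close> has cycles as its
  double contractions; they bound by assumption, and this makes the part itself removable. Afterwards the
  contraction with \<open>{i, u}\<close> lives away from \<open>i\<close>, \<open>j\<close> and \<open>u\<close>, and the join of the path \<open>u i j\<close> with it has the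
  same contraction. What is left when these joins are subtracted is a cycle in a cone with apex \<open>{i, j}\<close>.
\<close>

lemma cycle_decomposition:
  assumes V: "finite V" and ij: "i \<in> V" "j \<in> V" "i \<noteq> j" and c: "c \<in> Cyc (MK V) (Suc s)"
    and van: "\<And>u v s'. u \<in> V - {i, j} \<Longrightarrow> v \<in> V - {i, j} \<Longrightarrow> u \<noteq> v \<Longrightarrow> s = Suc s' \<Longrightarrow>
      Cyc (MK (V - {i, j, u, v})) s' \<subseteq> Bd (MK (V - {i, j, u, v})) s'"
  shows "\<exists>w1 w2. (\<forall>u\<in>V - {i, j}. w1 u \<in> Cyc (MK (V - {i, j, u})) s \<and>
      w2 u \<in> Cyc (MK (V - {i, j, u})) s) \<and>
    c - (\<Sum>u\<in>V - {i, j}. join_path u i j (w1 u) + join_path u j i (w2 u)) \<in> Bd (MK V) (Suc s)"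
proof -
  let ?M = "MK"
  define U where "U = V - {i, j}"
  define Q where "Q = {(u, v). u \<in> U \<and> v \<in> U \<and> u \<noteq> v}"
  have fin: "finite U" "finite Q"
    using V by (auto simp: U_def Q_def intro: finite_subset[of _ "V \<times> V"])
  have c': "c \<in> chains (?M V) (Suc s)" "boundary c = 0"
    using c by (auto simp: Cyc_def)
  have "\<exists>d\<in>chains (?M (V - {i, j, u, v})) s. boundary d = contract {j, v} (contract {i, u} c)"
    if uv: "u \<in> U" "v \<in> U" "u \<noteq> v" for u v
  proof -
    have 1: "contract {i, u} c \<in> chains (?M (V - {i, u})) s"
      using contract_chains[OF V c'(1)] .
    show ?thesis
    proof (cases s)
      case 0
      then show ?thesis
        using 1 by (intro bexI[of _ 0]) (auto simp: contract_chains_0 boundary_zero chains_zero)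
    next
      case (Suc s')
      have eq: "V - {i, u} - {j, v} = V - {i, j, u, v}"
        by auto
      have 2: "contract {j, v} (contract {i, u} c) \<in> chains (?M (V - {i, j, u, v})) s'"
        using contract_chains[of "V - {i, u}" "contract {i, u} c" pairs s' "{j, v}"] 1 V Suc unfolding eq by simp
      have "boundary (contract {j, v} (contract {i, u} c)) = 0"
        using boundary_chain_contract[OF 1] boundary_chain_contract[OF c'(1)] c'(2) by (simp add: contract.minus contract.zero)
      with 2 have "contract {j, v} (contract {i, u} c) \<in> Cyc (?M (V - {i, j, u, v})) s'"
        by (simp add: Cyc_def)
      then have "contract {j, v} (contract {i, u} c) \<in> Bd (?M (V - {i, j, u, v})) s'"
        using van[OF _ _ uv(3) Suc] uv unfolding U_def by blast
      then show ?thesis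
        unfolding Bd_def Suc by (elim imageE) (rule bexI, rule sym)
    qed
  qed
  then have "\<forall>q\<in>Q. \<exists>d. d \<in> chains (?M (V - {i, j, fst q, snd q})) s \<and>
      boundary d = contract {j, snd q} (contract {i, fst q} c)"
    unfolding Q_def by auto
  then obtain D where D: "\<And>q. q \<in> Q \<Longrightarrow> D q \<in> chains (?M (V - {i, j, fst q, snd q})) s"
    "\<And>q. q \<in> Q \<Longrightarrow> boundary (D q) = contract {j, snd q} (contract {i, fst q} c)"
    unfolding bchoice_iff by blast
  \<comment> \<open>The boundary of the join of two edges with \<open>D\<close> has \<open>boundary D\<close> as its double contraction.\<close>
  define T where "T q = cone {i, fst q} (cone {j, snd q} (D q))" for q
  define B where "B = (\<Sum>q\<in>Q. T q)"
  have QD: "fst q \<in> U" "snd q \<in> U" "fst q \<noteq> snd q" "fst q \<noteq> i" "fst q \<noteq> j" "snd q \<noteq> i" "snd q \<noteq> j"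
    "fst q \<in> V" "snd q \<in> V" if "q \<in> Q" for q
    using that by (auto simp: Q_def U_def)
  have T: "T q \<in> chains (?M V) (Suc (Suc s))" if q: "q \<in> Q" for q
  proof -
    have "V - {i, fst q} - {j, snd q} = V - {i, j, fst q, snd q}"
      by auto
    then have "cone {j, snd q} (D q) \<in> chains (?M (V - {i, fst q})) (Suc s)"
      using D(1)[OF q] QD[OF q] V ij by (intro cone_chains) (auto simp: card_insert_if)
    then show ?thesis
      unfolding T_def by (rule cone_chains[rotated -1]) (use QD[OF q] V ij in \<open>auto simp: card_insert_if\<close>)
  qed
  have B: "B \<in> chains (?M V) (Suc (Suc s))"
    unfolding B_def by (intro chains_sum T)
  have lkT: "contract {j, v} (contract {i, u} (T q)) = (if q = (u, v) then D q else 0)"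
    if q: "q \<in> Q" and uv: "u \<in> U" "v \<in> U" for q u v
  proof -
    have i: "contract {i, u} (D q) = 0" and j: "contract {j, v} (D q) = 0"
      by (rule contract_outside[OF D(1)[OF q]], simp)+
    have 1: "contract {i, u} (cone {j, snd q} (D q)) = 0"
      using QD[OF q] ij uv by (simp add: contract_cone i cone.zero doubleton_eq_iff U_def)
    have 2: "contract {i, u} (T q) = (if fst q = u then cone {j, snd q} (D q) else 0)"
      using QD[OF q] ij uv by (auto simp: T_def contract_cone[of _ "{i, fst q}"] 1 cone.zero doubleton_eq_iff)
    show ?thesis
      unfolding 2 using QD[OF q] ij uv
      by (auto simp: contract_cone j cone.zero contract.zero doubleton_eq_iff prod_eq_iff)
  qed
  define c1 where "c1 = c - boundary B"
  have bB: "boundary B \<in> Bd (?M V) (Suc s)"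
    using B by (auto simp: Bd_def)
  have sub: "b \<in> Bd (?M W) t \<Longrightarrow> b \<in> Cyc (?M W) t" for b W t
    by (rule Bd_in_Cyc) (auto simp: matchings_on_def intro: matchings_subset)
  have c1: "c1 \<in> Cyc (?M V) (Suc s)"
    unfolding c1_def by (intro Cyc_diff c sub bB)
  then have c1': "c1 \<in> chains (?M V) (Suc s)" "boundary c1 = 0"
    by (auto simp: Cyc_def)
  have lkc1: "contract {j, v} (contract {i, u} c1) = 0" if uv: "u \<in> U" "v \<in> U" for u v
  proof (cases "u = v")
    case True
    then show ?thesis
      by (intro contract_outside[OF contract_chains[OF V c1'(1)]]) auto
  next
    case False
    then have q: "(u, v) \<in> Q"
      using uv by (simp add: Q_def)
    have "contract {j, v} (contract {i, u} B) = (\<Sum>q\<in>Q. if q = (u, v) then D q else 0)"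
      unfolding B_def contract.sum by (intro sum.cong refl lkT uv)
    also have "\<dots> = D (u, v)"
      using q fin by (simp add: sum.delta)
    finally have "boundary (contract {j, v} (contract {i, u} B)) = boundary (D (u, v))"
      by simp
    moreover have "boundary (contract {j, v} (contract {i, u} B)) = contract {j, v} (contract {i, u} (boundary B))"
      using boundary_chain_contract[OF contract_chains[OF V B]] boundary_chain_contract[OF B] by (simp add: contract.minus)
    ultimately show ?thesis
      using D(2)[OF q] by (simp add: c1_def contract.diff)
  qed
  define w1 where "w1 u = contract {i, u} c1" for u
  define w2 where "w2 u = contract {j, u} c1" for u
  have edge_cases: "(\<exists>v\<in>U. e = {k, v}) \<or> e = {i, j}"
    if e: "e \<in> pairs" "e \<subseteq> V" "k \<in> e" "k \<in> {i, j}" for e k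
  proof -
    obtain u where "e = {k, u}" "u \<noteq> k"
      using pairs_mem[OF e(1,3)] .
    then show ?thesis
      using e(2,4) by (cases "u \<in> U") (auto simp: U_def)
  qed
  have w1: "w1 u \<in> Cyc (?M (V - {i, j, u})) s" if u: "u \<in> U" for u
  proof -
    have 1: "w1 u \<in> chains (?M (V - {i, u})) s"
      unfolding w1_def by (rule contract_chains[OF V c1'(1)])
    have "w1 u \<in> chains (?M (V - {i, u} - {j})) s"
    proof (rule chains_restrict[OF _ 1])
      fix e assume e: "e \<in> pairs" "e \<subseteq> V - {i, u}" "e \<inter> {j} \<noteq> {}"
      then obtain v where "v \<in> U" "e = {j, v}"
        using edge_cases[of e j] by blast
      then show "contract e (w1 u) = 0"
        using lkc1 u by (simp add: w1_def)
    qed (use V in auto)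
    moreover have "V - {i, u} - {j} = V - {i, j, u}"
      by auto
    moreover have "boundary (w1 u) = 0"
      unfolding w1_def using boundary_chain_contract[OF c1'(1)] c1'(2) by (simp add: contract.zero)
    ultimately show ?thesis
      by (simp add: Cyc_def)
  qed
  have w2: "w2 u \<in> Cyc (?M (V - {i, j, u})) s" if u: "u \<in> U" for u
  proof -
    have 1: "w2 u \<in> chains (?M (V - {j, u})) s"
      unfolding w2_def by (rule contract_chains[OF V c1'(1)])
    have "w2 u \<in> chains (?M (V - {j, u} - {i})) s"
    proof (rule chains_restrict[OF _ 1])
      fix e assume e: "e \<in> pairs" "e \<subseteq> V - {j, u}" "e \<inter> {i} \<noteq> {}"
      then obtain v where "v \<in> U" "e = {i, v}"
        using edge_cases[of e i] by blast
      then show "contract e (w2 u) = 0"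
        using lkc1[OF \<open>v \<in> U\<close> u] alternating_contract_contract[OF chainsD(2)[OF c1'(1)], of "{i, v}" "{j, u}"]
        by (simp add: w2_def)
    qed (use V in auto)
    moreover have "V - {j, u} - {i} = V - {i, j, u}"
      by auto
    moreover have "boundary (w2 u) = 0"
      unfolding w2_def using boundary_chain_contract[OF c1'(1)] c1'(2) by (simp add: contract.zero)
    ultimately show ?thesis
      by (simp add: Cyc_def)
  qed
  define S where "S = (\<Sum>u\<in>U. join_path u i j (w1 u) + join_path u j i (w2 u))"
  have S: "S \<in> Cyc (?M V) (Suc s)"
    unfolding S_def
  proof (intro Cyc_sum Cyc_add)
    fix u assume u: "u \<in> U"
    have eq: "V - {u, i, j} = V - {i, j, u}" "V - {u, j, i} = V - {i, j, u}"
      by auto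
    show "join_path u i j (w1 u) \<in> Cyc (?M V) (Suc s)" "join_path u j i (w2 u) \<in> Cyc (?M V) (Suc s)"
      by (rule join_path_Cyc; use V ij u w1 w2 in \<open>auto simp: U_def eq card_insert_if\<close>)+
  qed
  have contract_w: "contract e (w1 u) = 0" "contract e (w2 u) = 0" if "u \<in> U" "\<not> e \<subseteq> V - {i, j, u}" for e u
    using w1[OF that(1)] w2[OF that(1)] that(2) by (auto simp: Cyc_def intro: contract_outside)
  have lkS_i: "contract {i, v} S = w1 v" if v: "v \<in> U" for v
  proof -
    have "contract {i, v} (join_path u i j (w1 u) + join_path u j i (w2 u)) = (if u = v then w1 u else 0)" if "u \<in> U" for u
      using that v ij
      by (auto simp: join_path_def contract.add contract.diff contract_cone contract_w cone.zero doubleton_eq_iff U_def)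
    then have "contract {i, v} S = (\<Sum>u\<in>U. if u = v then w1 u else 0)"
      unfolding S_def contract.sum by (intro sum.cong) auto
    then show ?thesis
      using v fin by (simp add: sum.delta)
  qed
  have lkS_j: "contract {j, v} S = w2 v" if v: "v \<in> U" for v
  proof -
    have "contract {j, v} (join_path u i j (w1 u) + join_path u j i (w2 u)) = (if u = v then w2 u else 0)" if "u \<in> U" for u
      using that v ij
      by (auto simp: join_path_def contract.add contract.diff contract_cone contract_w cone.zero doubleton_eq_iff U_def)
    then have "contract {j, v} S = (\<Sum>u\<in>U. if u = v then w2 u else 0)"
      unfolding S_def contract.sum by (intro sum.cong) auto
    then show ?thesis
      using v fin by (simp add: sum.delta)
  qed
  define c2 where "c2 = c1 - S"
  have c2: "c2 \<in> chains (?M V) (Suc s)" "boundary c2 = 0"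
    using Cyc_diff[OF c1 S] by (auto simp: c2_def Cyc_def)
  \<comment> \<open>A cycle \<open>cone e x + y\<close> with \<open>x\<close>, \<open>y\<close> away from \<open>e\<close> is the boundary of \<open>cone e y\<close>.\<close>
  define x where "x = contract {i, j} c2"
  define y where "y = c2 - cone {i, j} x"
  have x: "x \<in> chains (?M (V - {i, j})) s"
    unfolding x_def by (rule contract_chains[OF V c2(1)])
  have bx: "boundary x = 0"
    unfolding x_def using boundary_chain_contract[OF c2(1)] c2(2) by (simp add: contract.zero)
  have cnx: "cone {i, j} x \<in> chains (?M V) (Suc s)"
    using x ij V by (intro cone_chains) (auto simp: card_insert_if)
  have y: "y \<in> chains (?M (V - {i, j})) (Suc s)"
  proof (rule chains_restrict[OF V])
    show "y \<in> chains (?M V) (Suc s)"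
      unfolding y_def by (intro chains_diff c2 cnx)
    fix e assume e: "e \<in> pairs" "e \<subseteq> V" "e \<inter> {i, j} \<noteq> {}"
    then have x0: "contract e x = 0"
      by (intro contract_outside[OF x]) auto
    from e consider v where "v \<in> U" "e = {i, v}" | v where "v \<in> U" "e = {j, v}" | "e = {i, j}"
      using edge_cases[of e i] edge_cases[of e j] by blast
    then show "contract e y = 0"
    proof cases
      case 1
      then show ?thesis
        using x0 ij lkS_i by (auto simp: y_def c2_def contract.diff contract_cone cone.zero doubleton_eq_iff w1_def U_def)
    next
      case 2
      then show ?thesis
        using x0 ij lkS_j by (auto simp: y_def c2_def contract.diff contract_cone cone.zero doubleton_eq_iff w2_def U_def)
    next
      case 3
      then show ?thesis
        using x0 by (simp add: y_def contract.diff contract_cone cone.zero x_def[symmetric])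
    qed
  qed
  have "boundary y = - x"
    unfolding y_def boundary_chain_diff[OF c2(1) cnx] using boundary_chain_cone[OF x] bx c2(2) by (simp add: cone.zero)
  then have "boundary (cone {i, j} y) = c2"
    using boundary_chain_cone[OF y] by (simp add: cone.minus) (simp add: y_def)
  moreover have "cone {i, j} y \<in> chains (?M V) (Suc (Suc s))"
    using y ij V by (intro cone_chains) (auto simp: card_insert_if)
  ultimately have "c2 \<in> Bd (?M V) (Suc s)"
    unfolding Bd_def by blast
  then have "c2 + boundary B \<in> Bd (?M V) (Suc s)"
    by (intro Bd_add bB)
  moreover have "c2 + boundary B = c - S"
    by (simp add: c2_def c1_def)
  ultimately have "c - S \<in> Bd (?M V) (Suc s)"
    by simp
  then show ?thesis
    using w1 w2 unfolding S_def U_def[symmetric] by (intro exI[where x=w1] exI[where x=w2]) simp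
qed

lemma ex_two:
  assumes "2 \<le> card V"
  obtains i j where "i \<in> V" "j \<in> V" "i \<noteq> j"
proof -
  obtain W where "W \<subseteq> V" "card W = 2"
    by (rule obtain_subset_with_card_n[OF assms]) blast
  then show thesis
    using that by (auto simp: card_2_iff)
qed

text \<open>
  Both the links that have to be acyclic in the decomposition and the chains \<open>w1\<close>, \<open>w2\<close> that occur in
  it are covered by the induction: three points fewer with one vertex fewer, four points fewer with two.
\<close>

theorem matching_homology_vanishing:
  assumes "finite V" "3 * s + 2 \<le> card V"
  shows "Cyc (MK V) s \<subseteq> Bd (MK V) s"
  using assms
proof (induction s arbitrary: V rule: less_induct)
  case (less s)
  obtain i j where ij: "i \<in> V" "j \<in> V" "i \<noteq> j"
    using less.prems by (elim ex_two[rotated]) auto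
  show ?case
  proof
    fix c assume c: "c \<in> Cyc (MK V) s"
    show "c \<in> Bd (MK V) s"
    proof (cases s)
      case 0
      then have c0: "c \<in> chains (MK (V - {i, j})) 0"
        using c less.prems by (intro chains_0_matchings_on) (auto simp: Cyc_def)
      then have "boundary (cone {i, j} c) = c"
        using boundary_chain_cone[OF c0] boundary_chains_0[OF c0] by (simp add: cone.zero)
      moreover have "cone {i, j} c \<in> chains (MK V) (Suc s)"
        unfolding 0 using c0 ij less.prems by (intro cone_chains) (auto simp: card_insert_if)
      ultimately show ?thesis
        unfolding Bd_def by (rule image_eqI[OF sym])
    next
      case (Suc t)
      have card3: "card (V - {i, j, u}) = card V - 3" if "u \<in> V - {i, j}" for u
        using ij that less.prems by (subst card_Diff_subset) auto
      have card4: "card (V - {i, j, u, v}) = card V - 4" if "u \<in> V - {i, j}" "v \<in> V - {i, j}" "u \<noteq> v" for u v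
        using ij that less.prems by (subst card_Diff_subset) auto
      have "\<exists>w1 w2. (\<forall>u\<in>V - {i, j}. w1 u \<in> Cyc (MK (V - {i, j, u})) t \<and>
          w2 u \<in> Cyc (MK (V - {i, j, u})) t) \<and>
        c - (\<Sum>u\<in>V - {i, j}. join_path u i j (w1 u) + join_path u j i (w2 u)) \<in> Bd (MK V) (Suc t)"
      proof (rule cycle_decomposition)
        show "Cyc (MK (V - {i, j, u, v})) s' \<subseteq> Bd (MK (V - {i, j, u, v})) s'"
          if "u \<in> V - {i, j}" "v \<in> V - {i, j}" "u \<noteq> v" "t = Suc s'" for u v s'
          using that less.prems Suc card4[OF that(1-3)] by (intro less.IH) auto
      qed (use less.prems ij c Suc in auto)
      then obtain w1 w2 where w: "\<forall>u\<in>V - {i, j}. w1 u \<in> Cyc (MK (V - {i, j, u})) t \<and>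
          w2 u \<in> Cyc (MK (V - {i, j, u})) t"
        and S: "c - (\<Sum>u\<in>V - {i, j}. join_path u i j (w1 u) + join_path u j i (w2 u)) \<in> Bd (MK V) s"
        unfolding Suc by blast
      have "(\<Sum>u\<in>V - {i, j}. join_path u i j (w1 u) + join_path u j i (w2 u)) \<in> Bd (MK V) s"
      proof (intro Bd_sum Bd_add)
        fix u assume u: "u \<in> V - {i, j}"
        have "w1 u \<in> Bd (MK (V - {i, j, u})) t" "w2 u \<in> Bd (MK (V - {i, j, u})) t"
        proof -
          have "Cyc (MK (V - {i, j, u})) t \<subseteq> Bd (MK (V - {i, j, u})) t"
            using less.prems card3[OF u] Suc by (intro less.IH) auto
          then show "w1 u \<in> Bd (MK (V - {i, j, u})) t" "w2 u \<in> Bd (MK (V - {i, j, u})) t"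
            using w u by blast+
        qed
        moreover have eq: "V - {u, i, j} = V - {i, j, u}" "V - {u, j, i} = V - {i, j, u}"
          by auto
        ultimately show "join_path u i j (w1 u) \<in> Bd (MK V) s" "join_path u j i (w2 u) \<in> Bd (MK V) s"
          unfolding Suc by (intro join_path_Bd; use less.prems ij u in \<open>auto simp: card_insert_if\<close>)+
      qed
      from Bd_add[OF S this] show ?thesis
        by simp
    qed
  qed
qed


text \<open>
  The subgroup generated by the boundaries and the path cycles, as an inductive set: properties of all cycles
  follow by rule induction once they are additive.
\<close>

inductive_set path_span :: "'a set \<Rightarrow> nat \<Rightarrow> ('a set list \<Rightarrow> int) set" for V s
  where Bd: "b \<in> Bd (MK V) s \<Longrightarrow> b \<in> path_span V s"
  | path_cycle: "distinct l \<Longrightarrow> set l = V \<Longrightarrow> path_cycle l \<in> path_span V s"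
  | add: "c \<in> path_span V s \<Longrightarrow> d \<in> path_span V s \<Longrightarrow> c + d \<in> path_span V s"
  | minus: "c \<in> path_span V s \<Longrightarrow> - c \<in> path_span V s"

lemma path_span_zero: "0 \<in> path_span V s"
  by (intro path_span.Bd Bd_zero)

lemma path_span_smul:
  assumes "c \<in> path_span V s"
  shows "m \<odot> c \<in> path_span V s"
proof -
  have nat: "int n \<odot> c \<in> path_span V s" for n
  proof (induction n)
    case 0
    have "int 0 \<odot> c \<in> path_span V s"
      by (simp add: path_span_zero)
    then show ?case .
  next
    case (Suc n)
    have "int n \<odot> c + c \<in> path_span V s"
      by (intro path_span.add Suc assms)
    then have "int (Suc n) \<odot> c \<in> path_span V s"
      by (simp add: smul_distribs add.commute)
    then show ?case .
  qed
  show ?thesis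
    using nat[of "nat m"] path_span.minus[OF nat[of "nat (- m)"]] by (cases "m \<ge> 0") auto
qed

lemma path_span_sum: "(\<And>i. i \<in> I \<Longrightarrow> f i \<in> path_span V s) \<Longrightarrow> (\<Sum>i\<in>I. f i) \<in> path_span V s"
  by (induction I rule: infinite_finite_induct) (auto simp: path_span_zero path_span.add)

lemma join_path_path_span:
  assumes "x \<in> path_span (V - {a, b, c}) s" "finite V" "a \<in> V" "b \<in> V" "c \<in> V" "a \<noteq> b" "b \<noteq> c" "a \<noteq> c"
  shows "join_path a b c x \<in> path_span V (Suc s)"
  using assms(1)
proof (induction rule: path_span.induct)
  case (Bd x)
  then have "join_path a b c x \<in> Bd (MK V) (Suc s)"
    using assms by (intro join_path_Bd) (auto simp: card_insert_if)
  then show ?case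
    by (rule path_span.Bd)
next
  case (path_cycle l)
  then have "path_cycle (a # b # c # l) \<in> path_span V (Suc s)"
    using assms by (intro path_span.path_cycle) auto
  then show ?case
    by simp
next
  case (add x y)
  then show ?case
    unfolding join_path_add by (intro path_span.add)
next
  case (minus x)
  then show ?case
    unfolding join_path.minus by (intro path_span.minus)
qed

text \<open>
  The chains \<open>w1\<close> and \<open>w2\<close> of the decomposition live on three points fewer, and the join with a path on these points
  prolongs path cycles; the links on four points fewer are acyclic.
\<close>

theorem path_cycles_generate:
  assumes "finite V" "3 * s \<le> card V" "card V \<le> 3 * s + 1"
  shows "Cyc (MK V) s \<subseteq> path_span V s"
  using assms
proof (induction s arbitrary: V)
  case 0
  then have "card V = 0 \<or> card V = 1"
    by linarith
  then have "V = {} \<or> (\<exists>x. V = {x})"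
    using 0 card_1_singletonE by (metis card_0_eq)
  then have "unit_chain \<in> path_span V 0"
    using path_span.path_cycle[of "[]" V 0] path_span.path_cycle[of "[_]" V 0] by auto
  then have "c [] \<odot> unit_chain \<in> path_span V 0" for c
    by (rule path_span_smul)
  then show ?case
    using chains_0_eq unfolding Cyc_def by (metis (mono_tags, lifting) mem_Collect_eq subsetI)
next
  case (Suc s)
  obtain i j where ij: "i \<in> V" "j \<in> V" "i \<noteq> j"
    using Suc.prems by (elim ex_two[rotated]) auto
  have card3: "card (V - {i, j, u}) = card V - 3" if "u \<in> V - {i, j}" for u
    using ij that Suc.prems by (subst card_Diff_subset) auto
  have card4: "card (V - {i, j, u, v}) = card V - 4" if "u \<in> V - {i, j}" "v \<in> V - {i, j}" "u \<noteq> v" for u v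
    using ij that Suc.prems by (subst card_Diff_subset) auto
  show ?case
  proof
    fix c assume c: "c \<in> Cyc (MK V) (Suc s)"
    have "\<exists>w1 w2. (\<forall>u\<in>V - {i, j}. w1 u \<in> Cyc (MK (V - {i, j, u})) s \<and>
        w2 u \<in> Cyc (MK (V - {i, j, u})) s) \<and>
      c - (\<Sum>u\<in>V - {i, j}. join_path u i j (w1 u) + join_path u j i (w2 u)) \<in> Bd (MK V) (Suc s)"
    proof (rule cycle_decomposition)
      show "Cyc (MK (V - {i, j, u, v})) s' \<subseteq> Bd (MK (V - {i, j, u, v})) s'"
        if "u \<in> V - {i, j}" "v \<in> V - {i, j}" "u \<noteq> v" "s = Suc s'" for u v s'
        using that Suc.prems card4[OF that(1-3)] by (intro matching_homology_vanishing) auto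
    qed (use Suc.prems ij c in auto)
    then obtain w1 w2 where w: "\<forall>u\<in>V - {i, j}. w1 u \<in> Cyc (MK (V - {i, j, u})) s \<and>
        w2 u \<in> Cyc (MK (V - {i, j, u})) s"
      and S: "c - (\<Sum>u\<in>V - {i, j}. join_path u i j (w1 u) + join_path u j i (w2 u)) \<in> Bd (MK V) (Suc s)"
      by blast
    have "(\<Sum>u\<in>V - {i, j}. join_path u i j (w1 u) + join_path u j i (w2 u)) \<in> path_span V (Suc s)"
    proof (intro path_span_sum path_span.add)
      fix u assume u: "u \<in> V - {i, j}"
      have "Cyc (MK (V - {i, j, u})) s \<subseteq> path_span (V - {i, j, u}) s"
        using Suc.prems card3[OF u] by (intro Suc.IH) auto
      then have "w1 u \<in> path_span (V - {i, j, u}) s" "w2 u \<in> path_span (V - {i, j, u}) s"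
        using w u by blast+
      moreover have eq: "V - {u, i, j} = V - {i, j, u}" "V - {u, j, i} = V - {i, j, u}"
        by auto
      ultimately show "join_path u i j (w1 u) \<in> path_span V (Suc s)" "join_path u j i (w2 u) \<in> path_span V (Suc s)"
        by (intro join_path_path_span; use Suc.prems ij u in \<open>auto\<close>)+
    qed
    from path_span.add[OF path_span.Bd[OF S] this] show "c \<in> path_span V (Suc s)"
      by simp
  qed
qed

section \<open>Rank of a complex from the links of a star of edges\<close>

lemma ex_common_gcd:
  fixes m :: "'i \<Rightarrow> int"
  assumes "finite I"
  shows "\<exists>u g. g = (\<Sum>i\<in>I. u i * m i) \<and> (\<forall>i\<in>I. g dvd m i)"
  using assms
proof (induction I rule: finite_induct)
  case (insert j I)
  then obtain u g where u: "g = (\<Sum>i\<in>I. u i * m i)" "\<forall>i\<in>I. g dvd m i"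
    by blast
  obtain a b where ab: "a * m j + b * g = gcd (m j) g"
    using bezout_int by blast
  define u' where "u' i = (if i = j then a else b * u i)" for i
  have "(\<Sum>i\<in>insert j I. u' i * m i) = a * m j + (\<Sum>i\<in>I. b * u i * m i)"
    using insert(1,2) by (simp add: u'_def) (intro sum.cong refl, auto)
  also have "\<dots> = gcd (m j) g"
    using ab u(1) by (simp add: sum_distrib_left mult.assoc)
  finally have 1: "gcd (m j) g = (\<Sum>i\<in>insert j I. u' i * m i)"
    by simp
  have "\<forall>i\<in>insert j I. gcd (m j) g dvd m i"
    using u(2) by (auto intro: dvd_trans)
  with 1 show ?case
    by (intro exI conjI)
qed auto

lemma contract_Cyc:
  assumes "finite V" "c \<in> Cyc (matchings_on E V) (Suc s)"
  shows "contract v c \<in> Cyc (matchings_on E (V - v)) s"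
proof -
  have c: "c \<in> chains (matchings_on E V) (Suc s)" "boundary c = 0"
    using assms(2) by (auto simp: Cyc_def)
  then show ?thesis
    using contract_chains[OF assms(1) c(1)] boundary_chain_contract[OF c(1)] by (simp add: Cyc_def contract.zero)
qed

lemma contract_Bd:
  assumes "finite V" "c \<in> Bd (matchings_on E V) (Suc s)"
  shows "contract v c \<in> Bd (matchings_on E (V - v)) s"
proof -
  obtain d where d: "d \<in> chains (matchings_on E V) (Suc (Suc s))" "c = boundary d"
    using assms(2) by (auto simp: Bd_def)
  have "boundary (- contract v d) = contract v c"
    unfolding boundary_uminus boundary_chain_contract[OF d(1)] d(2) by simp
  moreover have "- contract v d \<in> chains (matchings_on E (V - v)) (Suc s)"
    by (intro chains_uminus contract_chains assms d)
  ultimately show ?thesis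
    unfolding Bd_def by (intro image_eqI[where x="- contract v d"]) simp_all
qed

lemma functional_contract:
  assumes V: "finite V" and f: "functional (matchings_on E (V - v)) s p f"
  shows "functional (matchings_on E V) (Suc s) p (\<lambda>c. f (contract v c))"
  unfolding functional_def
proof (intro conjI ballI)
  show "[f (contract v (c + d)) = f (contract v c) + f (contract v d)] (mod p)"
    if "c \<in> Cyc (matchings_on E V) (Suc s)" "d \<in> Cyc (matchings_on E V) (Suc s)" for c d
    unfolding contract_add by (intro functional_add[OF f] contract_Cyc V that)
  show "[f (contract v b) = 0] (mod p)" if "b \<in> Bd (matchings_on E V) (Suc s)" for b
    by (intro functional_Bd[OF f] contract_Bd V that)
qed

text \<open>
  If \<open>c\<^sub>e\<close> are cycles in the links with \<open>(\<Sum>e. c\<^sub>e) = boundary d\<close> and \<open>d\<close> avoids \<open>i\<close>, then \<open>(\<Sum>e. cone e c\<^sub>e) - d\<close> is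
  a cycle with contractions \<open>c\<^sub>e\<close>. The obstruction to being of this form is a multiple of \<open>z\<close>. Subtracting a suitable
  multiple of one fixed family, whose obstruction is the greatest common divisor of all of them, makes any family
  liftable. So generators of the homology of the large complex and that one family account for all values of
  the functionals.
\<close>

theorem rank_of_links:
  assumes V: "finite V" and p: "p \<ge> 2" and N: "finite N"
    and e: "\<And>j. j \<in> N \<Longrightarrow> e j \<in> E" "\<And>j. j \<in> N \<Longrightarrow> e j \<subseteq> V" "\<And>j. j \<in> N \<Longrightarrow> i \<in> e j"
    and x: "\<And>j. j \<in> N \<Longrightarrow> x j \<in> Cyc (matchings_on E (V - e j)) s"
    and f: "\<And>j. j \<in> N \<Longrightarrow> functional (matchings_on E (V - e j)) s p (f j)"
    and dual: "\<And>j k. j \<in> N \<Longrightarrow> k \<in> N \<Longrightarrow> e j = e k \<Longrightarrow> [f j (x k) = of_bool (j = k)] (mod p)"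
    and z: "\<And>j. j \<in> N \<Longrightarrow> \<exists>m. x j - m \<odot> z \<in> Bd (matchings_on E (V - {i})) s"
  shows "card N \<le> homology_rank (matchings_on E V) (Suc s) + 1"
proof -
  let ?r = "homology_rank (matchings_on E V) (Suc s)"
  obtain y where y: "spans (matchings_on E V) (Suc s) ?r y"
    using rank_attained[OF finite_complex_matchings_on[OF V, of E], of "Suc s"] by blast
  obtain m where m: "\<And>j. j \<in> N \<Longrightarrow> x j - m j \<odot> z \<in> Bd (matchings_on E (V - {i})) s"
    using z by metis
  obtain u g where u: "g = (\<Sum>j\<in>N. u j * m j)" "\<And>j. j \<in> N \<Longrightarrow> g dvd m j"
    using ex_common_gcd[OF N, of m] by blast
  \<comment> \<open>The last vector holds the values of the functionals on the fixed family \<open>(\<Sum>j\<in>N. u j \<odot> x j)\<close>.\<close>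
  define v where "v k j = (if k < ?r then f j (contract (e j) (y k)) else u j)" for k j
  have "card N \<le> Suc ?r"
  proof (rule mod_span_count[OF p N, where r="Suc ?r" and v=v])
    fix j0 assume j0: "j0 \<in> N"
    obtain q where q: "m j0 = q * g"
      using u(2)[OF j0] by (metis dvd_def mult.commute)
    have "(x j0 - m j0 \<odot> z) - q \<odot> (\<Sum>j\<in>N. u j \<odot> (x j - m j \<odot> z)) \<in> Bd (matchings_on E (V - {i})) s"
      by (intro Bd_diff Bd_smul Bd_sum m j0)
    moreover have "(x j0 - m j0 \<odot> z) - q \<odot> (\<Sum>j\<in>N. u j \<odot> (x j - m j \<odot> z)) =
        x j0 - q \<odot> (\<Sum>j\<in>N. u j \<odot> x j)"
    proof -
      have "(\<Sum>j\<in>N. u j \<odot> (x j - m j \<odot> z)) = (\<Sum>j\<in>N. u j \<odot> x j) - g \<odot> z"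
        unfolding u(1) by (simp add: smul_distribs sum_subtractf fun_eq_iff sum_fun_apply sum_distrib_right)
      then show ?thesis
        unfolding q by (simp add: smul_distribs)
    qed
    ultimately obtain d where d: "d \<in> chains (matchings_on E (V - {i})) (Suc s)"
      "x j0 - q \<odot> (\<Sum>j\<in>N. u j \<odot> x j) = boundary d"
      by (auto simp: Bd_def)
    define cx where "cx j = cone (e j) (x j)" for j
    have cx: "cx j \<in> chains (matchings_on E V) (Suc s)" "boundary (cx j) = x j" if "j \<in> N" for j
    proof -
      have xj: "x j \<in> chains (matchings_on E (V - e j)) s" "boundary (x j) = 0"
        using x[OF that] by (auto simp: Cyc_def)
      show "cx j \<in> chains (matchings_on E V) (Suc s)"
        unfolding cx_def by (rule cone_chains[OF V _ _ _ xj(1)]) (use e[OF that] in auto)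
      show "boundary (cx j) = x j"
        unfolding cx_def boundary_chain_cone[OF xj(1)] xj(2) by (simp add: cone.zero)
    qed
    define S where "S = (\<Sum>j\<in>N. u j \<odot> cx j)"
    have S: "S \<in> chains (matchings_on E V) (Suc s)"
      unfolding S_def by (intro chains_sum chains_smul cx)
    have bS: "boundary S = (\<Sum>j\<in>N. u j \<odot> x j)"
    proof -
      have "boundary S = (\<Sum>j\<in>N. boundary (u j \<odot> cx j))"
        unfolding S_def by (rule boundary_chain_sum[where K="matchings_on E V" and s="Suc s"]) (intro chains_smul cx)
      also have "\<dots> = (\<Sum>j\<in>N. u j \<odot> x j)"
        by (intro sum.cong refl) (simp add: boundary_smul cx)
      finally show ?thesis .
    qed
    have d': "d \<in> chains (matchings_on E V) (Suc s)"
      by (rule chains_mono[OF d(1) matchings_on_mono]) auto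
    define Y where "Y = cx j0 - q \<odot> S - d"
    have Y: "Y \<in> Cyc (matchings_on E V) (Suc s)"
    proof -
      have "Y \<in> chains (matchings_on E V) (Suc s)"
        unfolding Y_def by (intro chains_diff chains_smul cx j0 S d')
      moreover have "boundary Y = 0"
        unfolding Y_def boundary_chain_diff[OF chains_diff[OF cx(1)[OF j0] chains_smul[OF S]] d'] boundary_chain_diff[OF cx(1)[OF j0] chains_smul[OF S]]
          boundary_smul bS cx(2)[OF j0] d(2)[symmetric] by simp
      ultimately show ?thesis
        by (simp add: Cyc_def)
    qed
    have contract_cx: "contract (e j) (cx k) = (if e j = e k then x k else 0)" if jk: "j \<in> N" "k \<in> N" for j k
    proof -
      have "contract (e j) (x k) = 0"
        by (rule contract_outside[of _ E "V - e k" s]) (use x[OF jk(2)] e(3) jk in \<open>auto simp: Cyc_def\<close>)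
      then show ?thesis
        by (auto simp: cx_def contract_cone cone.zero)
    qed
    have contract_d: "contract (e j) d = 0" if "j \<in> N" for j
      by (rule contract_outside[OF d(1)]) (use e(3)[OF that] in auto)
    have fY: "[f j (contract (e j) Y) = of_bool (j = j0) - q * u j] (mod p)" if j: "j \<in> N" for j
    proof -
      let ?t = "\<lambda>k. if e j = e k then x k else 0"
      have t: "?t k \<in> Cyc (matchings_on E (V - e j)) s" if "k \<in> N" for k
        using x[OF that] Cyc_zero by auto
      have ft: "[f j (?t k) = of_bool (j = k)] (mod p)" if "k \<in> N" for k
        using dual[OF j that] functional_Bd[OF f[OF j] Bd_zero] by auto
      have tS: "(\<Sum>k\<in>N. u k \<odot> ?t k) \<in> Cyc (matchings_on E (V - e j)) s"
        by (intro Cyc_sum Cyc_smul t)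
      have lkS: "contract (e j) S = (\<Sum>k\<in>N. u k \<odot> ?t k)"
        unfolding S_def contract.sum by (intro sum.cong refl) (simp only: contract_smul contract_cx[OF j])
      have "contract (e j) Y = ?t j0 - q \<odot> (\<Sum>k\<in>N. u k \<odot> ?t k)"
        unfolding Y_def contract.diff contract_smul lkS contract_cx[OF j j0] contract_d[OF j] by simp
      then have "[f j (contract (e j) Y) = f j (?t j0 - q \<odot> (\<Sum>k\<in>N. u k \<odot> ?t k))] (mod p)"
        by simp
      also have "[f j (?t j0 - q \<odot> (\<Sum>k\<in>N. u k \<odot> ?t k)) = f j (?t j0) - f j (q \<odot> (\<Sum>k\<in>N. u k \<odot> ?t k))] (mod p)"
        by (intro functional_diff[OF f[OF j]] t j0 Cyc_smul tS)
      also have "[f j (?t j0) - f j (q \<odot> (\<Sum>k\<in>N. u k \<odot> ?t k)) = of_bool (j = j0) - q * f j (\<Sum>k\<in>N. u k \<odot> ?t k)] (mod p)"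
        by (intro cong_diff ft j0 functional_smul[OF f[OF j]] tS)
      also have "[of_bool (j = j0) - q * f j (\<Sum>k\<in>N. u k \<odot> ?t k) = of_bool (j = j0) - q * (\<Sum>k\<in>N. u k * f j (?t k))] (mod p)"
        by (intro cong_diff cong_mult cong_refl functional_lincomb[OF f[OF j]] t)
      also have "[of_bool (j = j0) - q * (\<Sum>k\<in>N. u k * f j (?t k)) = of_bool (j = j0) - q * (\<Sum>k\<in>N. u k * of_bool (j = k))] (mod p)"
        by (intro cong_diff cong_mult cong_sum cong_refl ft)
      also have "(\<Sum>k\<in>N. u k * of_bool (j = k)) = u j"
        using N j by (simp add: of_bool_def if_distrib sum.delta' cong: if_cong)
      finally show ?thesis .
    qed
    have "\<exists>a. Y - lincomb ?r y a \<in> Bd (matchings_on E V) (Suc s)"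
      using y Y unfolding spans_lincomb by blast
    then obtain a where a: "Y - lincomb ?r y a \<in> Bd (matchings_on E V) (Suc s)" ..
    define b where "b = a(?r := q)"
    have "[(\<Sum>k<Suc ?r. b k * v k j) = of_bool (j = j0)] (mod p)" if j: "j \<in> N" for j
    proof -
      have F: "functional (matchings_on E V) (Suc s) p (\<lambda>c. f j (contract (e j) c))"
        by (rule functional_contract[OF V f[OF j]])
      have "[(\<Sum>k<?r. a k * f j (contract (e j) (y k))) = f j (contract (e j) (lincomb ?r y a))] (mod p)"
        unfolding lincomb_def
        by (rule cong_sym, rule functional_lincomb[OF F]) (use y in \<open>auto simp: spans_def\<close>)
      also have "[f j (contract (e j) (lincomb ?r y a)) = f j (contract (e j) Y)] (mod p)"
        by (rule cong_sym, rule functional_cong_Bd[OF F Y lincomb_Cyc[OF y] a])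
      also note fY[OF j]
      finally have "[(\<Sum>k<?r. a k * f j (contract (e j) (y k))) + q * u j = of_bool (j = j0) - q * u j + q * u j] (mod p)"
        by (intro cong_add cong_refl)
      moreover have "(\<Sum>k<Suc ?r. b k * v k j) = (\<Sum>k<?r. a k * f j (contract (e j) (y k))) + q * u j"
        by (simp add: b_def v_def)
      ultimately show ?thesis
        by simp
    qed
    then show "\<exists>a. \<forall>j\<in>N. [(\<Sum>k<Suc ?r. a k * v k j) = of_bool (j = j0)] (mod p)"
      by blast
  qed
  then show ?thesis
    by simp
qed

section \<open>Renumbering the points of a path cycle\<close>

definition homologous :: "'a set set \<Rightarrow> 'a set \<Rightarrow> nat \<Rightarrow> ('a set list \<Rightarrow> int) \<Rightarrow> ('a set list \<Rightarrow> int) \<Rightarrow> bool"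
  where "homologous E V s x y \<longleftrightarrow> x - y \<in> Bd (matchings_on E V) s"

lemma homologous_refl: "homologous E V s x x"
  by (simp add: homologous_def Bd_zero)

lemma homologous_sym: "homologous E V s x y \<Longrightarrow> homologous E V s y x"
  unfolding homologous_def using Bd_uminus[of "x - y"] by simp

lemma homologous_trans [trans]: "homologous E V s x y \<Longrightarrow> homologous E V s y z \<Longrightarrow> homologous E V s x z"
  unfolding homologous_def using Bd_add[of "x - y" _ _ "y - z"] by simp

lemma homologous_minus: "homologous E V s x y \<Longrightarrow> homologous E V s (- x) (- y)"
  unfolding homologous_def using Bd_uminus[of "x - y"] by (simp add: algebra_simps)

lemma homologous_minus_swap: "homologous E V s x (- y) \<Longrightarrow> homologous E V s (- x) y"
  using homologous_minus[of E V s x "- y"] by simp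

lemma homologous_smul: "homologous E V s x y \<Longrightarrow> homologous E V s (a \<odot> x) (a \<odot> y)"
  using Bd_smul[of "x - y"] by (simp add: homologous_def smul_distribs)

text \<open>
  The join of a path cycle with an arbitrary chain, so that relations between short path cycles can be
  transported into longer ones.
\<close>

fun join_paths :: "'a list \<Rightarrow> ('a set list \<Rightarrow> int) \<Rightarrow> 'a set list \<Rightarrow> int"
  where "join_paths (a # b # c # l) x = join_path a b c (join_paths l x)"
  | "join_paths _ x = x"

lemma path_cycle_eq: "path_cycle l = join_paths l unit_chain"
  by (induction l rule: path_cycle.induct) auto

lemma dvd3_Suc: "3 dvd Suc (Suc (Suc n)) \<longleftrightarrow> 3 dvd n"
  by presburger

lemma div3_length: "length (a # b # c # l) div 3 = Suc (length l div 3)"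
  by simp

lemma join_paths_append: "3 dvd length l \<Longrightarrow> join_paths (l @ l') x = join_paths l (join_paths l' x)"
proof (induction l x rule: join_paths.induct)
  case (1 a b c l x)
  then have "3 dvd length l"
    by (simp add: dvd3_Suc)
  then have "join_paths ((a # b # c # l) @ l') x = join_paths (a # b # c # l) (join_paths l' x)"
    using 1 by simp
  then show ?case .
qed (auto dest: dvd_imp_le)

lemma join_paths_minus: "join_paths l (- x) = - join_paths l x"
  by (induction l "- x" rule: join_paths.induct) (auto simp: join_path.minus)

lemma join_paths_diff: "join_paths l (x - y) = join_paths l x - join_paths l y"
proof (induction l rule: path_cycle.induct)
  case (1 a b c l)
  have "join_paths (a # b # c # l) (x - y) = join_paths (a # b # c # l) x - join_paths (a # b # c # l) y"
    unfolding join_paths.simps 1 by (rule join_path.diff)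
  then show ?case .
qed auto

lemma join_paths_Bd:
  assumes "finite V" "distinct l" "set l \<inter> V = {}" "path_edges E l" "x \<in> Bd (matchings_on E V) s" "set l \<union> V \<subseteq> W" "finite W"
    "3 dvd length l"
  shows "join_paths l x \<in> Bd (matchings_on E W) (length l div 3 + s)"
  using assms
proof (induction l arbitrary: W rule: path_cycle.induct)
  case (1 a b c l)
  have "join_paths l x \<in> Bd (matchings_on E (W - {a, b, c})) (length l div 3 + s)"
    using 1(2-) by (intro 1(1)) (auto simp: dvd3_Suc)
  then have "join_path a b c (join_paths l x) \<in> Bd (matchings_on E W) (Suc (length l div 3 + s))"
    using 1(2-) by (intro join_path_Bd) auto
  then have "join_paths (a # b # c # l) x \<in> Bd (matchings_on E W) (length (a # b # c # l) div 3 + s)"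
    unfolding div3_length by simp
  then show ?case .
qed (auto intro: Bd_mono[OF _ matchings_on_mono] dest: dvd_imp_le)

lemma join_paths_homologous:
  assumes "homologous E V s x y" "finite V" "distinct l" "set l \<inter> V = {}" "path_edges E l" "set l \<union> V \<subseteq> W" "finite W"
    "3 dvd length l"
  shows "homologous E W (length l div 3 + s) (join_paths l x) (join_paths l y)"
  using join_paths_Bd[OF assms(2-5) _ assms(6-8), of "x - y" s] assms(1) by (simp add: homologous_def join_paths_diff)

lemma join_paths_join_path: "join_paths l (join_path a b c x) = (-1) ^ (length l div 3) \<odot> join_path a b c (join_paths l x)"
proof (induction l rule: path_cycle.induct)
  case (1 d e f l)
  have IH: "join_paths l (join_path a b c x) = (-1) ^ (length l div 3) \<odot> join_path a b c (join_paths l x)"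
    using 1 .
  have "join_paths (d # e # f # l) (join_path a b c x) = (-1) ^ (length l div 3) \<odot> join_path d e f (join_path a b c (join_paths l x))"
    unfolding join_paths.simps IH join_path_smul ..
  also have "\<dots> = (-1) ^ (length (d # e # f # l) div 3) \<odot> join_path a b c (join_paths (d # e # f # l) x)"
  proof -
    have "length (d # e # f # l) div 3 = Suc (length l div 3)"
      by simp
    then show ?thesis
      by (simp only: join_paths.simps join_path_anticommute[of d e f a] smul_distribs power_Suc smul_simps mult_minus1)
  qed
  finally show ?case .
qed auto

lemma join_paths_smul: "join_paths l (m \<odot> x) = m \<odot> join_paths l x"
proof (induction l rule: path_cycle.induct)
  case (1 a b c l)
  then have "join_paths l (m \<odot> x) = m \<odot> join_paths l x" .
  then have "join_paths (a # b # c # l) (m \<odot> x) = m \<odot> join_paths (a # b # c # l) x"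
    by (simp add: join_path_smul)
  then show ?case .
qed auto

lemma join_paths_move_block:
  assumes "3 dvd length l" "3 dvd length l'"
  shows "join_paths (l @ a # b # c # l' @ r) x = (-1) ^ (length l' div 3) \<odot> join_paths (l @ l' @ a # b # c # r) x"
proof -
  have "join_paths (a # b # c # l' @ r) x = (-1) ^ (length l' div 3) \<odot> join_paths (l' @ a # b # c # r) x"
    using assms(2) by (simp add: join_paths_append join_paths_join_path flip: power_add)
  then show ?thesis
    using assms(1) by (simp add: join_paths_append join_paths_smul del: join_paths.simps)
qed

text \<open>
  All relations between path cycles below come from this one: disjoint edges are joined by an edge of the complex.
\<close>

lemma disjoint_edges_homologous:
  assumes "finite V" "p \<in> E" "q \<in> E" "p \<noteq> {}" "q \<noteq> {}" "p \<inter> q = {}" "p \<union> q \<subseteq> V"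
  shows "cone p unit_chain - cone q unit_chain \<in> Bd (matchings_on E V) (Suc 0)"
proof -
  have *: "boundary (cone v unit_chain) = (unit_chain :: 'a set list \<Rightarrow> int)" for v
    using boundary_chain_cone[OF unit_chain_in_chains[OF assms(1), of E], of v] boundary_chains_0[OF unit_chain_in_chains[OF assms(1), of E]]
    by (simp add: cone.zero)
  have 1: "unit_chain \<in> chains (matchings_on E (V - q - p)) 0"
    using assms(1) by (intro unit_chain_in_chains) auto
  have 2: "cone p unit_chain \<in> chains (matchings_on E (V - q)) (Suc 0)"
    by (intro cone_chains 1) (use assms in auto)
  have "cone q (cone p unit_chain) \<in> chains (matchings_on E V) (Suc (Suc 0))"
    by (rule cone_chains[OF _ _ _ _ 2]) (use assms in auto)
  moreover have "boundary (cone q (cone p unit_chain)) = cone p unit_chain - cone q unit_chain"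
    using boundary_chain_cone[OF 2] * by simp
  ultimately show ?thesis
    unfolding Bd_def by (intro image_eqI[where x="cone q (cone p unit_chain)"]) simp_all
qed

text \<open>
  On four points the two edges of a perfect matching are homologous, so the Klein four-group acts trivially.
\<close>

lemma join_path_square:
  assumes "distinct [d, e, f, g]"
  shows "homologous pairs {d, e, f, g} 1 (join_path d e f unit_chain) (join_path e d g unit_chain)"
proof -
  have "cone {d, g} unit_chain - cone {e, f} unit_chain \<in> Bd (MK {d, e, f, g}) (Suc 0)"
    using assms by (intro disjoint_edges_homologous) (auto simp: card_insert_if)
  moreover have "join_path d e f unit_chain - join_path e d g unit_chain = cone {d, g} unit_chain - cone {e, f} unit_chain"
    by (simp add: join_path_def insert_commute)
  ultimately show ?thesis
    by (simp add: homologous_def)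
qed

lemma path_cycle_square:
  assumes "distinct (l @ [d, e, f, g])" "3 dvd length l"
  shows "homologous pairs (set (l @ [d, e, f, g])) (Suc (length l div 3)) (path_cycle (l @ [d, e, f, g])) (path_cycle (l @ [e, d, g, f]))"
proof -
  have "homologous pairs (set (l @ [d, e, f, g])) (length l div 3 + 1) (join_paths l (join_path d e f unit_chain)) (join_paths l (join_path e d g unit_chain))"
    using assms by (intro join_paths_homologous[OF join_path_square] path_edges_pairs) auto
  then show ?thesis
    using assms(2) by (simp add: path_cycle_eq join_paths_append)
qed

lemma path_cycle_rev:
  assumes "3 dvd length l"
  shows "path_cycle (l @ [f, e, d, g]) = - path_cycle (l @ [d, e, f, g])"
  using assms by (simp add: path_cycle_eq join_paths_append join_path_rev[of f e d] join_paths_minus)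

text \<open>
  Conjugating the reversal of the last path by an element of the Klein four-group exchanges the hole with
  the middle of the path.
\<close>

lemma path_cycle_middle_hole:
  assumes "distinct (l @ [d, e, f, g])" "3 dvd length l"
  shows "homologous pairs (set (l @ [d, e, f, g])) (Suc (length l div 3)) (path_cycle (l @ [d, g, f, e])) (- path_cycle (l @ [d, e, f, g]))"
proof -
  let ?E = "homologous pairs (set (l @ [d, e, f, g])) (Suc (length l div 3))"
  have "?E (path_cycle (l @ [d, g, f, e])) (path_cycle (l @ [g, d, e, f]))"
  proof -
    have S: "set (l @ [d, g, f, e]) = set (l @ [d, e, f, g])" and d: "distinct (l @ [d, g, f, e])"
      using assms by auto
    show ?thesis
      using path_cycle_square[OF d assms(2)] unfolding S .
  qed
  also have "?E (path_cycle (l @ [g, d, e, f])) (- path_cycle (l @ [d, e, f, g]))"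
    unfolding path_cycle_rev[OF assms(2), of g d e f] by (rule homologous_minus[OF homologous_sym[OF path_cycle_square[OF assms]]])
  finally show ?thesis .
qed

text \<open>
  Over the integers this fails for a single path, where three classes with sum zero are permuted. A second path
  \<open>p q r\<close> provides what is missing: the hole can be exchanged with the middle of either path, hence the two middles
  with each other; conjugation by the Klein four-group moves one of them to an end of its path.
\<close>

lemma path_cycle_first_hole:
  assumes "distinct [p, q, r, d, e, f, g]"
  shows "homologous pairs {p, q, r, d, e, f, g} 2 (path_cycle [p, q, r, g, e, f, d]) (- path_cycle [p, q, r, d, e, f, g])"
proof -
  define S where "S = {p, q, r, d, e, f, g}"
  let ?E = "homologous pairs S 2"
  define ok where "ok l \<longleftrightarrow> distinct l \<and> set l = S" for l
  have swapblocks: "path_cycle [a, b, c, x, y, z, h] = - path_cycle [x, y, z, a, b, c, h]" for a b c x y z h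
    by (simp add: join_path_anticommute[of a b c])
  have mid: "?E (path_cycle [a, b, c, x, h, z, y]) (- path_cycle [a, b, c, x, y, z, h])"
    if "ok [a, b, c, x, y, z, h]" for a b c x y z h
  proof -
    have S: "set [a, b, c, x, y, z, h] = S" and d: "distinct ([a, b, c] @ [x, y, z, h])"
      using that by (simp_all add: ok_def)
    have n: "Suc (length [a, b, c] div 3) = 2" "3 dvd length [a, b, c]"
      by (simp_all add: dvd3_Suc)
    show ?thesis
      using path_cycle_middle_hole[OF d n(2)] unfolding S n(1) append.simps .
  qed
  have mid': "?E (path_cycle [a, h, c, x, y, z, b]) (- path_cycle [a, b, c, x, y, z, h])"
    if "ok [a, b, c, x, y, z, h]" for a b c x y z h
  proof -
    have "ok [x, y, z, a, b, c, h]"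
      using that by (auto simp: ok_def)
    from homologous_minus[OF mid[OF this]] show ?thesis
      unfolding swapblocks[of a h] swapblocks[of a b] .
  qed
  have sq: "?E (path_cycle [a, b, c, x, y, z, h]) (path_cycle [a, b, c, y, x, h, z])"
    if "ok [a, b, c, x, y, z, h]" for a b c x y z h
  proof -
    have S: "set [a, b, c, x, y, z, h] = S" and d: "distinct ([a, b, c] @ [x, y, z, h])"
      using that by (simp_all add: ok_def)
    have n: "Suc (length [a, b, c] div 3) = 2" "3 dvd length [a, b, c]"
      by (simp_all add: dvd3_Suc)
    show ?thesis
      using path_cycle_square[OF d n(2)] unfolding S n(1) append.simps .
  qed
  have mm: "?E (path_cycle [a, y, c, x, b, z, h]) (- path_cycle [a, b, c, x, y, z, h])"
    if "ok [a, b, c, x, y, z, h]" for a b c x y z h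
  proof -
    have "?E (path_cycle [a, y, c, x, b, z, h]) (- path_cycle [a, h, c, x, b, z, y])"
      using that by (intro mid') (auto simp: ok_def)
    also have "?E (- path_cycle [a, h, c, x, b, z, y]) (path_cycle [a, h, c, x, y, z, b])"
      using that by (intro homologous_minus_swap mid) (auto simp: ok_def)
    also have "?E (path_cycle [a, h, c, x, y, z, b]) (- path_cycle [a, b, c, x, y, z, h])"
      using that by (rule mid')
    finally show ?thesis .
  qed
  have mf: "?E (path_cycle [a, x, c, b, y, z, h]) (- path_cycle [a, b, c, x, y, z, h])"
    if "ok [a, b, c, x, y, z, h]" for a b c x y z h
  proof -
    have "?E (path_cycle [a, x, c, b, y, z, h]) (path_cycle [a, x, c, y, b, h, z])"
      using that by (intro sq) (auto simp: ok_def)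
    also have "?E (path_cycle [a, x, c, y, b, h, z]) (- path_cycle [a, b, c, y, x, h, z])"
      using that by (intro mm) (auto simp: ok_def)
    also have "?E (- path_cycle [a, b, c, y, x, h, z]) (- path_cycle [a, b, c, x, y, z, h])"
      using that by (intro homologous_minus sq) (auto simp: ok_def)
    finally show ?thesis .
  qed
  have ok: "ok [p, q, r, d, e, f, g]" "ok [p, q, r, g, e, f, d]" "ok [p, g, r, q, e, f, d]" "ok [p, d, r, q, e, f, g]"
    using assms by (auto simp: ok_def S_def)
  have "?E (path_cycle [p, q, r, g, e, f, d]) (- path_cycle [p, g, r, q, e, f, d])"
    by (rule mf) (rule ok)
  also have "?E (- path_cycle [p, g, r, q, e, f, d]) (path_cycle [p, d, r, q, e, f, g])"
    by (intro homologous_minus_swap mid') (rule ok)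
  also have "?E (path_cycle [p, d, r, q, e, f, g]) (- path_cycle [p, q, r, d, e, f, g])"
    by (rule mf) (rule ok)
  finally show ?thesis
    by (simp only: S_def)
qed

lemma path_cycle_hole_last:
  assumes "distinct (l @ [p, q, r, d, e, f, g])" "3 dvd length l" "y \<in> {d, e, f}"
  shows "homologous pairs (set (l @ [p, q, r, d, e, f, g])) (length l div 3 + 2)
    (path_cycle (map (transpose g y) (l @ [p, q, r, d, e, f, g]))) (- path_cycle (l @ [p, q, r, d, e, f, g]))"
proof -
  let ?S = "{p, q, r, d, e, f, g}"
  have fix1: "map (transpose g y) l = l"
    using assms(1,3) by (intro map_idI) (auto simp: transpose_def)
  have d: "distinct [p, q, r, d, e, f, g]"
    using assms(1) by simp
  have "homologous pairs ?S 2 (path_cycle (map (transpose g y) [p, q, r, d, e, f, g])) (- path_cycle [p, q, r, d, e, f, g])"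
  proof -
    consider "y = d" | "y = e" | "y = f"
      using assms(3) by blast
    then show ?thesis
    proof cases
      case 1
      then have "map (transpose g y) [p, q, r, d, e, f, g] = [p, q, r, g, e, f, d]"
        using d by (auto simp: transpose_def)
      then show ?thesis
        using path_cycle_first_hole[OF d] by (simp only:)
    next
      case 2
      then have "map (transpose g y) [p, q, r, d, e, f, g] = [p, q, r] @ [d, g, f, e]"
        using d by (auto simp: transpose_def)
      then show ?thesis
        using path_cycle_middle_hole[of "[p, q, r]" d e f g] d
        by (simp only:) (simp add: dvd3_Suc numeral_2_eq_2)
    next
      case 3
      then have "map (transpose g y) [p, q, r, d, e, f, g] = [p, q, r, d, e, g, f]"
        using d by (auto simp: transpose_def)
      moreover have "homologous pairs ?S 2 (- path_cycle [p, q, r, g, e, d, f]) (path_cycle [p, q, r, f, e, d, g])"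
      proof -
        have "distinct [p, q, r, f, e, d, g]" "{p, q, r, f, e, d, g} = ?S"
          using d by auto
        then show ?thesis
          using path_cycle_first_hole[of p q r f e d g] by (intro homologous_minus_swap) (simp only:)
      qed
      moreover have "path_cycle [p, q, r, g, e, d, f] = - path_cycle [p, q, r, d, e, g, f]"
        "path_cycle [p, q, r, f, e, d, g] = - path_cycle [p, q, r, d, e, f, g]"
        by (simp_all add: join_path_rev[of g e d] join_path_rev[of f e d] join_path.minus)
      ultimately show ?thesis
        by (simp only: minus_minus)
    qed
  qed
  then have "homologous pairs (set (l @ [p, q, r, d, e, f, g])) (length l div 3 + 2)
    (join_paths l (path_cycle (map (transpose g y) [p, q, r, d, e, f, g]))) (join_paths l (- path_cycle [p, q, r, d, e, f, g]))"
    by (rule join_paths_homologous) (use assms(1,2) in \<open>auto simp: path_edges_pairs\<close>)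
  then show ?thesis
    unfolding map_append fix1 join_paths_minus path_cycle_eq join_paths_append[OF assms(2)] .
qed

lemma length3E:
  assumes "3 dvd length l" "l \<noteq> []"
  obtains l' a b c where "l = l' @ [a, b, c]" "3 dvd length l'"
proof -
  obtain n where n: "length l = 3 * n"
    using assms(1) by (auto elim: dvdE)
  with assms(2) have "3 \<le> length l"
    by (cases n) auto
  define d where "d = drop (length l - 3) l"
  have "length d = Suc (Suc (Suc 0))"
    using \<open>3 \<le> length l\<close> by (simp add: d_def)
  then obtain a b c where "d = [a, b, c]"
    by (auto simp: length_Suc_conv)
  moreover have "3 dvd length (take (length l - 3) l)"
    using n by (auto simp: min_def right_diff_distrib')
  ultimately show thesis
    using that[of "take (length l - 3) l" a b c] by (metis append_take_drop_id d_def)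
qed

lemma block_split:
  assumes "3 dvd length l" "y \<in> set l"
  obtains l1 d e f l2 where "l = l1 @ d # e # f # l2" "y \<in> {d, e, f}" "3 dvd length l1" "3 dvd length l2"
  using assms
proof (induction l arbitrary: thesis rule: path_cycle.induct)
  case (1 a b c l)
  have l: "3 dvd length l"
    using 1(3) by (simp add: dvd3_Suc)
  show ?case
  proof (cases "y \<in> {a, b, c}")
    case True
    then show ?thesis
      using 1(2)[of "[]" a b c l] l by simp
  next
    case False
    then have "y \<in> set l"
      using 1(4) by auto
    from 1(1)[OF _ l this] obtain l1 d e f l2
      where "l = l1 @ d # e # f # l2" "y \<in> {d, e, f}" "3 dvd length l1" "3 dvd length l2" .
    then show ?thesis
      using 1(2)[of "a # b # c # l1" d e f l2] by (simp add: dvd3_Suc)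
  qed
qed (auto dest: dvd_imp_le)

lemma path_cycle_hole:
  assumes l: "distinct (l @ [g])" "3 dvd length l" "6 \<le> length l" "y \<in> set l"
  shows "homologous pairs (set (l @ [g])) (length l div 3) (path_cycle (map (transpose g y) (l @ [g]))) (- path_cycle (l @ [g]))"
proof -
  obtain l1 d e f l2 where l12: "l = l1 @ d # e # f # l2" "y \<in> {d, e, f}" "3 dvd length l1" "3 dvd length l2"
    using block_split[OF l(2,4)] .
  have "3 dvd length (l1 @ l2)" "l1 @ l2 \<noteq> []"
    using l(3) l12 by auto
  then obtain m p q r where m: "l1 @ l2 = m @ [p, q, r]" "3 dvd length m"
    by (rule length3E)
  let ?t = "transpose g y" and ?e = "(-1) ^ (length l2 div 3) :: int"
  have z1: "path_cycle (map ?t (l @ [g])) = ?e \<odot> path_cycle (map ?t (m @ [p, q, r, d, e, f, g]))"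
  proof -
    have "map ?t (m @ [p, q, r, d, e, f, g]) = map ?t (l1 @ l2) @ map ?t [d, e, f, g]"
      unfolding m by simp
    then have "map ?t (m @ [p, q, r, d, e, f, g]) = map ?t l1 @ map ?t l2 @ ?t d # ?t e # ?t f # [?t g]"
      by (simp only: map_append list.map append_assoc append.simps)
    moreover have "map ?t (l @ [g]) = map ?t l1 @ ?t d # ?t e # ?t f # map ?t l2 @ [?t g]"
      by (simp only: l12(1) map_append list.map append_assoc append.simps)
    ultimately show ?thesis
      using l12(3,4) join_paths_move_block[of "map ?t l1" "map ?t l2" "?t d" "?t e" "?t f" "[?t g]" unit_chain]
      by (simp only: path_cycle_eq length_map)
  qed
  have z2: "path_cycle (l @ [g]) = ?e \<odot> path_cycle (m @ [p, q, r, d, e, f, g])"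
  proof -
    have "m @ [p, q, r, d, e, f, g] = l1 @ l2 @ [d, e, f, g]"
      using m by simp
    then show ?thesis
      using l12(3,4) join_paths_move_block[of l1 l2 d e f "[g]" unit_chain]
      by (simp only: l12(1) path_cycle_eq append_assoc append.simps)
  qed
  have e: "homologous pairs (set (m @ [p, q, r, d, e, f, g])) (length m div 3 + 2)
      (path_cycle (map ?t (m @ [p, q, r, d, e, f, g]))) (- path_cycle (m @ [p, q, r, d, e, f, g]))"
  proof (rule path_cycle_hole_last)
    have "mset (m @ [p, q, r, d, e, f, g]) = mset (l1 @ l2) + mset [d, e, f, g]"
      unfolding m by simp
    also have "\<dots> = mset (l @ [g])"
      by (simp add: l12)
    finally show "distinct (m @ [p, q, r, d, e, f, g])"
      using l(1) mset_eq_imp_distinct_iff by blast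
  qed (use m l12 in auto)
  have s: "set (m @ [p, q, r, d, e, f, g]) = set (l @ [g])"
    using arg_cong[OF m(1), of set] by (auto simp: l12)
  have n: "length m div 3 + 2 = length l div 3"
    using arg_cong[OF m(1), of length] by (simp add: l12)
  show ?thesis
    using homologous_smul[OF e, of ?e] by (simp only: z1 z2 s n smul_distribs)
qed

text \<open>
  An exchange of two covered points is a product of three exchanges that each involve the current hole.
\<close>

theorem path_cycle_transpose:
  assumes l: "distinct l" "length l = 3 * k + 1" "2 \<le> k" "x \<in> set l" "y \<in> set l" "x \<noteq> y"
  shows "homologous pairs (set l) k (path_cycle (map (transpose x y) l)) (- path_cycle l)"
proof -
  have hole: "homologous pairs (set (m @ [g])) k (path_cycle (map (transpose g z) (m @ [g]))) (- path_cycle (m @ [g]))"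
    if "distinct (m @ [g])" "length m = 3 * k" "z \<in> set m" for m g z
    using path_cycle_hole[of m g z] that l(3) by simp
  obtain m h where m: "l = m @ [h]"
    using l(2) by (cases l rule: rev_cases) auto
  have len: "length m = 3 * k"
    using l(2) m by simp
  show ?thesis
  proof (cases "x = h \<or> y = h")
    case True
    then show ?thesis
      using hole[of m h x] hole[of m h y] l m len by (auto simp: transpose_commute)
  next
    case False
    let ?m1 = "map (transpose h x) m"
    let ?m2 = "map (transpose x y) ?m1"
    let ?m3 = "map (transpose y h) ?m2"
    have xy: "x \<in> set m" "y \<in> set m" "h \<notin> set m" "x \<noteq> h" "y \<noteq> h"
      using l m False by auto
    have s1: "set (?m1 @ [x]) = set l" and d1: "distinct (?m1 @ [x])"
      using xy l(1) m by (auto simp: distinct_map inj_on_def transpose_def image_iff split: if_splits)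
    have s2: "set (?m2 @ [y]) = set l" and d2: "distinct (?m2 @ [y])"
    proof -
      have "?m2 @ [y] = map (transpose x y) (?m1 @ [x])"
        by simp
      then show "set (?m2 @ [y]) = set l" "distinct (?m2 @ [y])"
        using s1 d1 l(4,5) by (simp_all only: set_map distinct_map inj_on_transpose transpose_image_eq)
    qed
    have y1: "y \<in> set ?m1"
      using xy l(6) by (auto simp: image_iff transpose_def intro!: bexI[of _ y])
    have "h \<in> set (?m2 @ [y])"
      unfolding s2 m by simp
    then have y2: "h \<in> set ?m2"
      using xy by simp
    have "map (transpose x y) l = ?m3 @ [h]"
      using xy l(6) by (auto simp: m transpose_def)
    moreover have "homologous pairs (set l) k (path_cycle (?m3 @ [h])) (- path_cycle (?m2 @ [y]))"
      using hole[OF d2 _ y2] len unfolding s2 by simp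
    moreover have "homologous pairs (set l) k (- path_cycle (?m2 @ [y])) (path_cycle (?m1 @ [x]))"
      using hole[OF d1 _ y1] len unfolding s1 by (intro homologous_minus_swap) simp
    moreover have "homologous pairs (set l) k (path_cycle (?m1 @ [x])) (- path_cycle l)"
      using hole[of m h x] len xy l(1) m by simp
    ultimately show ?thesis
      by (auto intro: homologous_trans)
  qed
qed

section \<open>A functional modulo 3\<close>

text \<open>
  Any two enumerations of a set differ by a sequence of exchanges of points.
\<close>

lemma enumeration_induct [consumes 4, case_names base transpose]:
  assumes "distinct l" "set l = V" "distinct l0" "set l0 = V" "Q l0"
    and step: "\<And>l x y. distinct l \<Longrightarrow> set l = V \<Longrightarrow> x \<in> V \<Longrightarrow> y \<in> V \<Longrightarrow> x \<noteq> y \<Longrightarrow> Q l \<Longrightarrow>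
      Q (map (transpose x y) l)"
  shows "Q l"
proof -
  have transp: "permute_list (transpose a b) xs = map (transpose (xs ! a) (xs ! b)) xs"
    if "distinct xs" "a < length xs" "b < length xs" for a b and xs :: "'a list"
    using that by (intro nth_equalityI)
      (auto simp: permute_list_nth permutes_swap_id transpose_def nth_eq_iff_index_eq)
  have len: "length l = length l0"
    using assms(1-4) by (metis distinct_card)
  have "mset l0 = mset l"
    using assms(1-4) by (metis set_eq_iff_mset_eq_distinct)
  then obtain p where p: "p permutes {..<length l}" "permute_list p l = l0"
    using mset_eq_permutation[of l0 l] by metis
  have "\<forall>xs. distinct xs \<and> set xs = V \<and> length xs = length l0 \<and> Q (permute_list p xs) \<longrightarrow> Q xs"
    using p(1) finite_lessThan unfolding len
  proof (induction rule: permutes_induct)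
    case (swap a b p)
    show ?case
    proof (intro allI impI; elim conjE)
      fix xs assume xs: "distinct xs" "set xs = V" "length xs = length l0"
        and Q: "Q (permute_list (transpose a b \<circ> p) xs)"
      let ?ys = "permute_list (transpose a b) xs"
      have ys: "?ys = map (transpose (xs ! a) (xs ! b)) xs"
        using xs swap by (intro transp) auto
      have ab: "xs ! a \<in> V" "xs ! b \<in> V" "xs ! a \<noteq> xs ! b"
        using xs swap by (auto simp: nth_eq_iff_index_eq)
      have dys: "distinct ?ys" "set ?ys = V"
        unfolding ys using xs ab by (simp_all add: distinct_map)
      have "permute_list p ?ys = permute_list (transpose a b \<circ> p) xs"
        using swap.hyps xs by (subst permute_list_compose) auto
      then have "Q ?ys"
        using swap.IH Q dys xs by simp
      from step[OF dys ab this] show "Q xs"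
        unfolding ys by (simp add: o_def)
    qed
  qed simp
  then show ?thesis
    using p(2) assms(1,2,5) len by metis
qed

text \<open>
  The sign of an enumeration up to a constant factor. With functions of this kind no reference enumeration has to
  be carried along when points are removed: prefixing a fixed list yields a sign function on the rest.
\<close>

definition sign_function :: "'a set \<Rightarrow> ('a list \<Rightarrow> int) \<Rightarrow> bool"
  where "sign_function V s \<longleftrightarrow> (\<forall>l x y. distinct l \<and> set l = V \<and> x \<in> V \<and> y \<in> V \<and> x \<noteq> y \<longrightarrow>
    s (map (transpose x y) l) = - s l)"

lemma sign_functionD:
  "sign_function V s \<Longrightarrow> distinct l \<Longrightarrow> set l = V \<Longrightarrow> x \<in> V \<Longrightarrow> y \<in> V \<Longrightarrow> x \<noteq> y \<Longrightarrow>
    s (map (transpose x y) l) = - s l"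
  by (auto simp: sign_function_def)

lemma sign_function_oriented_simplex: "sign_function V (oriented_simplex l0)"
  unfolding sign_function_def
proof (intro allI impI; elim conjE)
  fix l :: "'a list" and x y
  assume l: "distinct l" "set l = V" "x \<in> V" "y \<in> V" "x \<noteq> y"
  obtain a b where ab: "a < length l" "l ! a = x" "b < length l" "l ! b = y"
    using l(2-4) by (metis in_set_conv_nth)
  have t: "transpose a b permutes {..<length l}"
    using ab by (intro permutes_swap_id) auto
  have "map (transpose x y) l = permute_list (transpose a b) l"
    using l ab by (intro nth_equalityI) (auto simp: permute_list_nth[OF t] transpose_def nth_eq_iff_index_eq)
  moreover have "sign (transpose a b) = - 1"
    using ab l(5) by (simp add: sign_swap_id) auto
  ultimately show "oriented_simplex l0 (map (transpose x y) l) = - oriented_simplex l0 l"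
    using alternating_oriented_simplex[of l0] t by (simp add: alternating_def)
qed

lemma card4E:
  assumes "card V = 4"
  obtains d e f g where "distinct [d, e, f, g]" "V = {d, e, f, g}"
proof -
  have "finite V"
    using assms card.infinite by fastforce
  then obtain l where l: "set l = V" "distinct l"
    using finite_distinct_list by blast
  then have "length l = 4"
    using assms by (metis distinct_card)
  then obtain d e f g where "l = [d, e, f, g]"
    by (auto simp: eval_nat_numeral length_Suc_conv)
  then show thesis
    using l that by auto
qed

text \<open>
  On four points the faces form three components, one for each perfect matching. The form is the total coefficient of one
  component minus that of another.
\<close>

definition pairing_form :: "'a list \<Rightarrow> ('a set list \<Rightarrow> int) \<Rightarrow> int"
  where "pairing_form l c = c [{l ! 0, l ! 1}] + c [{l ! 2, l ! 3}] - c [{l ! 0, l ! 2}] - c [{l ! 1, l ! 3}]"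

lemma complementary_edge:
  assumes "v \<in> pairs" "v \<subseteq> {d, e, f, g}" "v \<inter> {d, e} = {}"
  shows "v = {f, g}"
  using assms by (auto simp: card_2_iff)

text \<open>
  The component sums of a reduced cycle add up to zero. Hence the difference of two of them is, modulo 3, invariant
  under cyclic rotation of the components, and an exchange of two points reverses its sign.
\<close>

lemma functional_four_points:
  assumes V: "V = {d, e, f, g}" "distinct [d, e, f, g]"
    and s: "sign_function V s"
  shows "\<exists>\<phi>. functional (MK V) 1 3 \<phi> \<and> (\<forall>l. distinct l \<and> set l = V \<longrightarrow> [\<phi> (path_cycle l) = s l] (mod 3))"
proof -
  have fin: "finite V"
    by (simp add: V)
  have card4: "card V = 4"
    using V by simp
  define l0 where "l0 = [d, e, f, g]"
  let ?\<phi> = "\<lambda>c. s l0 * pairing_form l0 c"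
  have opp: "boundary b [{x, y}] = b [{z, w}, {x, y}]"
    if b: "b \<in> chains (MK V) 2" and V': "V = {x, y, z, w}" "distinct [x, y, z, w]" for b x y z w
  proof -
    have "boundary b [{x, y}] = (\<Sum>v\<in>{{z, w}}. b (v # [{x, y}]))"
    proof (rule boundary_eq_sum)
      fix v assume "b (v # [{x, y}]) \<noteq> 0"
      then have "distinct [v, {x, y}]" "{v, {x, y}} \<in> MK V"
        using chainsD(3,4)[OF b, of "[v, {x, y}]"] by auto
      then show "v \<in> {{z, w}}"
        using complementary_edge[of v x y z w] V' by (auto simp: matchings_on_iff disjoint_def)
    qed simp
    then show ?thesis
      by simp
  qed
  have swap: "b [{z, w}, {x, y}] = - b [{x, y}, {z, w}]" if "b \<in> chains (MK V) 2" for b x y z w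
    using alternating_swap[OF chainsD(2)[OF that], of "[]" "{z, w}" "{x, y}" "[]"] by simp
  have Bd: "pairing_form l0 b = 0" if "b \<in> Bd (MK V) 1" for b
  proof -
    obtain c where c: "c \<in> chains (MK V) 2" "b = boundary c"
      using \<open>b \<in> Bd (MK V) 1\<close> by (auto simp: Bd_def numeral_2_eq_2)
    have "b [{d, e}] = c [{f, g}, {d, e}]" "b [{f, g}] = c [{d, e}, {f, g}]"
      "b [{d, f}] = c [{e, g}, {d, f}]" "b [{e, g}] = c [{d, f}, {e, g}]"
      unfolding c(2) by (rule opp[OF c(1)]; use V in auto)+
    then show ?thesis
      using swap[OF c(1), of f g d e] swap[OF c(1), of e g d f]
      by (simp add: pairing_form_def l0_def)
  qed
  have "functional (MK V) 1 3 ?\<phi>"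
    unfolding functional_def using Bd by (auto simp: pairing_form_def algebra_simps)
  moreover have "[?\<phi> (path_cycle l) = s l] (mod 3)" if l: "distinct l" "set l = V" for l
  proof -
    have "\<forall>c\<in>Cyc (MK V) 1. [s l * pairing_form l c = s l0 * pairing_form l0 c] (mod 3)"
      using l
    proof (rule enumeration_induct)
      show "distinct l0" "set l0 = V"
        using V by (auto simp: l0_def)
      fix l x y
      assume l: "distinct l" "set l = V" and xy: "x \<in> V" "y \<in> V" "x \<noteq> y"
        and IH: "\<forall>c\<in>Cyc (MK V) 1. [s l * pairing_form l c = s l0 * pairing_form l0 c] (mod 3)"
      have "length l = 4"
        using distinct_card[OF l(1)] l(2) card4 by simp
      then obtain D E F G where lD: "l = [D, E, F, G]"
        by (auto simp: eval_nat_numeral length_Suc_conv)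
      show "\<forall>c\<in>Cyc (MK V) 1. [s (map (transpose x y) l) * pairing_form (map (transpose x y) l) c = s l0 * pairing_form l0 c] (mod 3)"
      proof
        fix c assume c: "c \<in> Cyc (MK V) 1"
        have dist: "distinct [D, E, F, G]" and V': "V = {D, E, F, G}"
          using l by (auto simp: lD)
        let ?P = "{{D, E}, {D, F}, {D, G}, {E, F}, {E, G}, {F, G}}"
        have "boundary c [] = (\<Sum>v\<in>?P. c [v])"
        proof (rule boundary_eq_sum)
          fix v assume "c [v] \<noteq> 0"
          then have "v \<in> pairs" "v \<subseteq> V"
            using chainsD(4)[of c "MK V" 1 "[v]"] c by (auto simp: Cyc_def matchings_on_iff)
          then obtain a b where "v = {a, b}" "a \<noteq> b" "a \<in> {D, E, F, G}" "b \<in> {D, E, F, G}"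
            unfolding V' by (auto simp: card_2_iff)
          then show "v \<in> ?P"
            by (elim insertE emptyE) (simp_all add: doubleton_eq_iff)
        qed simp
        also have "\<dots> = c [{D, E}] + c [{D, F}] + c [{D, G}] + c [{E, F}] + c [{E, G}] + c [{F, G}]"
          using dist by (simp add: doubleton_eq_iff)
        finally have tot: "c [{D, E}] + c [{D, F}] + c [{D, G}] + c [{E, F}] + c [{E, G}] + c [{F, G}] = 0"
          using c by (simp add: Cyc_def)
        have "3 dvd pairing_form (map (transpose x y) l) c + pairing_form l c"
        proof -
          have com: "{E, D} = {D, E}" "{F, D} = {D, F}" "{G, D} = {D, G}" "{F, E} = {E, F}" "{G, E} = {E, G}" "{G, F} = {F, G}"
            by auto
          have m: "3 dvd (a::int)" if "a = 3 * b" for a b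
            using that by simp
          consider "{x, y} = {D, E}" | "{x, y} = {D, F}" | "{x, y} = {D, G}" | "{x, y} = {E, F}" | "{x, y} = {E, G}" | "{x, y} = {F, G}"
            using xy V' by auto
          then show ?thesis
          proof cases
            case 1
            then have "map (transpose x y) l = [E, D, F, G]"
              using dist unfolding lD doubleton_eq_iff by (auto simp: transpose_def)
            then show ?thesis
              using tot by (intro m[of _ "c [{D, E}] + c [{F, G}]"]) (simp add: pairing_form_def lD com)
          next
            case 2
            then have "map (transpose x y) l = [F, E, D, G]"
              using dist unfolding lD doubleton_eq_iff by (auto simp: transpose_def)
            then show ?thesis
              using tot by (intro m[of _ "- c [{D, F}] - c [{E, G}]"]) (simp add: pairing_form_def lD com)
          next
            case 3
            then have "map (transpose x y) l = [G, E, F, D]"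
              using dist unfolding lD doubleton_eq_iff by (auto simp: transpose_def)
            then show ?thesis
              by (simp add: pairing_form_def lD com)
          next
            case 4
            then have "map (transpose x y) l = [D, F, E, G]"
              using dist unfolding lD doubleton_eq_iff by (auto simp: transpose_def)
            then show ?thesis
              by (simp add: pairing_form_def lD com)
          next
            case 5
            then have "map (transpose x y) l = [D, G, F, E]"
              using dist unfolding lD doubleton_eq_iff by (auto simp: transpose_def)
            then show ?thesis
              using tot by (intro m[of _ "- c [{D, F}] - c [{E, G}]"]) (simp add: pairing_form_def lD com)
          next
            case 6
            then have "map (transpose x y) l = [D, E, G, F]"
              using dist unfolding lD doubleton_eq_iff by (auto simp: transpose_def)
            then show ?thesis
              using tot by (intro m[of _ "c [{D, E}] + c [{F, G}]"]) (simp add: pairing_form_def lD com)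
          qed
        qed
        then have "[- (s l) * pairing_form (map (transpose x y) l) c = s l * pairing_form l c] (mod 3)"
          unfolding cong_iff_dvd_diff
          by (metis (no_types, opaque_lifting) dvd_minus_iff dvd_mult minus_add_distrib mult_minus_left ring_class.ring_distribs(1) diff_conv_add_uminus)
        then show "[s (map (transpose x y) l) * pairing_form (map (transpose x y) l) c = s l0 * pairing_form l0 c] (mod 3)"
          using IH c cong_trans sign_functionD[OF s l xy] by metis
      qed
    qed simp
    moreover have len: "length l = 4"
      using distinct_card[OF l(1)] l(2) card4 by simp
    moreover have "path_cycle l \<in> Cyc (MK V) 1"
      using path_cycle_Cyc[of V l pairs] l fin path_edges_pairs[OF l(1)] len by simp
    moreover have "pairing_form l (path_cycle l) = 1"
    proof -
      obtain D E F G where lD: "l = [D, E, F, G]"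
        using len by (auto simp: eval_nat_numeral length_Suc_conv)
      then show ?thesis
        using l(1) by (auto simp: pairing_form_def join_path_def unit_chain_def doubleton_eq_iff)
    qed
    ultimately show ?thesis
      by (metis cong_sym mult.right_neutral)
  qed
  ultimately show ?thesis
    by blast
qed

lemma path_span_Cyc:
  assumes "finite V" "card V div 3 = s" "c \<in> path_span V s"
  shows "c \<in> Cyc (MK V) s"
  using assms(3)
proof (induction rule: path_span.induct)
  case (Bd b)
  then show ?case
    using finite_complex_matchings_on[OF assms(1), of pairs] by (intro Bd_in_Cyc) (auto simp: finite_complex_def)
next
  case (path_cycle l)
  then have "path_cycle l \<in> Cyc (MK V) s"
    using path_cycle_Cyc[of V l pairs] assms distinct_card[of l] by (auto simp: path_edges_pairs)
  then show ?case .
next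
  case (add c d)
  then show ?case
    by (intro Cyc_add)
next
  case (minus c)
  then show ?case
    by (intro Cyc_uminus)
qed

text \<open>
  If the boundary of \<open>c\<close> has no faces with \<open>{i, u}\<close> and an edge at \<open>j\<close>, then the contractions of \<open>c\<close> with two such
  edges are cycles, and the remaining part of \<open>contract {i, u} c\<close> shows how their sum bounds.
\<close>

lemma link_sum:
  assumes V: "finite V" and ij: "i \<in> V" "j \<in> V" "i \<noteq> j" and c: "c \<in> chains (MK V) (Suc (Suc k))"
    and u: "u \<in> V - {i, j}"
    and b: "\<And>v. v \<in> V - {i, j, u} \<Longrightarrow> contract {j, v} (contract {i, u} (boundary c)) = 0"
  shows "\<And>v. v \<in> V - {i, j, u} \<Longrightarrow> contract {j, v} (contract {i, u} c) \<in> Cyc (MK (V - {i, j, u, v})) k"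
    and "(\<Sum>v\<in>V - {i, j, u}. contract {j, v} (contract {i, u} c)) + contract {i, u} (boundary c) \<in> Bd (MK (V - {i, j, u})) k"
proof -
  let ?U = "V - {i, j, u}"
  define x where "x = contract {i, u} c"
  define w where "w v = contract {j, v} x" for v
  have x: "x \<in> chains (MK (V - {i, u})) (Suc k)"
    unfolding x_def by (rule contract_chains[OF V c])
  have bx: "boundary x = - contract {i, u} (boundary c)"
    unfolding x_def by (rule boundary_chain_contract[OF c])
  have w: "w v \<in> Cyc (MK (V - {i, j, u, v})) k" if v: "v \<in> ?U" for v
  proof -
    have eq: "V - {i, u} - {j, v} = V - {i, j, u, v}"
      by auto
    have "w v \<in> chains (MK (V - {i, u} - {j, v})) k"
      unfolding w_def using V x by (intro contract_chains) auto
    moreover have "boundary (w v) = 0"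
      unfolding w_def boundary_chain_contract[OF x] bx using b[OF v] by (simp add: contract.minus)
    ultimately show ?thesis
      unfolding eq by (simp add: Cyc_def)
  qed
  then show "contract {j, v} (contract {i, u} c) \<in> Cyc (MK (V - {i, j, u, v})) k" if "v \<in> ?U" for v
    using that unfolding w_def x_def .
  have cnw: "cone {j, v} (w v) \<in> chains (MK (V - {i, u})) (Suc k)" if v: "v \<in> ?U" for v
  proof (rule cone_chains)
    have "V - {i, u} - {j, v} = V - {i, j, u, v}"
      by auto
    then show "w v \<in> chains (MK (V - {i, u} - {j, v})) k"
      using w[OF v] by (simp add: Cyc_def)
  qed (use v V ij u in \<open>auto simp: card_insert_if\<close>)
  define r where "r = x - (\<Sum>v\<in>?U. cone {j, v} (w v))"
  have r: "r \<in> chains (MK (V - {i, u})) (Suc k)"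
    unfolding r_def by (intro chains_diff x chains_sum cnw)
  have eq: "V - {i, u} - {j} = ?U"
    by auto
  have r': "r \<in> chains (MK ?U) (Suc k)"
    unfolding eq[symmetric]
  proof (rule chains_restrict[OF _ r])
    fix e assume e: "e \<in> pairs" "e \<subseteq> V - {i, u}" "e \<inter> {j} \<noteq> {}"
    then obtain v where ev: "e = {j, v}" "v \<noteq> j"
      using pairs_mem[of e j] by auto
    then have v: "v \<in> ?U"
      using e by auto
    have "contract e (cone {j, v'} (w v')) = (if v' = v then w v' else 0)" if v': "v' \<in> ?U" for v'
    proof -
      have "contract e (w v') = 0"
        using w[OF v'] ev by (intro contract_outside[of _ _ "V - {i, j, u, v'}"]) (auto simp: Cyc_def)
      then show ?thesis
        using ev v v' by (auto simp: contract_cone cone.zero doubleton_eq_iff)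
    qed
    then have "contract e (\<Sum>v\<in>?U. cone {j, v} (w v)) = (\<Sum>v'\<in>?U. if v' = v then w v' else 0)"
      unfolding contract.sum by (intro sum.cong) auto
    also have "\<dots> = w v"
      using v V by (simp add: sum.delta)
    finally show "contract e r = 0"
      unfolding r_def contract.diff by (simp add: w_def ev)
  qed (use V in auto)
  have "boundary (cone {j, v} (w v)) = w v" if "v \<in> ?U" for v
    using w[OF that] boundary_chain_cone[of "w v" _ k "{j, v}"] by (auto simp: Cyc_def cone.zero)
  then have "boundary (\<Sum>v\<in>?U. cone {j, v} (w v)) = (\<Sum>v\<in>?U. w v)"
    using boundary_chain_sum[of ?U "\<lambda>v. cone {j, v} (w v)", OF cnw] by simp
  then have "boundary r = - contract {i, u} (boundary c) - (\<Sum>v\<in>?U. w v)"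
  proof -
    have S: "(\<Sum>v\<in>?U. cone {j, v} (w v)) \<in> chains (MK (V - {i, u})) (Suc k)"
      by (intro chains_sum cnw)
    show ?thesis
      if "boundary (\<Sum>v\<in>?U. cone {j, v} (w v)) = (\<Sum>v\<in>?U. w v)"
      unfolding r_def boundary_chain_diff[OF x S] bx that ..
  qed
  then have "boundary (- r) = (\<Sum>v\<in>?U. w v) + contract {i, u} (boundary c)"
    unfolding boundary_uminus by simp
  moreover have "- r \<in> chains (MK ?U) (Suc k)"
    by (rule chains_uminus[OF r'])
  ultimately have "(\<Sum>v\<in>?U. w v) + contract {i, u} (boundary c) \<in> Bd (MK ?U) k"
    unfolding Bd_def by (intro image_eqI[where x="- r"]) simp_all
  then show "(\<Sum>v\<in>?U. contract {j, v} (contract {i, u} c)) + contract {i, u} (boundary c) \<in> Bd (MK ?U) k"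
    unfolding w_def x_def .
qed


lemma path_cycle_snoc: "3 dvd length l \<Longrightarrow> path_cycle (l @ [v]) = path_cycle l"
  by (simp add: path_cycle_eq join_paths_append)

text \<open>
  A path cycle on the \<open>3k\<close> points other than \<open>i, j, u, v\<close> can have \<open>v\<close> or \<open>u\<close> as its hole. The lists \<open>u i j \<dots> v\<close> and \<open>v i j \<dots> u\<close>
  differ by one exchange, which is where the sign comes from; path cycles generate.
\<close>

lemma links_cong:
  assumes V: "finite V" "card V = 3 * k + 4" and ij: "i \<in> V" "j \<in> V" "i \<noteq> j"
    and u: "u \<in> V - {i, j}" and v: "v \<in> V - {i, j}" and uv: "u \<noteq> v"
    and s: "sign_function V s"
    and f: "functional (MK (V - {i, j, u})) k 3 f"
      "\<And>l. distinct l \<Longrightarrow> set l = V - {i, j, u} \<Longrightarrow> [f (path_cycle l) = s (u # i # j # l)] (mod 3)"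
    and g: "functional (MK (V - {i, j, v})) k 3 g"
      "\<And>l. distinct l \<Longrightarrow> set l = V - {i, j, v} \<Longrightarrow> [g (path_cycle l) = s (v # i # j # l)] (mod 3)"
    and w: "w \<in> Cyc (MK (V - {i, j, u, v})) k"
  shows "[f w = - g w] (mod 3)"
proof -
  let ?W = "V - {i, j, u, v}"
  have W: "finite ?W" "card ?W = 3 * k"
    using V ij u v uv by (auto simp: card_Diff_subset)
  have sub: "MK ?W \<subseteq> MK (V - {i, j, u})" "MK ?W \<subseteq> MK (V - {i, j, v})"
    by (auto intro!: matchings_on_mono)
  have Cyc: "c \<in> Cyc (MK (V - {i, j, u})) k" "c \<in> Cyc (MK (V - {i, j, v})) k"
    if "c \<in> path_span ?W k" for c
    using path_span_Cyc[OF W(1) _ that] W(2) Cyc_mono[OF _ sub(1)] Cyc_mono[OF _ sub(2)] by auto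
  have "w \<in> path_span ?W k"
    using path_cycles_generate[of ?W k] W w by auto
  then show ?thesis
  proof (induction rule: path_span.induct)
    case (Bd b)
    have "[f b = 0] (mod 3)" "[g b = 0] (mod 3)"
      using functional_Bd[OF f(1) Bd_mono[OF Bd sub(1)]] functional_Bd[OF g(1) Bd_mono[OF Bd sub(2)]] .
    then have "[f b = - g b] (mod 3)"
      by (simp add: cong_iff_dvd_diff)
    then show ?case .
  next
    case (path_cycle l)
    have len: "3 dvd length l"
      using distinct_card[OF path_cycle(1)] path_cycle(2) W(2) by (metis dvd_triv_left)
    have d: "distinct (u # i # j # l @ [v])" and st: "set (u # i # j # l @ [v]) = V"
      using path_cycle u v uv ij by auto
    have "map (transpose u v) l = l"
      using path_cycle by (intro map_idI) (auto simp: transpose_def)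
    then have "map (transpose u v) (u # i # j # l @ [v]) = v # i # j # l @ [u]"
      using u v by (auto simp: transpose_def)
    then have *: "s (v # i # j # l @ [u]) = - s (u # i # j # l @ [v])"
      using sign_functionD[OF s d st, of u v] u v uv by simp
    have "[f (path_cycle l) = s (u # i # j # l @ [v])] (mod 3)"
      using f(2)[of "l @ [v]"] path_cycle u v uv path_cycle_snoc[OF len, of v] by auto
    moreover have "[g (path_cycle l) = - s (u # i # j # l @ [v])] (mod 3)"
      unfolding *[symmetric] using g(2)[of "l @ [u]"] path_cycle u v uv path_cycle_snoc[OF len, of u] by auto
    ultimately have "[f (path_cycle l) - g (path_cycle l) * (-1) = s (u # i # j # l @ [v]) - (- s (u # i # j # l @ [v])) * (-1)] (mod 3)"
      by (intro cong_diff cong_mult cong_refl)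
    then have "[f (path_cycle l) = - g (path_cycle l)] (mod 3)"
      by (simp add: cong_iff_dvd_diff)
    then show ?case .
  next
    case (add c d)
    have "[f (c + d) = f c + f d] (mod 3)"
      by (intro functional_add[OF f(1)] Cyc add)
    also have "[f c + f d = - g c + - g d] (mod 3)"
      using add by (intro cong_add)
    also have "[- g c + - g d = - (g (c + d))] (mod 3)"
      using functional_add[OF g(1) Cyc(2)[OF add(1)] Cyc(2)[OF add(2)]]
      by (simp add: cong_iff_dvd_diff algebra_simps)
    finally show ?case .
  next
    case (minus c)
    have "[f (- c) = - f c] (mod 3)"
      by (intro functional_uminus[OF f(1)] Cyc minus)
    also have "[- f c = - (- g c)] (mod 3)"
      using minus(2) by (simp only: cong_minus_minus_iff)
    also have "[- (- g c) = - g (- c)] (mod 3)"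
      using functional_uminus[OF g(1) Cyc(2)[OF minus(1)]] by (simp add: cong_iff_dvd_diff algebra_simps)
    finally show ?case .
  qed
qed

text \<open>
  Let \<open>a\<close> times the path cycle of \<open>x i j \<dots>\<close> be the boundary of \<open>c\<close>, and let \<open>w u v\<close> be the contraction of \<open>c\<close> with \<open>{i, u}\<close>
  and \<open>{j, v}\<close>. For fixed \<open>u\<close> the sum over \<open>v\<close> of the values of the functional at \<open>u\<close> is \<open>- a\<close> for \<open>u = x\<close> and
  otherwise 0, all modulo 3, and for fixed \<open>v\<close> the sum over \<open>u\<close> of the values of the functional at \<open>v\<close> is 0. By
  \<open>links_cong\<close> the two double sums are negatives of each other.
\<close>

lemma path_cycle_multiple:
  assumes V: "finite V" "card V = 3 * k + 4"
    and IH: "\<And>u i j s. i \<in> V \<Longrightarrow> j \<in> V \<Longrightarrow> u \<in> V \<Longrightarrow> distinct [u, i, j] \<Longrightarrow> sign_function (V - {i, j, u}) s \<Longrightarrow>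
      \<exists>\<phi>. functional (MK (V - {i, j, u})) k 3 \<phi> \<and>
        (\<forall>l. distinct l \<and> set l = V - {i, j, u} \<longrightarrow> [\<phi> (path_cycle l) = s l] (mod 3))"
    and l0: "distinct l0" "set l0 = V" and a: "a \<odot> path_cycle l0 \<in> Bd (MK V) (Suc k)"
  shows "3 dvd a"
proof -
  have "length l0 = 3 * k + 4"
    using distinct_card[OF l0(1)] l0(2) V(2) by simp
  then obtain x i j l' where l': "l0 = x # i # j # l'"
    by (cases l0; cases "tl l0"; cases "tl (tl l0)") auto
  have ij: "i \<in> V" "j \<in> V" "i \<noteq> j" and x: "x \<in> V - {i, j}"
    using l0 by (auto simp: l')
  define U where "U = V - {i, j}"
  have U: "finite U"
    using V by (simp add: U_def)
  define s where "s = oriented_simplex l0"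
  have s: "sign_function V s"
    unfolding s_def by (rule sign_function_oriented_simplex)
  have s1: "s l0 = 1"
    unfolding s_def by (rule oriented_simplex_self[OF l0(1)])
  have "\<exists>\<phi>. functional (MK (V - {i, j, u})) k 3 \<phi> \<and>
      (\<forall>l. distinct l \<and> set l = V - {i, j, u} \<longrightarrow> [\<phi> (path_cycle l) = s (u # i # j # l)] (mod 3))" if u: "u \<in> U" for u
  proof (rule IH)
    show "sign_function (V - {i, j, u}) (\<lambda>l. s (u # i # j # l))"
      unfolding sign_function_def
    proof (intro allI impI; elim conjE)
      fix l y z assume l: "distinct l" "set l = V - {i, j, u}" and yz: "y \<in> V - {i, j, u}" "z \<in> V - {i, j, u}" "y \<noteq> z"
      have "map (transpose y z) (u # i # j # l) = u # i # j # map (transpose y z) l"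
        using yz by (auto simp: transpose_def)
      moreover have "distinct (u # i # j # l)" "set (u # i # j # l) = V"
        using l u ij by (auto simp: U_def)
      ultimately show "s (u # i # j # map (transpose y z) l) = - s (u # i # j # l)"
        using sign_functionD[OF s, of "u # i # j # l" y z] yz by simp
    qed
  qed (use u ij in \<open>auto simp: U_def\<close>)
  then obtain f where f: "\<And>u. u \<in> U \<Longrightarrow> functional (MK (V - {i, j, u})) k 3 (f u)"
    "\<And>u l. u \<in> U \<Longrightarrow> distinct l \<Longrightarrow> set l = V - {i, j, u} \<Longrightarrow> [f u (path_cycle l) = s (u # i # j # l)] (mod 3)"
    by metis
  obtain c where c: "c \<in> chains (MK V) (Suc (Suc k))" "a \<odot> path_cycle l0 = boundary c"
    using a by (auto simp: Bd_def)
  define w where "w u v = contract {j, v} (contract {i, u} c)" for u v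
  have zl': "path_cycle l' \<in> Cyc (MK (V - {x, i, j})) k"
  proof -
    have "length l' div 3 = k"
      using \<open>length l0 = 3 * k + 4\<close> l' by simp
    then show ?thesis
      using path_cycle_Cyc[of "V - {x, i, j}" l' pairs] l0 V(1) by (auto simp: l' path_edges_pairs)
  qed
  have out: "contract e (path_cycle l') = 0" if "i \<in> e \<or> j \<in> e" for e
    using zl' that by (intro contract_outside[of _ _ "V - {x, i, j}"]) (auto simp: Cyc_def)
  have li: "contract {i, u} (boundary c) = (if u = x then a \<odot> path_cycle l' else 0)" if "u \<in> U" for u
    using that ij x unfolding c(2)[symmetric] l'
    by (auto simp: join_path_def contract_smul contract.diff contract_cone out cone.zero doubleton_eq_iff U_def)
  have lj: "contract {j, u} (boundary c) = 0" if "u \<in> U" for u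
    using that ij x unfolding c(2)[symmetric] l'
    by (auto simp: join_path_def contract_smul contract.diff contract_cone out cone.zero doubleton_eq_iff U_def)
  have sw: "contract {i, u} (contract {j, v} c) = - w u v" for u v
    unfolding w_def by (rule alternating_contract_contract[OF chainsD(2)[OF c(1)]])
  have ljli: "contract {j, v} (contract {i, u} (boundary c)) = 0" if "u \<in> U" for u v
    using li[OF that] by (simp add: contract_smul out contract.zero)
  have w: "w u v \<in> Cyc (MK (V - {i, j, u, v})) k" if "u \<in> U" "v \<in> U - {u}" for u v
    unfolding w_def using that ij by (intro link_sum(1) V c ljli) (auto simp: U_def)
  have Ueq: "V - {i, j, u} = U - {u}" "V - {j, i, u} = U - {u}" for u
    by (auto simp: U_def)
  have B1: "(\<Sum>v\<in>U - {u}. w u v) + (if u = x then a \<odot> path_cycle l' else 0) \<in> Bd (MK (V - {i, j, u})) k"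
    if u: "u \<in> U" for u
    using link_sum(2)[OF V(1) ij c(1), of u] ljli[OF u] u li[OF u] unfolding w_def Ueq by (simp add: U_def)
  have B2: "- (\<Sum>u\<in>U - {v}. w u v) \<in> Bd (MK (V - {i, j, v})) k" if v: "v \<in> U" for v
  proof -
    have "V - {j, i, v} = V - {i, j, v}"
      by auto
    then show ?thesis
      using link_sum(2)[OF V(1) ij(2,1) ij(3)[symmetric] c(1), of v] v lj[OF v]
      by (simp add: U_def sw sum_negf contract.zero Ueq)
  qed
  have wC: "w u v \<in> Cyc (MK (V - {i, j, u})) k" "w u v \<in> Cyc (MK (V - {i, j, v})) k"
    if "u \<in> U" "v \<in> U - {u}" for u v
    by (rule Cyc_mono[OF w[OF that] matchings_on_mono]; auto)+
  have 1: "[(\<Sum>v\<in>U - {u}. f u (w u v)) = (if u = x then - a else 0)] (mod 3)" if u: "u \<in> U" for u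
  proof -
    have wS: "(\<Sum>v\<in>U - {u}. w u v) \<in> Cyc (MK (V - {i, j, u})) k"
      using wC u by (intro Cyc_sum)
    show ?thesis
    proof (cases "u = x")
      case True
      have xs: "V - {x, i, j} = V - {i, j, u}"
        using True by auto
      have zC: "path_cycle l' \<in> Cyc (MK (V - {i, j, u})) k"
        using zl' unfolding xs .
      have "[0 = f u ((\<Sum>v\<in>U - {u}. w u v) + a \<odot> path_cycle l')] (mod 3)"
        using functional_Bd[OF f(1)[OF u] B1[OF u]] True by (simp add: cong_sym)
      also have "[f u ((\<Sum>v\<in>U - {u}. w u v) + a \<odot> path_cycle l') = f u (\<Sum>v\<in>U - {u}. w u v) + f u (a \<odot> path_cycle l')] (mod 3)"
        by (rule functional_add[OF f(1)[OF u] wS Cyc_smul[OF zC]])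
      also have "[f u (\<Sum>v\<in>U - {u}. w u v) + f u (a \<odot> path_cycle l') = (\<Sum>v\<in>U - {u}. f u (w u v)) + a * f u (path_cycle l')] (mod 3)"
        using wC u by (intro cong_add functional_sum[OF f(1)[OF u]] functional_smul[OF f(1)[OF u] zC])
      also have "[(\<Sum>v\<in>U - {u}. f u (w u v)) + a * f u (path_cycle l') = (\<Sum>v\<in>U - {u}. f u (w u v)) + a * 1] (mod 3)"
      proof (intro cong_add cong_mult cong_refl)
        have "[f u (path_cycle l') = s (u # i # j # l')] (mod 3)"
          using l0 True by (intro f(2)[OF u]) (auto simp: l')
        then show "[f u (path_cycle l') = 1] (mod 3)"
          using s1 True l' by simp
      qed
      finally have "3 dvd (0 - ((\<Sum>v\<in>U - {u}. f u (w u v)) + a * 1))"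
        by (simp only: cong_iff_dvd_diff)
      then show ?thesis
        using True by (simp add: cong_iff_dvd_diff) (metis dvd_minus_iff minus_add_distrib diff_conv_add_uminus)
    next
      case False
      have "[(\<Sum>v\<in>U - {u}. f u (w u v)) = f u (\<Sum>v\<in>U - {u}. w u v)] (mod 3)"
        using wC u by (intro cong_sym[OF functional_sum[OF f(1)[OF u]]])
      also have "[f u (\<Sum>v\<in>U - {u}. w u v) = 0] (mod 3)"
        using functional_Bd[OF f(1)[OF u]] B1[OF u] False by simp
      finally show ?thesis
        using False by simp
    qed
  qed
  have 2: "[(\<Sum>u\<in>U - {v}. f v (w u v)) = 0] (mod 3)" if v: "v \<in> U" for v
  proof -
    have "[(\<Sum>u\<in>U - {v}. f v (w u v)) = f v (\<Sum>u\<in>U - {v}. w u v)] (mod 3)"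
      using wC v by (intro cong_sym[OF functional_sum[OF f(1)[OF v]]]) auto
    also have "[f v (\<Sum>u\<in>U - {v}. w u v) = 0] (mod 3)"
      using functional_Bd[OF f(1)[OF v] Bd_uminus[OF B2[OF v]]] by simp
    finally show ?thesis .
  qed
  have e1: "[(\<Sum>u\<in>U. \<Sum>v\<in>U - {u}. f u (w u v)) = (\<Sum>u\<in>U. if u = x then - a else 0)] (mod 3)"
    by (intro cong_sum 1)
  have e1': "(\<Sum>u\<in>U. if u = x then - a else 0) = - a"
    using U x by (simp add: sum.delta U_def)
  have e2: "[(\<Sum>u\<in>U. \<Sum>v\<in>U - {u}. f u (w u v)) = (\<Sum>u\<in>U. \<Sum>v\<in>U - {u}. - f v (w u v))] (mod 3)"
  proof (intro cong_sum)
    fix u v assume uv: "u \<in> U" "v \<in> U - {u}"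
    show "[f u (w u v) = - f v (w u v)] (mod 3)"
      by (rule links_cong[OF V ij _ _ _ s f(1) _ f(1) _ w[OF uv]]) (use uv f(2) in \<open>auto simp: U_def\<close>)
  qed
  have e2': "(\<Sum>u\<in>U. \<Sum>v\<in>U - {u}. - f v (w u v)) = (\<Sum>v\<in>U. \<Sum>u\<in>U - {v}. - f v (w u v))"
  proof -
    have "(\<Sum>u\<in>U. \<Sum>v\<in>U - {u}. - f v (w u v)) = (\<Sum>u\<in>U. \<Sum>v\<in>U. if u = v then 0 else - f v (w u v))"
      using U by (intro sum.cong[OF refl] sum.mono_neutral_cong_left) auto
    also have "\<dots> = (\<Sum>v\<in>U. \<Sum>u\<in>U. if u = v then 0 else - f v (w u v))"
      by (rule sum.swap)
    also have "\<dots> = (\<Sum>v\<in>U. \<Sum>u\<in>U - {v}. - f v (w u v))"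
      using U by (intro sum.cong[OF refl] sum.mono_neutral_cong_right) auto
    finally show ?thesis .
  qed
  have e3: "[(\<Sum>v\<in>U. \<Sum>u\<in>U - {v}. - f v (w u v)) = (\<Sum>v\<in>U. - 0)] (mod 3)"
  proof (rule cong_sum)
    show "[(\<Sum>u\<in>U - {v}. - f v (w u v)) = - 0] (mod 3)" if "v \<in> U" for v
      unfolding sum_negf using 2[OF that] by (simp only: cong_minus_minus_iff)
  qed
  have "[- a = (\<Sum>v\<in>U. - 0)] (mod 3)"
    by (rule cong_trans[OF cong_sym[OF e1[unfolded e1']] cong_trans[OF e2[unfolded e2'] e3]])
  then have "[- a = 0] (mod 3)"
    by simp
  then show "3 dvd a"
    by (simp add: cong_0_iff)
qed

lemma path_cycle_enumerations:
  assumes V: "finite V" "card V = 3 * k + 1" "2 \<le> k" and s: "sign_function V s"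
    and l0: "distinct l0" "set l0 = V" and l: "distinct l" "set l = V"
  shows "\<exists>\<epsilon>. path_cycle l - \<epsilon> \<odot> path_cycle l0 \<in> Bd (MK V) k \<and> s l = \<epsilon> * s l0"
  using l l0
proof (induction rule: enumeration_induct)
  case base
  have "path_cycle l0 - 1 \<odot> path_cycle l0 \<in> Bd (MK V) k \<and> s l0 = 1 * s l0"
    by (simp add: Bd_zero)
  then show ?case
    by (rule exI[where x=1])
next
  case (transpose l x y)
  then obtain \<epsilon> where e: "path_cycle l - \<epsilon> \<odot> path_cycle l0 \<in> Bd (MK V) k" "s l = \<epsilon> * s l0"
    by blast
  have "length l = 3 * k + 1"
    using distinct_card transpose(1,2) V(2) by metis
  then have "homologous pairs (set l) k (path_cycle (map (Transposition.transpose x y) l)) (- path_cycle l)"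
    using transpose V by (intro path_cycle_transpose) auto
  then have "path_cycle (map (Transposition.transpose x y) l) + path_cycle l \<in> Bd (MK V) k"
    using transpose(2) by (simp add: homologous_def)
  from Bd_diff[OF this e(1)] have "path_cycle (map (Transposition.transpose x y) l) - (- \<epsilon>) \<odot> path_cycle l0 \<in> Bd (MK V) k"
    by (simp add: algebra_simps)
  moreover have "s (map (Transposition.transpose x y) l) = (- \<epsilon>) * s l0"
    using sign_functionD[OF s transpose(1-5)] e(2) by simp
  ultimately show ?case
    by blast
qed

theorem matching_homology_cyclic:
  assumes V: "finite V" "card V = 3 * k + 1" "2 \<le> k" and l0: "distinct l0" "set l0 = V"
    and c: "c \<in> Cyc (MK V) k"
  shows "\<exists>a. c - a \<odot> path_cycle l0 \<in> Bd (MK V) k"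
proof -
  have "c \<in> path_span V k"
    using path_cycles_generate[of V k] V c by auto
  then show ?thesis
  proof (induction rule: path_span.induct)
    case (Bd b)
    then have "b - 0 \<odot> path_cycle l0 \<in> Bd (MK V) k"
      by simp
    then show ?case
      by (rule exI[where x=0])
  next
    case (path_cycle l)
    then show ?case
      using path_cycle_enumerations[OF V sign_function_oriented_simplex l0] by blast
  next
    case (add c d)
    from add(3) obtain a where a: "c - a \<odot> path_cycle l0 \<in> Bd (MK V) k" ..
    from add(4) obtain b where b: "d - b \<odot> path_cycle l0 \<in> Bd (MK V) k" ..
    from Bd_add[OF a b] have "(c + d) - (a + b) \<odot> path_cycle l0 \<in> Bd (MK V) k"
      by (simp add: smul_distribs algebra_simps)
    then show ?case
      by (rule exI[where x="a + b"])
  next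
    case (minus c)
    from minus(2) obtain a where a: "c - a \<odot> path_cycle l0 \<in> Bd (MK V) k" ..
    from Bd_uminus[OF a] have "(- c) - (- a) \<odot> path_cycle l0 \<in> Bd (MK V) k"
      by (simp add: algebra_simps)
    then show ?case
      by (rule exI[where x="- a"])
  qed
qed

text \<open>
  For \<open>k \<ge> 2\<close> every cycle is homologous to a multiple of one path cycle, and the multiplicity is unique modulo 3 by
  \<open>path_cycle_multiple\<close>. The case of four points starts the induction separately, because the homology is not
  cyclic there.
\<close>

theorem functional_exists:
  assumes "finite V" "card V = 3 * k + 1" "1 \<le> k" "sign_function V s"
  shows "\<exists>\<phi>. functional (MK V) k 3 \<phi> \<and> (\<forall>l. distinct l \<and> set l = V \<longrightarrow> [\<phi> (path_cycle l) = s l] (mod 3))"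
  using assms(3,1,2,4)
proof (induction k arbitrary: V s rule: nat_induct_at_least)
  case base
  then have "card V = 4"
    by simp
  from card4E[OF this] obtain d e f g where "distinct [d, e, f, g]" "V = {d, e, f, g}" .
  with base show ?case
    by (intro functional_four_points) auto
next
  case (Suc k)
  obtain l0 where l0: "distinct l0" "set l0 = V"
    using finite_distinct_list[OF Suc.prems(1)] by blast
  have len: "length l0 = 3 * Suc k + 1"
    using distinct_card[OF l0(1)] l0(2) Suc.prems(2) by simp
  have mult: "3 dvd a" if "a \<odot> path_cycle l0 \<in> Bd (MK V) (Suc k)" for a
  proof (rule path_cycle_multiple[OF Suc.prems(1) _ _ l0 that])
    show "card V = 3 * k + 4"
      using Suc.prems by simp
    show "\<exists>\<phi>. functional (MK (V - {i, j, u})) k 3 \<phi> \<and>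
        (\<forall>l. distinct l \<and> set l = V - {i, j, u} \<longrightarrow> [\<phi> (path_cycle l) = s l] (mod 3))"
      if "i \<in> V" "j \<in> V" "u \<in> V" "distinct [u, i, j]" "sign_function (V - {i, j, u}) s" for u i j s
      using that Suc.prems by (intro Suc.IH) (auto simp: card_Diff_subset)
  qed
  have k: "2 \<le> Suc k"
    using Suc.hyps by simp
  note zl = path_cycle_enumerations[OF Suc.prems(1,2) k Suc.prems(3) l0]
  note cyc = matching_homology_cyclic[OF Suc.prems(1,2) k l0]
  define A where "A c = (SOME a. c - a \<odot> path_cycle l0 \<in> Bd (MK V) (Suc k))" for c
  have A: "c - A c \<odot> path_cycle l0 \<in> Bd (MK V) (Suc k)" if "c \<in> Cyc (MK V) (Suc k)" for c
    unfolding A_def using cyc[OF that] by (rule someI_ex)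
  have A_eq: "[A c = a] (mod 3)" if "c \<in> Cyc (MK V) (Suc k)" "c - a \<odot> path_cycle l0 \<in> Bd (MK V) (Suc k)" for c a
  proof -
    have "(A c - a) \<odot> path_cycle l0 \<in> Bd (MK V) (Suc k)"
      using Bd_diff[OF that(2) A[OF that(1)]] by (simp add: smul_distribs)
    then show ?thesis
      using mult by (simp add: cong_iff_dvd_diff)
  qed
  have sub: "b \<in> Bd (MK V) (Suc k) \<Longrightarrow> b \<in> Cyc (MK V) (Suc k)" for b
    using finite_complex_matchings_on[OF Suc.prems(1), of pairs] by (intro Bd_in_Cyc) (auto simp: finite_complex_def)
  have "functional (MK V) (Suc k) 3 (\<lambda>c. A c * s l0)"
    unfolding functional_def
  proof (intro conjI ballI)
    fix c d assume cd: "c \<in> Cyc (MK V) (Suc k)" "d \<in> Cyc (MK V) (Suc k)"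
    have "(c + d) - (A c + A d) \<odot> path_cycle l0 \<in> Bd (MK V) (Suc k)"
      using Bd_add[OF A[OF cd(1)] A[OF cd(2)]] by (simp add: smul_distribs algebra_simps)
    then have "[A (c + d) = A c + A d] (mod 3)"
      by (intro A_eq Cyc_add cd)
    then have "[A (c + d) * s l0 = (A c + A d) * s l0] (mod 3)"
      by (intro cong_mult cong_refl)
    then show "[A (c + d) * s l0 = A c * s l0 + A d * s l0] (mod 3)"
      by (simp add: distrib_right)
  next
    fix b assume b: "b \<in> Bd (MK V) (Suc k)"
    then have "[A b = 0] (mod 3)"
      by (intro A_eq sub) simp_all
    then have "[A b * s l0 = 0 * s l0] (mod 3)"
      by (intro cong_mult cong_refl)
    then show "[A b * s l0 = 0] (mod 3)"
      by simp
  qed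
  moreover have "[A (path_cycle l) * s l0 = s l] (mod 3)" if l: "distinct l" "set l = V" for l
  proof -
    obtain \<epsilon> where e: "path_cycle l - \<epsilon> \<odot> path_cycle l0 \<in> Bd (MK V) (Suc k)" "s l = \<epsilon> * s l0"
      using zl[OF l] by blast
    have "length l = 3 * Suc k + 1"
      using distinct_card[OF l(1)] l(2) Suc.prems(2) by simp
    then have "path_cycle l \<in> Cyc (MK V) (Suc k)"
      using path_cycle_Cyc[of V l pairs] Suc.prems(1) l by (simp add: path_edges_pairs)
    from A_eq[OF this e(1)] show ?thesis
      unfolding e(2) by (intro cong_mult cong_refl)
  qed
  ultimately show ?case
    by blast
qed

section \<open>Stars and the chessboard moves\<close>

definition bipartite :: "('a + 'b) set set"
  where "bipartite = {{Inl a, Inr b} | a b. True}"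

lemma bipartite_iff [simp]:
  "{Inl a, Inr b} \<in> bipartite" "{Inr b, Inl a} \<in> bipartite" "{Inl a, Inl c} \<notin> bipartite" "{Inr b, Inr d} \<notin> bipartite"
  by (auto simp: bipartite_def doubleton_eq_iff)

lemma bipartite_pairs: "bipartite \<subseteq> pairs"
  by (auto simp: bipartite_def card_insert_if)

lemma matchings_on_mono_edges: "E \<subseteq> E' \<Longrightarrow> matchings_on E V \<subseteq> matchings_on E' V"
  unfolding matchings_on_iff subset_iff by blast

lemma functional_mono:
  assumes "functional K' s p f" "K \<subseteq> K'"
  shows "functional K s p f"
  using assms unfolding functional_def by (blast intro: Cyc_mono Bd_mono)

text \<open>
  Of all path cycles with \<open>i\<close> at the end of the first path, only the one that uses the edge \<open>{i, b}\<close> has a nonzero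
  contraction with it, namely the path cycle of the remaining points, with the third point \<open>a\<close> as its hole.
\<close>

lemma star_dual_system:
  fixes L :: "'a \<Rightarrow> 'a list"
  assumes V: "finite V" "card V = 3 * k + 3" "1 \<le> k" and E: "E \<subseteq> pairs"
    and L: "\<And>b. b \<in> N \<Longrightarrow> \<exists>a r. L b = i # b # a # r"
      "\<And>b. b \<in> N \<Longrightarrow> distinct (L b) \<and> set (L b) = V \<and> path_edges E (L b)"
  shows "\<exists>f. dual_system (matchings_on E V) (Suc k) 3 N (\<lambda>b. path_cycle (L b)) f"
proof -
  obtain a r where ar: "\<And>b. b \<in> N \<Longrightarrow> L b = i # b # a b # r b"
    using L(1) by metis
  have *: "distinct (i # b # a b # r b)" "set (i # b # a b # r b) = V" "path_edges E (r b)" "length (r b) = 3 * k" if "b \<in> N" for b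
  proof -
    show 1: "distinct (i # b # a b # r b)" "set (i # b # a b # r b) = V" "path_edges E (r b)"
      using L(2)[OF that] ar[OF that] by auto
    show "length (r b) = 3 * k"
      using distinct_card[OF 1(1)] V(2) unfolding 1(2) by simp
  qed
  have "\<exists>\<phi>. functional (matchings_on E (V - {i, b})) k 3 \<phi> \<and> [\<phi> (path_cycle (r b)) = 1] (mod 3)" if b: "b \<in> N" for b
  proof -
    let ?l = "r b @ [a b]"
    have l: "distinct ?l" "set ?l = V - {i, b}"
      using *[OF b] by auto
    have "card (V - {i, b}) = 3 * k + 1"
      using *[OF b] V by (subst card_Diff_subset) auto
    then obtain \<phi> where \<phi>: "functional (MK (V - {i, b})) k 3 \<phi>"
      "\<And>l. distinct l \<Longrightarrow> set l = V - {i, b} \<Longrightarrow> [\<phi> (path_cycle l) = oriented_simplex ?l l] (mod 3)"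
      using functional_exists[OF _ _ V(3) sign_function_oriented_simplex, of "V - {i, b}" ?l] V(1) by auto
    have "[\<phi> (path_cycle ?l) = 1] (mod 3)"
      using \<phi>(2)[OF l] oriented_simplex_self[OF l(1)] by simp
    moreover have "path_cycle ?l = path_cycle (r b)"
      using *[OF b] by (intro path_cycle_snoc) simp
    ultimately show ?thesis
      using functional_mono[OF \<phi>(1) matchings_on_mono_edges[OF E]] by auto
  qed
  then obtain f where f: "\<And>b. b \<in> N \<Longrightarrow> functional (matchings_on E (V - {i, b})) k 3 (f b)"
    "\<And>b. b \<in> N \<Longrightarrow> [f b (path_cycle (r b)) = 1] (mod 3)"
    by metis
  have zr: "path_cycle (r b) \<in> Cyc (matchings_on E (V - {i, b, a b})) k" if b: "b \<in> N" for b
    using path_cycle_Cyc[of "V - {i, b, a b}" "r b" E] V(1) *[OF b] by auto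
  have "dual_system (matchings_on E V) (Suc k) 3 N (\<lambda>b. path_cycle (L b)) (\<lambda>b c. f b (contract {i, b} c))"
    unfolding dual_system_def
  proof (intro conjI ballI)
    show "path_cycle (L b) \<in> Cyc (matchings_on E V) (Suc k)" if "b \<in> N" for b
    proof -
      have "length (L b) div 3 = Suc k"
        using *(4)[OF that] ar[OF that] by simp
      then show ?thesis
        using path_cycle_Cyc[of V "L b" E] V(1) L(2)[OF that] by auto
    qed
    show "functional (matchings_on E V) (Suc k) 3 (\<lambda>c. f b (contract {i, b} c))" if "b \<in> N" for b
      by (intro functional_contract V f that)
    show "[f b (contract {i, b} (path_cycle (L c))) = of_bool (b = c)] (mod 3)" if bc: "b \<in> N" "c \<in> N" for b c
    proof -
      have "contract {i, b} (path_cycle (r c)) = 0"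
        using zr[OF bc(2)] by (intro contract_outside[of _ E "V - {i, c, a c}"]) (auto simp: Cyc_def)
      then have "contract {i, b} (path_cycle (L c)) = (if b = c then path_cycle (r c) else 0)"
        using *(1)[OF bc(1)] *(1)[OF bc(2)]
        by (auto simp: ar[OF bc(2)] join_path_def contract.diff contract_cone cone.zero doubleton_eq_iff)
      then show ?thesis
        using f(2)[OF bc(1)] functional_Bd[OF f(1)[OF bc(1)] Bd_zero] by auto
    qed
  qed
  then show ?thesis
    by blast
qed

fun flatten :: "('a \<times> 'a \<times> 'a) list \<Rightarrow> 'a list"
  where "flatten [] = []"
  | "flatten ((a, b, c) # ts) = a # b # c # flatten ts"

lemma flatten_append: "flatten (ts @ us) = flatten ts @ flatten us"
  by (induction ts rule: flatten.induct) auto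

lemma length_flatten: "length (flatten ts) = 3 * length ts"
  by (induction ts rule: flatten.induct) auto

lemma join_paths_flatten_Cons: "join_paths (flatten ((a, b, c) # ts)) x = join_path a b c (join_paths (flatten ts) x)"
  by simp

lemma join_paths_flatten_append: "join_paths (flatten (ts @ us)) x = join_paths (flatten ts) (join_paths (flatten us) x)"
  by (simp add: flatten_append join_paths_append length_flatten)

lemma join_paths_flatten_perm:
  assumes "mset ts = mset us"
  shows "\<exists>\<epsilon>\<in>{1, -1}. join_paths (flatten ts) x = \<epsilon> \<odot> join_paths (flatten us) x"
  using assms
proof (induction ts arbitrary: us)
  case Nil
  then have "join_paths (flatten []) x = 1 \<odot> join_paths (flatten us) x"
    by simp
  then show ?case
    by blast
next
  case (Cons T ts)
  obtain a b c where T: "T = (a, b, c)"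
    by (cases T) auto
  have "T \<in> set us"
    using Cons.prems by (metis list.set_intros(1) mset_eq_setD)
  then obtain u v where us: "us = u @ T # v"
    using split_list by metis
  have "mset ts = mset (u @ v)"
    using Cons.prems us by simp
  from Cons.IH[OF this] obtain \<epsilon> where e: "\<epsilon> \<in> {1, -1}" "join_paths (flatten ts) x = \<epsilon> \<odot> join_paths (flatten (u @ v)) x" ..
  define \<delta> :: int where "\<delta> = (-1) ^ (length (flatten u) div 3)"
  have d: "\<delta> \<in> {1, -1}" "\<delta> * \<delta> = 1"
    by (auto simp: \<delta>_def minus_one_power_iff)
  have "join_paths (flatten us) x = \<delta> \<odot> join_path a b c (join_paths (flatten (u @ v)) x)"
    unfolding us T join_paths_flatten_append join_paths_flatten_Cons join_paths_join_path \<delta>_def ..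
  then have "join_paths (flatten (T # ts)) x = (\<epsilon> * \<delta>) \<odot> join_paths (flatten us) x"
    unfolding T join_paths_flatten_Cons e(2) join_path_smul using d(2) by (simp add: mult.assoc)
  moreover have "\<epsilon> * \<delta> \<in> {1, -1}"
    using e(1) d(1) by auto
  ultimately show ?case
    by (rule bexI)
qed

text \<open>
  In a cyclic image only multiples of a class matter, so signs need not be followed from here on.
\<close>

definition homologous_pm :: "'a set set \<Rightarrow> 'a set \<Rightarrow> nat \<Rightarrow> ('a set list \<Rightarrow> int) \<Rightarrow> ('a set list \<Rightarrow> int) \<Rightarrow> bool"
  where "homologous_pm E V s x y \<longleftrightarrow> homologous E V s x y \<or> homologous E V s x (- y)"

lemma homologous_pm_refl: "homologous_pm E V s x x"
  by (simp add: homologous_pm_def homologous_refl)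

lemma homologous_pm_trans [trans]: "homologous_pm E V s x y \<Longrightarrow> homologous_pm E V s y z \<Longrightarrow> homologous_pm E V s x z"
  unfolding homologous_pm_def using homologous_trans[of E V s x] homologous_minus[of E V s y] by fastforce

lemma homologous_pm_sym: "homologous_pm E V s x y \<Longrightarrow> homologous_pm E V s y x"
  unfolding homologous_pm_def using homologous_sym[of E V s x] homologous_minus_swap[of E V s x y] homologous_sym[of E V s "- x" y] by auto

lemma homologous_pm_sign: "\<epsilon> \<in> {1, -1} \<Longrightarrow> x = \<epsilon> \<odot> y \<Longrightarrow> homologous_pm E V s x y"
  by (auto simp: homologous_pm_def homologous_refl)

lemma homologous_pm_multiple: "homologous_pm E V s x y \<Longrightarrow> \<exists>m. x - m \<odot> y \<in> Bd (matchings_on E V) s"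
proof -
  assume "homologous_pm E V s x y"
  then have "x - 1 \<odot> y \<in> Bd (matchings_on E V) s \<or> x - (- 1) \<odot> y \<in> Bd (matchings_on E V) s"
    by (simp add: homologous_pm_def homologous_def)
  then show ?thesis
    by (elim disjE) (rule exI, assumption)+
qed

lemma homologous_pm_join_paths:
  assumes "homologous_pm E V s x y" "finite V" "distinct l" "set l \<inter> V = {}" "path_edges E l" "set l \<union> V \<subseteq> W" "finite W"
    "3 dvd length l"
  shows "homologous_pm E W (length l div 3 + s) (join_paths l x) (join_paths l y)"
  using assms(1) join_paths_homologous[OF _ assms(2-8), of s x y] join_paths_homologous[OF _ assms(2-8), of s x "- y"]
  by (auto simp: homologous_pm_def join_paths_minus)

lemma homologous_pm_perm: "mset ts = mset us \<Longrightarrow> homologous_pm E V s (join_paths (flatten ts) x) (join_paths (flatten us) x)"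
  using join_paths_flatten_perm[of ts us x] homologous_pm_sign by blast

text \<open>
  In the relations on four points only the edges of the path and the edge to the hole occur, so they
  hold in bipartite graphs as well.
\<close>

lemma homologous_pm_rotate:
  assumes "{x, y} \<in> E" "{z, w} \<in> E" "distinct [x, y, z, w]"
  shows "homologous_pm E {x, y, z, w} 1 (join_path x y z unit_chain) (join_path y z w unit_chain)"
proof -
  have "cone {x, y} unit_chain - cone {z, w} unit_chain \<in> Bd (matchings_on E {x, y, z, w}) (Suc 0)"
    using assms by (intro disjoint_edges_homologous) auto
  moreover have "join_path x y z unit_chain - (- join_path y z w unit_chain) = cone {x, y} unit_chain - cone {z, w} unit_chain"
    by (simp add: join_path_def)
  ultimately show ?thesis
    unfolding homologous_pm_def homologous_def by (metis One_nat_def)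
qed

lemma homologous_pm_middle:
  assumes "{a, b} \<in> E" "{b, c} \<in> E" "{a, h} \<in> E" "{h, c} \<in> E" "distinct [a, b, c, h]"
  shows "homologous_pm E {a, b, c, h} 1 (join_path a h c unit_chain) (join_path a b c unit_chain)"
proof -
  have 1: "homologous_pm E {h, a, b, c} 1 (join_path h a b unit_chain) (join_path a b c unit_chain)"
    using assms by (intro homologous_pm_rotate) (auto simp: insert_commute)
  have 2: "homologous_pm E {b, a, h, c} 1 (join_path b a h unit_chain) (join_path a h c unit_chain)"
    using assms by (intro homologous_pm_rotate) (auto simp: insert_commute)
  have 3: "homologous_pm E {a, b, c, h} 1 (join_path b a h unit_chain) (join_path h a b unit_chain)"
    by (rule homologous_pm_sign[of "-1"]) (auto simp: join_path_rev[of b a h])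
  have s: "{h, a, b, c} = {a, b, c, h}" "{b, a, h, c} = {a, b, c, h}"
    by auto
  from homologous_pm_trans[OF homologous_pm_sym[OF 2[unfolded s]] homologous_pm_trans[OF 3 1[unfolded s]]] show ?thesis .
qed

lemma homologous_pm_block_end:
  assumes "homologous_pm E U 1 (join_path a b c unit_chain) (join_path d e f unit_chain)" "finite U" "finite V" "U \<subseteq> V"
    "set (flatten ts) \<subseteq> V - U" "distinct (flatten ts)" "path_edges E (flatten ts)"
  shows "homologous_pm E V (Suc (length ts)) (join_paths (flatten (ts @ [(a, b, c)])) unit_chain) (join_paths (flatten (ts @ [(d, e, f)])) unit_chain)"
proof -
  have "homologous_pm E V (length (flatten ts) div 3 + 1) (join_paths (flatten ts) (join_path a b c unit_chain)) (join_paths (flatten ts) (join_path d e f unit_chain))"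
    using assms by (intro homologous_pm_join_paths[OF assms(1)]) (auto simp: length_flatten)
  then show ?thesis
    by (simp add: join_paths_flatten_append length_flatten)
qed

text \<open>
  Five left and five right points carry two paths with middle on the right, one path with middle on the left, and
  a hole on the right. The second path serves to break up the double exchange \<open>swap_right_13_45\<close>.
  In \<open>config\<close> the left and the right points are listed separately; the hole is the last right point.
\<close>

locale chess_moves =
  fixes SA SB :: "('a + 'b) set"
  assumes SA: "SA \<subseteq> range Inl" and SB: "SB \<subseteq> range Inr" and fin: "finite SA" "finite SB"
begin

definition placed where
  "placed as bs \<longleftrightarrow> distinct as \<and> set as = SA \<and> distinct bs \<and> set bs = SB"

fun config where
  "config [a1, a2, a3, a4, a5] [b1, b2, b3, b4, b5 :: 'a + 'b] =
    join_paths (flatten [(a1, b1, a2), (a3, b2, a4), (b3, a5, b4)]) unit_chain"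
| "config _ _ = unit_chain"

abbreviation sim (infix "\<sim>" 50)
  where "x \<sim> y \<equiv> homologous_pm bipartite (SA \<union> SB) 3 x y"

lemma edge: "a \<in> SA \<Longrightarrow> b \<in> SB \<Longrightarrow> {a, b} \<in> bipartite" "a \<in> SA \<Longrightarrow> b \<in> SB \<Longrightarrow> {b, a} \<in> bipartite"
  using SA SB by fastforce+

lemma dist: "a \<in> SA \<Longrightarrow> b \<in> SB \<Longrightarrow> a \<noteq> b" "a \<in> SA \<Longrightarrow> b \<in> SB \<Longrightarrow> b \<noteq> a"
  using SA SB by fastforce+

lemma mem5: "set [x1, x2, x3, x4, x5] = S \<Longrightarrow> x1 \<in> S \<and> x2 \<in> S \<and> x3 \<in> S \<and> x4 \<in> S \<and> x5 \<in> S"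
  by auto

lemma reverse_first:
  "config [a2, a1, a3, a4, a5] [b1, b2, b3, b4, b5] \<sim> config [a1, a2, a3, a4, a5] [b1, b2, b3, b4, b5]"
  by (rule homologous_pm_sign[of "-1"]) (auto simp: join_path_rev[of a2 b1 a1])

lemma swap_first_second:
  "config [a3, a4, a1, a2, a5] [b2, b1, b3, b4, b5] \<sim> config [a1, a2, a3, a4, a5] [b1, b2, b3, b4, b5]"
  unfolding config.simps by (rule homologous_pm_perm) simp

lemma swap_hole_first:
  assumes ok: "placed [a1, a2, a3, a4, a5] [b1, b2, b3, b4, b5]"
  shows "config [a1, a2, a3, a4, a5] [b5, b2, b3, b4, b1] \<sim> config [a1, a2, a3, a4, a5] [b1, b2, b3, b4, b5]"
proof -
  have mem: "a1 \<in> SA \<and> a2 \<in> SA \<and> a3 \<in> SA \<and> a4 \<in> SA \<and> a5 \<in> SA" "b1 \<in> SB \<and> b2 \<in> SB \<and> b3 \<in> SB \<and> b4 \<in> SB \<and> b5 \<in> SB"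
    using ok by (intro mem5; simp add: placed_def)+
  have "config [a1, a2, a3, a4, a5] [b5, b2, b3, b4, b1] \<sim> join_paths (flatten ([(a3, b2, a4), (b3, a5, b4)] @ [(a1, b5, a2)])) unit_chain"
    unfolding config.simps by (rule homologous_pm_perm) simp
  also have "join_paths (flatten ([(a3, b2, a4), (b3, a5, b4)] @ [(a1, b5, a2)])) unit_chain \<sim>
      join_paths (flatten ([(a3, b2, a4), (b3, a5, b4)] @ [(a1, b1, a2)])) unit_chain"
  proof -
    have "homologous_pm bipartite (SA \<union> SB) (Suc (length [(a3, b2, a4), (b3, a5, b4)]))
       (join_paths (flatten ([(a3, b2, a4), (b3, a5, b4)] @ [(a1, b5, a2)])) unit_chain)
       (join_paths (flatten ([(a3, b2, a4), (b3, a5, b4)] @ [(a1, b1, a2)])) unit_chain)"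
      by (rule homologous_pm_block_end[OF homologous_pm_middle[of a1 b1 _ a2 b5]])
        (use ok fin mem in \<open>auto simp: placed_def edge dist\<close>)
    then show ?thesis
      by (simp only: list.size numeral_3_eq_3 One_nat_def add_0_right plus_nat.simps add_Suc_right)
  qed
  also have "join_paths (flatten ([(a3, b2, a4), (b3, a5, b4)] @ [(a1, b1, a2)])) unit_chain \<sim> config [a1, a2, a3, a4, a5] [b1, b2, b3, b4, b5]"
    unfolding config.simps by (rule homologous_pm_perm) simp
  finally show ?thesis .
qed

text \<open>
  The first path and the hole form a square, which can release a left point as the new hole; the third path
  absorbs it and releases a right point.
\<close>

lemma rotate_first_third:
  assumes ok: "placed [a1, a2, a3, a4, a5] [b1, b2, b3, b4, b5]"
  shows "config [a1, a5, a3, a4, a2] [b3, b2, b1, b5, b4] \<sim> config [a1, a2, a3, a4, a5] [b1, b2, b3, b4, b5]"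
proof -
  have mem: "a1 \<in> SA \<and> a2 \<in> SA \<and> a3 \<in> SA \<and> a4 \<in> SA \<and> a5 \<in> SA" "b1 \<in> SB \<and> b2 \<in> SB \<and> b3 \<in> SB \<and> b4 \<in> SB \<and> b5 \<in> SB"
    using ok by (intro mem5; simp add: placed_def)+
  have "config [a1, a5, a3, a4, a2] [b3, b2, b1, b5, b4] \<sim> join_paths (flatten ([(a3, b2, a4), (b1, a2, b5)] @ [(a1, b3, a5)])) unit_chain"
    unfolding config.simps by (rule homologous_pm_perm) simp
  also have "join_paths (flatten ([(a3, b2, a4), (b1, a2, b5)] @ [(a1, b3, a5)])) unit_chain \<sim>
      join_paths (flatten ([(a3, b2, a4), (b1, a2, b5)] @ [(b3, a5, b4)])) unit_chain"
  proof -
    have "homologous_pm bipartite (SA \<union> SB) (Suc (length [(a3, b2, a4), (b1, a2, b5)]))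
       (join_paths (flatten ([(a3, b2, a4), (b1, a2, b5)] @ [(a1, b3, a5)])) unit_chain)
       (join_paths (flatten ([(a3, b2, a4), (b1, a2, b5)] @ [(b3, a5, b4)])) unit_chain)"
      by (rule homologous_pm_block_end[OF homologous_pm_rotate[of a1 b3 _ a5 b4]])
        (use ok fin mem in \<open>auto simp: placed_def edge dist\<close>)
    then show ?thesis
      by (simp only: list.size numeral_3_eq_3 One_nat_def add_0_right plus_nat.simps add_Suc_right)
  qed
  also have "join_paths (flatten ([(a3, b2, a4), (b1, a2, b5)] @ [(b3, a5, b4)])) unit_chain \<sim>
      join_paths (flatten ([(a3, b2, a4), (b3, a5, b4)] @ [(b1, a2, b5)])) unit_chain"
    by (rule homologous_pm_perm) simp
  also have "join_paths (flatten ([(a3, b2, a4), (b3, a5, b4)] @ [(b1, a2, b5)])) unit_chain \<sim>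
      join_paths (flatten ([(a3, b2, a4), (b3, a5, b4)] @ [(a1, b1, a2)])) unit_chain"
  proof -
    have "homologous_pm bipartite (SA \<union> SB) (Suc (length [(a3, b2, a4), (b3, a5, b4)]))
       (join_paths (flatten ([(a3, b2, a4), (b3, a5, b4)] @ [(b1, a2, b5)])) unit_chain)
       (join_paths (flatten ([(a3, b2, a4), (b3, a5, b4)] @ [(a1, b1, a2)])) unit_chain)"
      by (rule homologous_pm_block_end[OF homologous_pm_sym[OF homologous_pm_rotate[of a1 b1 _ a2 b5]]])
        (use ok fin mem in \<open>auto simp: placed_def edge dist\<close>)
    then show ?thesis
      by (simp only: list.size numeral_3_eq_3 One_nat_def add_0_right plus_nat.simps add_Suc_right)
  qed
  also have "join_paths (flatten ([(a3, b2, a4), (b3, a5, b4)] @ [(a1, b1, a2)])) unit_chain \<sim> config [a1, a2, a3, a4, a5] [b1, b2, b3, b4, b5]"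
    unfolding config.simps by (rule homologous_pm_perm) simp
  finally show ?thesis .
qed

text \<open>
  Conjugating a reversal by the rotation leaves the right points in place.
\<close>

lemma swap_left_1_5:
  assumes ok: "placed [a1, a2, a3, a4, a5] [b1, b2, b3, b4, b5]"
  shows "config [a5, a2, a3, a4, a1] [b1, b2, b3, b4, b5] \<sim> config [a1, a2, a3, a4, a5] [b1, b2, b3, b4, b5]"
proof -
  have "config [a5, a2, a3, a4, a1] [b1, b2, b3, b4, b5] \<sim> config [a5, a1, a3, a4, a2] [b3, b2, b1, b5, b4]"
    by (rule rotate_first_third) (use ok in \<open>auto simp: placed_def\<close>)
  also have "\<dots> \<sim> config [a1, a5, a3, a4, a2] [b3, b2, b1, b5, b4]"
    by (rule reverse_first)
  also have "\<dots> \<sim> config [a1, a2, a3, a4, a5] [b1, b2, b3, b4, b5]"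
    by (rule rotate_first_third[OF ok])
  finally show ?thesis .
qed

text \<open>
  The rotation without its effect on the left points.
\<close>

lemma swap_right_13_45:
  assumes ok: "placed [a1, a2, a3, a4, a5] [b1, b2, b3, b4, b5]"
  shows "config [a1, a2, a3, a4, a5] [b3, b2, b1, b5, b4] \<sim> config [a1, a2, a3, a4, a5] [b1, b2, b3, b4, b5]"
proof -
  have "config [a1, a2, a3, a4, a5] [b3, b2, b1, b5, b4] \<sim> config [a2, a1, a3, a4, a5] [b3, b2, b1, b5, b4]"
    by (rule reverse_first)
  also have "\<dots> \<sim> config [a5, a1, a3, a4, a2] [b3, b2, b1, b5, b4]"
    by (rule swap_left_1_5) (use ok in \<open>auto simp: placed_def\<close>)
  also have "\<dots> \<sim> config [a1, a5, a3, a4, a2] [b3, b2, b1, b5, b4]"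
    by (rule reverse_first)
  also have "\<dots> \<sim> config [a1, a2, a3, a4, a5] [b1, b2, b3, b4, b5]"
    by (rule rotate_first_third[OF ok])
  finally show ?thesis .
qed

lemma swap_hole_second:
  assumes ok: "placed [a1, a2, a3, a4, a5] [b1, b2, b3, b4, b5]"
  shows "config [a1, a2, a3, a4, a5] [b1, b5, b3, b4, b2] \<sim> config [a1, a2, a3, a4, a5] [b1, b2, b3, b4, b5]"
proof -
  have "config [a1, a2, a3, a4, a5] [b1, b5, b3, b4, b2] \<sim> config [a3, a4, a1, a2, a5] [b5, b1, b3, b4, b2]"
    by (rule swap_first_second)
  also have "\<dots> \<sim> config [a3, a4, a1, a2, a5] [b2, b1, b3, b4, b5]"
    by (rule swap_hole_first) (use ok in \<open>auto simp: placed_def\<close>)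
  also have "\<dots> \<sim> config [a1, a2, a3, a4, a5] [b1, b2, b3, b4, b5]"
    by (rule swap_first_second)
  finally show ?thesis .
qed

lemma swap_right_1_2:
  assumes ok: "placed [a1, a2, a3, a4, a5] [b1, b2, b3, b4, b5]"
  shows "config [a1, a2, a3, a4, a5] [b2, b1, b3, b4, b5] \<sim> config [a1, a2, a3, a4, a5] [b1, b2, b3, b4, b5]"
proof -
  have "config [a1, a2, a3, a4, a5] [b2, b1, b3, b4, b5] \<sim> config [a1, a2, a3, a4, a5] [b5, b1, b3, b4, b2]"
    by (rule swap_hole_first) (use ok in \<open>auto simp: placed_def\<close>)
  also have "\<dots> \<sim> config [a1, a2, a3, a4, a5] [b5, b2, b3, b4, b1]"
    by (rule swap_hole_second) (use ok in \<open>auto simp: placed_def\<close>)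
  also have "\<dots> \<sim> config [a1, a2, a3, a4, a5] [b1, b2, b3, b4, b5]"
    by (rule swap_hole_first[OF ok])
  finally show ?thesis .
qed

lemma swap_right_2_3:
  assumes ok: "placed [a1, a2, a3, a4, a5] [b1, b2, b3, b4, b5]"
  shows "config [a1, a2, a3, a4, a5] [b1, b3, b2, b4, b5] \<sim> config [a1, a2, a3, a4, a5] [b1, b2, b3, b4, b5]"
proof -
  have "config [a1, a2, a3, a4, a5] [b1, b3, b2, b4, b5] \<sim> config [a1, a2, a3, a4, a5] [b2, b3, b1, b5, b4]"
    by (rule swap_right_13_45) (use ok in \<open>auto simp: placed_def\<close>)
  also have "\<dots> \<sim> config [a1, a2, a3, a4, a5] [b3, b2, b1, b5, b4]"
    by (rule swap_right_1_2) (use ok in \<open>auto simp: placed_def\<close>)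
  also have "\<dots> \<sim> config [a1, a2, a3, a4, a5] [b1, b2, b3, b4, b5]"
    by (rule swap_right_13_45[OF ok])
  finally show ?thesis .
qed

lemma swap_right_3_5:
  assumes ok: "placed [a1, a2, a3, a4, a5] [b1, b2, b3, b4, b5]"
  shows "config [a1, a2, a3, a4, a5] [b1, b2, b5, b4, b3] \<sim> config [a1, a2, a3, a4, a5] [b1, b2, b3, b4, b5]"
proof -
  have "config [a1, a2, a3, a4, a5] [b1, b2, b5, b4, b3] \<sim> config [a1, a2, a3, a4, a5] [b1, b3, b5, b4, b2]"
    by (rule swap_hole_second) (use ok in \<open>auto simp: placed_def\<close>)
  also have "\<dots> \<sim> config [a1, a2, a3, a4, a5] [b1, b5, b3, b4, b2]"
    by (rule swap_right_2_3) (use ok in \<open>auto simp: placed_def\<close>)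
  also have "\<dots> \<sim> config [a1, a2, a3, a4, a5] [b1, b2, b3, b4, b5]"
    by (rule swap_hole_second[OF ok])
  finally show ?thesis .
qed

lemma reverse_third:
  "config [a1, a2, a3, a4, a5] [b1, b2, b4, b3, b5] \<sim> config [a1, a2, a3, a4, a5] [b1, b2, b3, b4, b5]"
  by (rule homologous_pm_sign[of "-1"]) (auto simp: join_path_rev[of b4 a5 b3] join_path.minus)

lemma swap_right_4_5:
  assumes ok: "placed [a1, a2, a3, a4, a5] [b1, b2, b3, b4, b5]"
  shows "config [a1, a2, a3, a4, a5] [b1, b2, b3, b5, b4] \<sim> config [a1, a2, a3, a4, a5] [b1, b2, b3, b4, b5]"
proof -
  have "config [a1, a2, a3, a4, a5] [b1, b2, b3, b5, b4] \<sim> config [a1, a2, a3, a4, a5] [b1, b2, b5, b3, b4]"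
    by (rule reverse_third)
  also have "\<dots> \<sim> config [a1, a2, a3, a4, a5] [b1, b2, b4, b3, b5]"
    by (rule swap_right_3_5) (use ok in \<open>auto simp: placed_def\<close>)
  also have "\<dots> \<sim> config [a1, a2, a3, a4, a5] [b1, b2, b3, b4, b5]"
    by (rule reverse_third)
  finally show ?thesis .
qed

end

section \<open>Moving the hole of a chessboard path cycle\<close>

definition map_triple :: "('a \<Rightarrow> 'b) \<Rightarrow> 'a \<times> 'a \<times> 'a \<Rightarrow> 'b \<times> 'b \<times> 'b"
  where "map_triple t = map_prod t (map_prod t t)"

lemma map_triple [simp]: "map_triple t (a, b, c) = (t a, t b, t c)"
  by (simp add: map_triple_def)

lemma map_flatten: "map t (flatten ts) = flatten (map (map_triple t) ts)"
  by (induction ts rule: flatten.induct) auto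

lemma set_flatten: "set (flatten ts) = (\<Union>(a, b, c)\<in>set ts. {a, b, c})"
  by (induction ts rule: flatten.induct) auto

lemma mset_flatten: "mset (flatten ts) = (\<Sum>(a, b, c)\<in>#mset ts. {#a, b, c#})"
  by (induction ts rule: flatten.induct) auto

lemma distinct_flatten_perm: "mset ts = mset us \<Longrightarrow> distinct (flatten ts @ r) \<Longrightarrow> distinct (flatten us @ r)"
  by (metis mset_append mset_eq_imp_distinct_iff mset_flatten)

lemma path_edges_flatten: "path_edges E (flatten ts) \<longleftrightarrow> (\<forall>(a, b, c)\<in>set ts. {a, b} \<in> E \<and> {b, c} \<in> E)"
  by (induction ts rule: flatten.induct) auto

lemma flatten_fixed: "(\<And>v. v \<in> set (flatten ts) \<Longrightarrow> t v = v) \<Longrightarrow> map (map_triple t) ts = ts"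
  by (induction ts rule: flatten.induct) auto

lemma bipartite_edge_cases:
  assumes "{x, y} \<in> bipartite"
  obtains a b where "x = Inl a" "y = Inr b" | a b where "x = Inr b" "y = Inl a"
  using assms by (cases x; cases y) auto

text \<open>
  If \<open>y\<close> is the middle of a path, the square formed by that path and the hole suffices. If \<open>y\<close> is an end of a
  path with middle on the left, that path, the hole and the two given paths form the configuration above.
\<close>

lemma hole_move:
  assumes V: "finite V" and ts: "distinct (flatten ts @ [h])" "set (flatten ts @ [h]) = V" "path_edges bipartite (flatten ts)"
    and h: "h \<in> range Inr" and y: "y \<in> set (flatten ts)" "y \<in> range Inr"
    and P: "mset ts = mset ((Inl a1, Inr b1, Inl a2) # (Inl a3, Inr b2, Inl a4) # vs)"
  shows "homologous_pm bipartite V (length ts) (join_paths (flatten (map (map_triple (transpose h y)) ts)) unit_chain) (join_paths (flatten ts) unit_chain)"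
proof -
  let ?t = "transpose h y"
  have reorder: "homologous_pm bipartite V (length ts) (join_paths (flatten (map (map_triple ?t) ts)) unit_chain) (join_paths (flatten ts) unit_chain)"
    if us: "mset ts = mset us" and p: "homologous_pm bipartite V (length us) (join_paths (flatten (map (map_triple ?t) us)) unit_chain) (join_paths (flatten us) unit_chain)" for us
  proof -
    have len: "length us = length ts"
      using us by (metis size_mset)
    have "homologous_pm bipartite V (length ts) (join_paths (flatten (map (map_triple ?t) ts)) unit_chain) (join_paths (flatten (map (map_triple ?t) us)) unit_chain)"
      by (rule homologous_pm_perm) (simp add: us)
    also have "homologous_pm bipartite V (length ts) (join_paths (flatten (map (map_triple ?t) us)) unit_chain) (join_paths (flatten us) unit_chain)"
      using p unfolding len .
    also have "homologous_pm bipartite V (length ts) (join_paths (flatten us) unit_chain) (join_paths (flatten ts) unit_chain)"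
      by (rule homologous_pm_perm) (simp add: us)
    finally show ?thesis .
  qed
  obtain T where T: "T \<in> set ts" "y \<in> {fst T, fst (snd T), snd (snd T)}"
    using y(1) by (auto simp: set_flatten)
  obtain x1 x2 x3 where Tx: "T = (x1, x2, x3)"
    by (cases T) auto
  have e: "{x1, x2} \<in> bipartite" "{x2, x3} \<in> bipartite"
    using ts(3) T(1) by (auto simp: Tx path_edges_flatten)
  have h': "h \<noteq> Inl v" for v
    using h by auto
  show ?thesis
  proof (cases "x1 \<in> range Inl")
    case True
    with e obtain a b c where x: "x1 = Inl a" "x2 = Inr b" "x3 = Inl c"
      by (auto elim!: bipartite_edge_cases)
    have yb: "y = Inr b"
      using T(2) y(2) by (auto simp: Tx x)
    obtain u v where uv: "ts = u @ T # v"
      using split_list[OF T(1)] by blast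
    have m: "mset ts = mset ((u @ v) @ [T])"
      by (simp add: uv)
    have d: "distinct (flatten ((u @ v) @ [T]) @ [h])"
      using distinct_flatten_perm[OF m ts(1)] .
    have fixed: "map (map_triple ?t) (u @ v) = u @ v"
      using d by (intro flatten_fixed) (auto simp: flatten_append Tx x yb transpose_def)
    have sub: "set (flatten (u @ v)) \<subseteq> V" "Inl a \<in> V" "Inr b \<in> V" "Inl c \<in> V" "h \<in> V"
      using ts(2) by (auto simp: uv flatten_append Tx x)
    have "homologous_pm bipartite V (Suc (length (u @ v))) (join_paths (flatten ((u @ v) @ [(Inl a, h, Inl c)])) unit_chain)
        (join_paths (flatten ((u @ v) @ [(Inl a, Inr b, Inl c)])) unit_chain)"
    proof (rule homologous_pm_block_end[OF homologous_pm_middle[of "Inl a" "Inr b" _ "Inl c" h]])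
      show "path_edges bipartite (flatten (u @ v))"
        using ts(3) unfolding uv path_edges_flatten by auto
    qed (use h d V sub in \<open>auto simp: flatten_append Tx x\<close>)
    moreover have "map (map_triple ?t) ((u @ v) @ [T]) = (u @ v) @ [(Inl a, h, Inl c)]"
    proof -
      have "map (map_triple ?t) [T] = [(Inl a, h, Inl c)]"
        using h' by (auto simp: Tx x yb transpose_def)
      then show ?thesis
        by (simp only: map_append[of _ "u @ v"] fixed)
    qed
    moreover have "length ((u @ v) @ [T]) = Suc (length (u @ v))"
      by simp
    ultimately have "homologous_pm bipartite V (length ((u @ v) @ [T])) (join_paths (flatten (map (map_triple ?t) ((u @ v) @ [T]))) unit_chain)
        (join_paths (flatten ((u @ v) @ [T])) unit_chain)"
      by (simp only: Tx x)
    then show ?thesis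
      by (rule reorder[OF m])
  next
    case False
    with e obtain b3 a5 b4 where x: "x1 = Inr b3" "x2 = Inl a5" "x3 = Inr b4"
      by (auto elim!: bipartite_edge_cases)
    let ?P1 = "(Inl a1, Inr b1, Inl a2)" and ?P2 = "(Inl a3, Inr b2, Inl a4)"
    have "T \<in> set vs"
      using T(1) mset_eq_setD[OF P] by (auto simp: Tx x)
    then obtain u v where uv: "vs = u @ T # v"
      using split_list by metis
    have m: "mset ts = mset ((u @ v) @ [?P1, ?P2, T])"
      using P by (simp add: uv)
    have d: "distinct (flatten ((u @ v) @ [?P1, ?P2, T]) @ [h])"
      using distinct_flatten_perm[OF m ts(1)] .
    have sV: "set (flatten ((u @ v) @ [?P1, ?P2, T]) @ [h]) = V"
      using ts(2) mset_eq_setD[OF m] by (simp add: set_flatten)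
    have yb: "y = Inr b3 \<or> y = Inr b4"
      using T(2) y(2) by (auto simp: Tx x)
    have fixed: "map (map_triple ?t) (u @ v) = u @ v"
      using d yb by (intro flatten_fixed) (auto simp: flatten_append Tx x transpose_def)
    define SA :: "('a + 'b) set" where "SA = {Inl a1, Inl a2, Inl a3, Inl a4, Inl a5}"
    define SB :: "('a + 'b) set" where "SB = {Inr b1, Inr b2, Inr b3, Inr b4, h}"
    interpret chess_moves SA SB
      by standard (use h in \<open>auto simp: SA_def SB_def\<close>)
    have ok: "placed [Inl a1, Inl a2, Inl a3, Inl a4, Inl a5] [Inr b1, Inr b2, Inr b3, Inr b4, h]"
      unfolding placed_def using d by (auto simp: SA_def SB_def flatten_append Tx x)
    have "homologous_pm bipartite (SA \<union> SB) 3 (join_paths (flatten (map (map_triple ?t) [?P1, ?P2, T])) unit_chain) (join_paths (flatten [?P1, ?P2, T]) unit_chain)"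
      using yb
    proof
      assume y3: "y = Inr b3"
      have "map (map_triple ?t) [?P1, ?P2, T] = [?P1, ?P2, (h, Inl a5, Inr b4)]"
        using d h' by (auto simp: y3 Tx x flatten_append transpose_def)
      then show ?thesis
        using swap_right_3_5[OF ok] by (simp only: Tx x config.simps)
    next
      assume y4: "y = Inr b4"
      have "map (map_triple ?t) [?P1, ?P2, T] = [?P1, ?P2, (Inr b3, Inl a5, h)]"
        using d h' by (auto simp: y4 Tx x flatten_append transpose_def)
      then show ?thesis
        using swap_right_4_5[OF ok] by (simp only: Tx x config.simps)
    qed
    then have "homologous_pm bipartite V (length (flatten (u @ v)) div 3 + 3) (join_paths (flatten (u @ v)) (join_paths (flatten (map (map_triple ?t) [?P1, ?P2, T])) unit_chain))
        (join_paths (flatten (u @ v)) (join_paths (flatten [?P1, ?P2, T]) unit_chain))"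
    proof (rule homologous_pm_join_paths)
      show "path_edges bipartite (flatten (u @ v))"
      proof -
        have "set (u @ v) \<subseteq> set ts"
          using mset_eq_setD[OF m] by auto
        then show ?thesis
          using ts(3) unfolding path_edges_flatten by blast
      qed
      show "set (flatten (u @ v)) \<inter> (SA \<union> SB) = {}"
        using d by (auto simp: SA_def SB_def flatten_append Tx x)
      show "set (flatten (u @ v)) \<union> (SA \<union> SB) \<subseteq> V"
        unfolding sV[symmetric] SA_def SB_def Tx x
        by (simp only: flatten_append set_append flatten.simps list.set) blast
      show "distinct (flatten (u @ v))"
        using d by (auto simp: flatten_append)
    qed (use V fin in \<open>auto simp: length_flatten\<close>)
    moreover have "map (map_triple ?t) ((u @ v) @ [?P1, ?P2, T]) = (u @ v) @ map (map_triple ?t) [?P1, ?P2, T]"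
      by (simp only: map_append[of _ "u @ v"] fixed)
    moreover have "length (flatten (u @ v)) div 3 + 3 = length ((u @ v) @ [?P1, ?P2, T])"
      by (simp add: length_flatten)
    ultimately have "homologous_pm bipartite V (length ((u @ v) @ [?P1, ?P2, T])) (join_paths (flatten (map (map_triple ?t) ((u @ v) @ [?P1, ?P2, T]))) unit_chain)
        (join_paths (flatten ((u @ v) @ [?P1, ?P2, T])) unit_chain)"
      by (simp only: join_paths_flatten_append[of "u @ v"])
    then show ?thesis
      by (rule reorder[OF m])
  qed
qed

text \<open>
  Two paths with middle on the right, as they are used by \<open>hole_move\<close>, stand at fixed places of the list, which makes
  the condition stable under exchanges of right points. The parameters \<open>i\<close> and \<open>b\<close> record the edge with which the
  list starts and \<open>h\<close> records the hole, because these determine the dual system in which the path cycle is used.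
\<close>

definition two_path_state :: "('a + 'b) set \<Rightarrow> 'a \<Rightarrow> 'b \<Rightarrow> (('a + 'b) \<times> ('a + 'b) \<times> ('a + 'b)) list \<Rightarrow> 'b \<Rightarrow> bool"
  where "two_path_state V i b ts h \<longleftrightarrow> distinct (flatten ts @ [Inr h]) \<and> set (flatten ts @ [Inr h]) = V \<and> path_edges bipartite (flatten ts) \<and>
    (\<exists>a c d e us. ts = (Inl i, Inr b, Inl a) # (Inl c, Inr d, Inl e) # us)"

lemma two_path_state_step:
  assumes V: "finite V" and g: "two_path_state V i b ts h" and y: "Inr y \<in> V"
  shows "\<exists>ts'. two_path_state V i (transpose h y b) ts' y \<and> length ts' = length ts \<and>
    homologous_pm bipartite V (length ts) (join_paths (flatten ts') unit_chain) (join_paths (flatten ts) unit_chain)"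
proof (cases "y = h")
  case True
  then show ?thesis
    using g homologous_pm_refl by fastforce
next
  case False
  let ?t = "transpose (Inr h) (Inr y) :: 'a + 'b \<Rightarrow> 'a + 'b"
  obtain a c d e us where ts: "ts = (Inl i, Inr b, Inl a) # (Inl c, Inr d, Inl e) # us"
    using g by (auto simp: two_path_state_def)
  have D: "distinct (flatten ts @ [Inr h])" "set (flatten ts @ [Inr h]) = V" "path_edges bipartite (flatten ts)"
    using g by (auto simp: two_path_state_def)
  have t: "?t (Inr v) = Inr (transpose h y v)" "?t (Inl w) = Inl w" for v w
    by (auto simp: transpose_def)
  let ?ts = "map (map_triple ?t) ts"
  have eq: "flatten ?ts @ [Inr y] = map ?t (flatten ts @ [Inr h])"
    by (simp add: map_flatten)
  have "two_path_state V i (transpose h y b) ?ts y"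
    unfolding two_path_state_def
  proof (intro conjI)
    show "distinct (flatten ?ts @ [Inr y])"
      unfolding eq by (simp only: distinct_map D(1) inj_on_transpose simp_thms)
    have "?t ` V = V"
      by (rule transpose_image_eq) (use y D(2) in auto)
    then show "set (flatten ?ts @ [Inr y]) = V"
      unfolding eq set_map D(2) .
    show "path_edges bipartite (flatten ?ts)"
      unfolding path_edges_flatten
    proof clarsimp
      fix x1 x2 x3 assume "(x1, x2, x3) \<in> set ts"
      then have "{x1, x2} \<in> bipartite" "{x2, x3} \<in> bipartite"
        using D(3) by (auto simp: path_edges_flatten)
      then show "{?t x1, ?t x2} \<in> bipartite \<and> {?t x2, ?t x3} \<in> bipartite"
        by (auto elim!: bipartite_edge_cases simp: t)
    qed
    show "\<exists>a c d e us. ?ts = (Inl i, Inr (transpose h y b), Inl a) # (Inl c, Inr d, Inl e) # us"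
      unfolding ts by (simp add: t)
  qed
  moreover have "homologous_pm bipartite V (length ts) (join_paths (flatten ?ts) unit_chain) (join_paths (flatten ts) unit_chain)"
  proof (rule hole_move[OF V D])
    show "Inr y \<in> set (flatten ts)"
      using y False D(2) by auto
    show "mset ts = mset ((Inl i, Inr b, Inl a) # (Inl c, Inr d, Inl e) # us)"
      by (simp add: ts)
  qed auto
  ultimately show ?thesis
    by (intro exI[where x="?ts"]) simp
qed

text \<open>
  Three exchanges with the hole bring prescribed points to both places: first \<open>b\<close> becomes the hole, then the old neighbour
  of \<open>i\<close> does, then \<open>h\<close>.
\<close>

lemma two_path_state_all:
  assumes V: "finite V" and g: "two_path_state V i b0 ts0 h0" and b: "Inr b \<in> V" "Inr h \<in> V" "b \<noteq> h"
  shows "\<exists>ts. two_path_state V i b ts h \<and> length ts = length ts0 \<and>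
    homologous_pm bipartite V (length ts0) (join_paths (flatten ts) unit_chain) (join_paths (flatten ts0) unit_chain)"
proof -
  obtain ts1 where 1: "two_path_state V i (transpose h0 b b0) ts1 b" "length ts1 = length ts0"
    "homologous_pm bipartite V (length ts0) (join_paths (flatten ts1) unit_chain) (join_paths (flatten ts0) unit_chain)"
    using two_path_state_step[OF V g b(1)] by blast
  let ?b1 = "transpose h0 b b0"
  have b1: "Inr ?b1 \<in> V" "?b1 \<noteq> b"
    using 1(1) unfolding two_path_state_def by auto
  obtain ts2 where 2: "two_path_state V i (transpose b ?b1 ?b1) ts2 ?b1" "length ts2 = length ts0"
    "homologous_pm bipartite V (length ts0) (join_paths (flatten ts2) unit_chain) (join_paths (flatten ts1) unit_chain)"
    using two_path_state_step[OF V 1(1) b1(1)] 1(2) by auto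
  have g2: "two_path_state V i b ts2 ?b1"
    using 2(1) by simp
  obtain ts3 where 3: "two_path_state V i (transpose ?b1 h b) ts3 h" "length ts3 = length ts0"
    "homologous_pm bipartite V (length ts0) (join_paths (flatten ts3) unit_chain) (join_paths (flatten ts2) unit_chain)"
    using two_path_state_step[OF V g2 b(2)] 2(2) by auto
  have "transpose ?b1 h b = b"
    using b1 b(3) by (simp add: transpose_def)
  then show ?thesis
    using 3 homologous_pm_trans[OF 3(3) homologous_pm_trans[OF 2(3) 1(3)]] by auto
qed

lemma ex_blocks:
  assumes "finite A" "finite B" "card A = 2 * p + q" "card B = p + 2 * q"
  shows "\<exists>ts us. length ts = p \<and> length us = q \<and> (\<forall>T\<in>set ts. \<exists>a b c. T = (Inl a, Inr b, Inl c)) \<and>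
    distinct (flatten (ts @ us)) \<and> set (flatten (ts @ us)) = Inl ` A \<union> Inr ` B \<and> path_edges bipartite (flatten (ts @ us))"
  using assms
proof (induction p arbitrary: A B)
  case 0
  then show ?case
  proof (induction q arbitrary: A B)
    case 0
    then show ?case
      by simp
  next
    case (Suc q)
    obtain a where a: "a \<in> A"
      using Suc.prems by fastforce
    have "2 \<le> card B"
      using Suc.prems by simp
    then obtain b c where bc: "b \<in> B" "c \<in> B" "b \<noteq> c"
      by (rule ex_two)
    have "card (A - {a}) = 2 * 0 + q" "card (B - {b, c}) = 0 + 2 * q"
      using Suc.prems a bc by (auto simp: card_Diff_subset)
    then obtain ts us :: "(('a + 'b) \<times> ('a + 'b) \<times> ('a + 'b)) list"
      where *: "length ts = 0" "length us = q" "distinct (flatten (ts @ us))"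
        "set (flatten (ts @ us)) = Inl ` (A - {a}) \<union> Inr ` (B - {b, c})" "path_edges bipartite (flatten (ts @ us))"
      using Suc.IH[of "A - {a}" "B - {b, c}"] Suc.prems by blast
    have ts: "ts = []"
      using *(1) by simp
    let ?us = "(Inr b, Inl a, Inr c) # us"
    have f: "flatten ([] @ ?us) = Inr b # Inl a # Inr c # flatten (ts @ us)"
      by (simp add: ts)
    have "distinct (flatten ([] @ ?us))"
      unfolding f using *(3) bc by (simp add: *(4)) blast
    moreover have "set (flatten ([] @ ?us)) = Inl ` A \<union> Inr ` B"
    proof -
      have "Inl ` A = insert (Inl a) (Inl ` (A - {a}))" "Inr ` B = insert (Inr b) (insert (Inr c) (Inr ` (B - {b, c})))"
        using a bc by blast+
      note p = this
      show ?thesis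
        unfolding f list.set *(4) p by blast
    qed
    moreover have "path_edges bipartite (flatten ([] @ ?us))"
      unfolding f using *(5) by simp
    ultimately show ?case
      using *(2) by (intro exI[where x="[]"] exI[where x="?us"] conjI) simp_all
  qed
next
  case (Suc p)
  have "2 \<le> card A"
    using Suc.prems by simp
  then obtain a c where ac: "a \<in> A" "c \<in> A" "a \<noteq> c"
    by (rule ex_two)
  obtain b where b: "b \<in> B"
    using Suc.prems by fastforce
  have "card (A - {a, c}) = 2 * p + q" "card (B - {b}) = p + 2 * q"
    using Suc.prems ac b by (auto simp: card_Diff_subset)
  then obtain ts us :: "(('a + 'b) \<times> ('a + 'b) \<times> ('a + 'b)) list"
    where *: "length ts = p" "length us = q" "\<forall>T\<in>set ts. \<exists>a b c. T = (Inl a, Inr b, Inl c)"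
      "distinct (flatten (ts @ us))"
      "set (flatten (ts @ us)) = Inl ` (A - {a, c}) \<union> Inr ` (B - {b})" "path_edges bipartite (flatten (ts @ us))"
    using Suc.IH[of "A - {a, c}" "B - {b}"] Suc.prems by blast
  let ?ts = "(Inl a, Inr b, Inl c) # ts"
  have f: "flatten (?ts @ us) = Inl a # Inr b # Inl c # flatten (ts @ us)"
    by simp
  have "distinct (flatten (?ts @ us))"
    unfolding f using *(4) ac by (simp add: *(5)) blast
  moreover have "set (flatten (?ts @ us)) = Inl ` A \<union> Inr ` B"
  proof -
    have "Inl ` A = insert (Inl a) (insert (Inl c) (Inl ` (A - {a, c})))" "Inr ` B = insert (Inr b) (Inr ` (B - {b}))"
      using ac b by blast+
    note p = this
    show ?thesis
      unfolding f list.set *(5) p by blast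
  qed
  moreover have "path_edges bipartite (flatten (?ts @ us))"
    unfolding f using *(6) by simp
  moreover have "\<forall>T\<in>set ?ts. \<exists>a b c. T = (Inl a, Inr b, Inl c)"
    using *(3) by simp
  ultimately show ?case
    using *(1,2) by (intro exI[where x="?ts"] exI[where x=us] conjI) simp_all
qed


section \<open>Relabelling of points\<close>

definition relabel :: "('b \<Rightarrow> 'a) \<Rightarrow> ('a list \<Rightarrow> int) \<Rightarrow> 'b list \<Rightarrow> int"
  where "relabel g c = (\<lambda>xs. c (map g xs))"

lemma relabel_add: "relabel g (c + d) = relabel g c + relabel g d"
  by (simp add: relabel_def fun_eq_iff)

lemma relabel_relabel: "(\<And>x. h (g x) = x) \<Longrightarrow> relabel g (relabel h c) = c"
  by (simp add: relabel_def o_def)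

lemma boundary_relabel:
  assumes "bij g"
  shows "boundary (relabel g c) = relabel g (boundary c)"
proof
  fix xs
  have "bij_betw g {v. c (g v # map g xs) \<noteq> 0} {w. c (w # map g xs) \<noteq> 0}"
    using assms by (intro bij_betwI[where g="inv_into UNIV g"])
      (auto simp: bij_is_surj surj_f_inv_f bij_is_inj)
  from sum.reindex_bij_betw[OF this, of "\<lambda>w. c (w # map g xs)"]
  show "boundary (relabel g c) xs = relabel g (boundary c) xs"
    by (simp add: boundary_def relabel_def)
qed

lemma relabel_chains:
  assumes "finite V'" "\<And>F. g ` F \<in> matchings_on E V \<Longrightarrow> F \<in> matchings_on E' V'" "c \<in> chains (matchings_on E V) s"
  shows "relabel g c \<in> chains (matchings_on E' V') s"
proof (rule matchings_on_chainsI[OF assms(1)])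
  show "alternating (relabel g c)"
    unfolding relabel_def
    by (rule alternatingI) (unfold map_append list.map, rule alternating_swap[OF chainsD(2)[OF assms(3)]])
  fix xs assume "relabel g c xs \<noteq> 0"
  then have "c (map g xs) \<noteq> 0"
    by (simp add: relabel_def)
  then show "distinct xs \<and> set xs \<in> matchings_on E' V' \<and> length xs = s"
    using chainsD(3-5)[OF assms(3), of "map g xs"] assms(2)[of "set xs"] by (auto simp: distinct_map)
qed

lemma relabel_Cyc:
  assumes "bij g" "finite V'" "\<And>F. g ` F \<in> matchings_on E V \<Longrightarrow> F \<in> matchings_on E' V'" "c \<in> Cyc (matchings_on E V) s"
  shows "relabel g c \<in> Cyc (matchings_on E' V') s"
proof -
  have "relabel g 0 = 0"
    by (simp add: relabel_def fun_eq_iff)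
  then show ?thesis
    using assms relabel_chains[OF assms(2,3)] boundary_relabel[OF assms(1), of c] by (auto simp: Cyc_def)
qed

lemma relabel_Bd:
  assumes "bij g" "finite V'" "\<And>F. g ` F \<in> matchings_on E V \<Longrightarrow> F \<in> matchings_on E' V'" "c \<in> Bd (matchings_on E V) s"
  shows "relabel g c \<in> Bd (matchings_on E' V') s"
proof -
  obtain d where d: "d \<in> chains (matchings_on E V) (Suc s)" "c = boundary d"
    using assms(4) by (auto simp: Bd_def)
  have "relabel g d \<in> chains (matchings_on E' V') (Suc s)"
    using assms(2,3) d(1) by (rule relabel_chains)
  moreover have "boundary (relabel g d) = relabel g c"
    unfolding d(2) by (rule boundary_relabel[OF assms(1)])
  ultimately show ?thesis
    unfolding Bd_def by (intro image_eqI[where x="relabel g d"]) simp_all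
qed

lemma matchings_on_pairs_image:
  assumes "inj \<sigma>" "(`) \<sigma> ` F \<in> MK (\<sigma> ` V)"
  shows "F \<in> MK V"
  unfolding matchings_on_iff
proof (intro conjI ballI)
  fix e assume e: "e \<in> F"
  then have "card (\<sigma> ` e) = 2" "\<sigma> ` e \<subseteq> \<sigma> ` V"
    using assms(2) by (auto simp: matchings_on_iff)
  then show "e \<in> pairs" "e \<subseteq> V"
    using assms(1) by (auto simp: card_image inj_on_subset inj_image_subset_iff)
next
  show "disjoint F"
  proof (rule disjointI)
    fix e e' assume e: "e \<in> F" "e' \<in> F" "e \<noteq> e'"
    have "\<sigma> ` e \<noteq> \<sigma> ` e'"
      using e(3) assms(1) by (simp add: inj_image_eq_iff)
    then have "\<sigma> ` e \<inter> \<sigma> ` e' = {}"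
      using assms(2) e(1,2) disjointD[of "(`) \<sigma> ` F" "\<sigma> ` e" "\<sigma> ` e'"] by (simp add: matchings_on_iff)
    then show "e \<inter> e' = {}"
      by blast
  qed
qed

lemma dual_system_relabel:
  assumes \<sigma>: "bij \<sigma>" and V: "finite V" and d: "dual_system (MK (\<sigma> ` V)) s p I x f"
  shows "\<exists>x' f'. dual_system (MK V) s p I x' f'"
proof -
  let ?g = "(`) \<sigma>" and ?h = "(`) (inv_into UNIV \<sigma>)"
  have g: "?g (?h e) = e" for e
    using \<sigma> by (simp add: image_f_inv_f bij_is_surj)
  have h: "?h (?g e) = e" for e
    using \<sigma> by (simp add: image_inv_f_f bij_is_inj)
  note gh = g h
  have bij: "bij ?g" "bij ?h"
    by (rule o_bij[where g="?h"], auto simp: gh fun_eq_iff, rule o_bij[where g="?g"], auto simp: gh fun_eq_iff)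
  have 1: "F \<in> MK V" if "?g ` F \<in> MK (\<sigma> ` V)" for F
    by (rule matchings_on_pairs_image[OF bij_is_inj[OF \<sigma>] that])
  have 2: "F \<in> MK (\<sigma> ` V)" if "?h ` F \<in> MK V" for F
  proof (rule matchings_on_pairs_image[of "inv_into UNIV \<sigma>"])
    show "inj (inv_into UNIV \<sigma>)"
      using \<sigma> by (simp add: bij_imp_bij_inv bij_is_inj)
    show "?h ` F \<in> MK (?h (\<sigma> ` V))"
      using that by (simp only: gh)
  qed
  have fin: "finite (\<sigma> ` V)"
    using V by simp
  note Cyc1 = relabel_Cyc[OF bij(1) V 1] and Bd1 = relabel_Bd[OF bij(1) V 1]
    and Cyc2 = relabel_Cyc[OF bij(2) fin 2] and Bd2 = relabel_Bd[OF bij(2) fin 2]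
  have "dual_system (MK V) s p I (\<lambda>i. relabel ?g (x i)) (\<lambda>i c. f i (relabel ?h c))"
    using d unfolding dual_system_def functional_def
    by (auto simp: relabel_add Cyc1 Cyc2 Bd2 relabel_relabel gh simp del: plus_fun_apply)
  then show ?thesis
    by blast
qed

lemma matching_rank_eq: "matching_rank n = homology_rank (MK {1..n}) ((n + 1) div 3)"
proof -
  have "{{i, j} |i j. i \<in> {1..n} \<and> j \<in> {1..n} \<and> i \<noteq> j} = {e \<in> pairs. e \<subseteq> {1..n}}"
    by (auto simp: card_2_iff) blast+
  then show ?thesis
    by (simp add: matching_rank_def matching_nu_def matching_complex_def matchings_on_def)
qed

lemma chessboard_rank_eq:
  "chessboard_rank m n = homology_rank (matchings_on bipartite (Inl ` {1..m} \<union> Inr ` {1..n})) (min m (min n ((m + n + 1) div 3)))"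
proof -
  have "{{Inl i, Inr j} |i j. i \<in> {1..m} \<and> j \<in> {1..n}} =
      {e \<in> bipartite. e \<subseteq> Inl ` {1..m} \<union> Inr ` {1..n}}"
    by (auto simp: bipartite_def) blast+
  then show ?thesis
    by (simp add: chessboard_rank_def chessboard_nu_def chessboard_complex_def matchings_on_def)
qed

section \<open>The rank bounds\<close>

lemma matching_rank_lower_bound:
  assumes "1 \<le> k"
  shows "3 * k + 2 \<le> matching_rank (3 * k + 3)"
proof -
  let ?V = "{1..3 * k + 3}" and ?N = "{2..3 * k + 3}"
  have "\<exists>l. (\<exists>a r. l = 1 # b # a # r) \<and> distinct l \<and> set l = ?V \<and> path_edges pairs l" if b: "b \<in> ?N" for b
  proof -
    obtain l where l: "set l = ?V - {1, b}" "distinct l"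
      using finite_distinct_list[of "?V - {1, b}"] by auto
    have "2 \<in> ?V - {1, b} \<or> 3 \<in> ?V - {1, b}"
      using assms by auto
    then have "set l \<noteq> {}"
      unfolding l(1) by blast
    then obtain a r where ar: "l = a # r"
      by (cases l) auto
    have mem: "1 \<in> ?V" "b \<in> ?V" "1 \<noteq> b"
      using b by auto
    have "distinct (1 # b # l)"
      using mem(3) l(2) by (simp add: l(1))
    moreover have "set (1 # b # l) = ?V"
      unfolding list.set l(1) using mem by blast
    ultimately have "distinct (1 # b # a # r)" "set (1 # b # a # r) = ?V"
      unfolding ar by blast+
    then show ?thesis
      by (intro exI[where x="1 # b # a # r"]) (auto intro: path_edges_pairs simp del: path_edges.simps)
  qed
  then obtain L where L: "\<And>b. b \<in> ?N \<Longrightarrow> \<exists>a r. L b = 1 # b # a # r"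
    "\<And>b. b \<in> ?N \<Longrightarrow> distinct (L b) \<and> set (L b) = ?V \<and> path_edges pairs (L b)"
    by metis
  have "\<exists>f. dual_system (MK ?V) (Suc k) 3 ?N (\<lambda>b. path_cycle (L b)) f"
    using assms L by (intro star_dual_system[where i=1]) auto
  then have "card ?N \<le> homology_rank (MK ?V) (Suc k)"
    using dual_system_le_rank[OF finite_complex_matchings_on, of ?V 3 ?N pairs "Suc k"] by auto
  then show ?thesis
    by (simp add: matching_rank_eq)
qed

text \<open>
  The links of the edges at the point 1 are matching complexes on \<open>3k\<close> points, each with its dual system of maximal
  size, and their homology classes all map into the cyclic homology on \<open>3k + 1\<close> points.
\<close>

lemma matching_rank_step:
  assumes k: "2 \<le> k"
  shows "(3 * k + 1) * matching_rank (3 * k) \<le> matching_rank (3 * k + 2) + 1"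
proof -
  define n where "n = 3 * k + 2"
  define d where "d = matching_rank (3 * k)"
  let ?V = "{1..n}"
  have d: "d = homology_rank (MK {1..3 * k}) k"
  proof -
    have "(3 * k + 1) div 3 = k"
      by simp
    then show ?thesis
      by (simp only: d_def matching_rank_eq)
  qed
  obtain p x0 f0 where p: "p \<ge> 2" and dual0: "dual_system (MK {1..3 * k}) k p {..<d} x0 f0"
    using rank_dual_system[OF finite_complex_matchings_on, of "{1..3 * k}" pairs k] unfolding d by auto
  have "\<exists>x f. dual_system (MK (?V - {1, a})) k p {..<d} x f" if a: "a \<in> {2..n}" for a
  proof -
    let ?t = "transpose 1 (n - 1)"
    \<comment> \<open>A bijection that takes the points other than 1 and \<open>a\<close> to \<open>{1..3 * k}\<close>.\<close>
    define \<sigma> where "\<sigma> = transpose (?t a) n \<circ> ?t"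
    have t: "transpose (?t a) n permutes ?V" "?t permutes ?V"
      using a k by (auto intro!: permutes_swap_id simp: n_def transpose_def)
    then have \<sigma>: "\<sigma> permutes ?V"
      unfolding \<sigma>_def by (rule permutes_compose[rotated])
    have bij: "bij \<sigma>"
      by (rule permutes_bij[OF \<sigma>])
    have "\<sigma> 1 = n - 1" "\<sigma> a = n"
      using a k by (auto simp: \<sigma>_def n_def transpose_def)
    then have "\<sigma> ` {1, a} = {n - 1, n}"
      by simp
    then have "\<sigma> ` (?V - {1, a}) = ?V - {n - 1, n}"
      using image_set_diff[OF bij_is_inj[OF bij], of ?V "{1, a}"] permutes_image[OF \<sigma>] by simp
    also have "\<dots> = {1..3 * k}"
      by (auto simp: n_def)
    finally have "dual_system (MK (\<sigma> ` (?V - {1, a}))) k p {..<d} x0 f0"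
      using dual0 by simp
    then show ?thesis
      by (intro dual_system_relabel[OF bij]) auto
  qed
  then obtain X F where XF: "\<And>a. a \<in> {2..n} \<Longrightarrow> dual_system (MK (?V - {1, a})) k p {..<d} (X a) (F a)"
    by metis
  obtain l0 where l0: "distinct l0" "set l0 = ?V - {1}"
    using finite_distinct_list[of "?V - {1}"] by auto
  let ?J = "{2..n} \<times> {..<d}"
  have "card ?J \<le> homology_rank (MK ?V) (Suc k) + 1"
  proof (rule rank_of_links[where e="\<lambda>j. {1, fst j}" and x="\<lambda>j. X (fst j) (snd j)"
        and f="\<lambda>j. F (fst j) (snd j)" and z="path_cycle l0" and i=1 and p=p])
    fix j assume j: "j \<in> ?J"
    then have a: "fst j \<in> {2..n}" "snd j < d"
      by auto
    show "{1, fst j} \<in> pairs" "{1, fst j} \<subseteq> ?V" "1 \<in> {1, fst j}"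
      using a by (auto simp: card_insert_if)
    show x: "X (fst j) (snd j) \<in> Cyc (MK (?V - {1, fst j})) k"
      using XF[OF a(1)] a(2) by (auto simp: dual_system_def)
    show "functional (MK (?V - {1, fst j})) k p (F (fst j) (snd j))"
      using XF[OF a(1)] a(2) by (auto simp: dual_system_def)
    have "X (fst j) (snd j) \<in> Cyc (MK (?V - {1})) k"
      by (rule Cyc_mono[OF x matchings_on_mono]) auto
    then show "\<exists>m. X (fst j) (snd j) - m \<odot> path_cycle l0 \<in> Bd (MK (?V - {1})) k"
      by (intro matching_homology_cyclic k l0) (auto simp: n_def)
  next
    fix j j' assume "j \<in> ?J" "j' \<in> ?J" and e: "{1, fst j} = {1, fst j'}"
    then have a: "fst j \<in> {2..n}" "snd j < d" "snd j' < d" "fst j = fst j'"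
      by (auto simp: doubleton_eq_iff)
    show "[F (fst j) (snd j) (X (fst j') (snd j')) = of_bool (j = j')] (mod p)"
      using XF[OF a(1)] a by (auto simp: dual_system_def prod_eq_iff)
  qed (use p in auto)
  moreover have "card ?J = (3 * k + 1) * d"
    by (simp add: n_def)
  moreover have "matching_rank (3 * k + 2) = homology_rank (MK ?V) (Suc k)"
    by (simp add: matching_rank_eq n_def)
  ultimately show ?thesis
    by (simp add: d_def)
qed

text \<open>
  With \<open>m - t\<close> paths that have their middle on the right and \<open>n - t\<close> paths that have it on the left all points are
  covered, and a path of the first kind can start at the left point 1.
\<close>

lemma chessboard_rank_lower_bound:
  assumes t: "m + n = 3 * t" "t < m" "t \<le> n" "2 \<le> t"
  shows "n \<le> chessboard_rank m n"
proof -
  let ?V = "Inl ` {1..m} \<union> Inr ` {1..n} :: (nat + nat) set" and ?N = "Inr ` {1..n} :: (nat + nat) set"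
  define k where "k = t - 1"
  have "\<exists>l. (\<exists>a r. l = Inl 1 # b # a # r) \<and> distinct l \<and> set l = ?V \<and> path_edges bipartite l" if b: "b \<in> ?N" for b
  proof -
    obtain c where c: "b = Inr c" "c \<in> {1..n}"
      using b by auto
    let ?A = "{1..m} - {1, 2}" and ?B = "{1..n} - {c}"
    have "card ?A = 2 * (m - t - 1) + (n - t)" "card ?B = (m - t - 1) + 2 * (n - t)"
      using t c by (auto simp: card_Diff_subset)
    then obtain ts us :: "((nat + nat) \<times> (nat + nat) \<times> (nat + nat)) list" where *: "distinct (flatten (ts @ us))"
      "set (flatten (ts @ us)) = Inl ` ?A \<union> Inr ` ?B" "path_edges bipartite (flatten (ts @ us))"
      using ex_blocks[of ?A ?B "m - t - 1" "n - t"] by auto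
    let ?l = "Inl 1 # b # Inl 2 # flatten (ts @ us)"
    have "distinct ?l"
      using *(1) by (simp add: c *(2)) blast
    moreover have "set ?l = ?V"
    proof -
      have A: "{1..m} = insert 1 (insert 2 ?A)"
        using t by auto
      have B: "{1..n} = insert c ?B"
        using c by auto
      have p: "?V = insert (Inl 1) (insert (Inl 2) (Inl ` ?A)) \<union> insert (Inr c) (Inr ` ?B)"
        by (subst A, subst B) (simp only: image_insert)
      show ?thesis
        unfolding p list.set *(2) c(1) by blast
    qed
    moreover have "path_edges bipartite ?l"
      using *(3) by (simp add: c)
    ultimately show ?thesis
      by (intro exI[where x="?l"]) simp
  qed
  then obtain L where L: "\<And>b. b \<in> ?N \<Longrightarrow> \<exists>a r. L b = Inl 1 # b # a # r"
    "\<And>b. b \<in> ?N \<Longrightarrow> distinct (L b) \<and> set (L b) = ?V \<and> path_edges bipartite (L b)"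
    by metis
  have card: "card ?V = 3 * k + 3"
    using t by (subst card_Un_disjoint) (auto simp: card_image k_def)
  have "\<exists>f. dual_system (matchings_on bipartite ?V) (Suc k) 3 ?N (\<lambda>b. path_cycle (L b)) f"
  proof (rule star_dual_system[where i="Inl 1"])
    show "card ?V = 3 * k + 3" "1 \<le> k"
      using card t by (auto simp: k_def)
  qed (use L bipartite_pairs in auto)
  then have "card ?N \<le> homology_rank (matchings_on bipartite ?V) (Suc k)"
    using dual_system_le_rank[OF finite_complex_matchings_on, of ?V 3 ?N bipartite "Suc k"] by auto
  moreover have "min m (min n ((m + n + 1) div 3)) = Suc k"
    using t by (auto simp: k_def)
  ultimately show ?thesis
    by (simp add: chessboard_rank_eq card_image)
qed

text \<open>
  The link of \<open>{Inl 1, Inr h}\<close> has a dual system of \<open>n - 1\<close> path cycles, one for each neighbour \<open>b\<close> of the left point 2.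
  As path cycles with hole \<open>h\<close> on the points other than \<open>Inl 1\<close> they are all homologous up to sign.
\<close>

lemma chessboard_rank_step:
  assumes t: "m + n = 3 * t + 2" "t + 3 \<le> m" "t + 1 \<le> n" "2 \<le> t"
  shows "n * (n - 1) \<le> chessboard_rank m n + 1"
proof -
  let ?V = "Inl ` {1..m} \<union> Inr ` {1..n} :: (nat + nat) set"
  let ?V1 = "?V - {Inl 1}"
  define k where "k = t - 1"
  have fin: "finite ?V1"
    by simp
  have "\<exists>ts0. two_path_state ?V1 2 1 ts0 2 \<and> length ts0 = t"
  proof -
    let ?A = "{1..m} - {1, 2, 3, 4, 5}" and ?B = "{1..n} - {1, 2, 3}"
    have "card ?A = 2 * (m - t - 3) + (n - t - 1)" "card ?B = (m - t - 3) + 2 * (n - t - 1)"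
      using t by (auto simp: card_Diff_subset)
    then obtain ts us :: "((nat + nat) \<times> (nat + nat) \<times> (nat + nat)) list" where *: "distinct (flatten (ts @ us))"
      "set (flatten (ts @ us)) = Inl ` ?A \<union> Inr ` ?B" "path_edges bipartite (flatten (ts @ us))"
      "length ts = m - t - 3" "length us = n - t - 1"
      using ex_blocks[of ?A ?B "m - t - 3" "n - t - 1"] by auto
    let ?ts = "(Inl 2, Inr 1, Inl 3) # (Inl 4, Inr 3, Inl 5) # ts @ us"
    have f: "flatten ?ts @ [Inr 2] = Inl 2 # Inr 1 # Inl 3 # Inl 4 # Inr 3 # Inl 5 # flatten (ts @ us) @ [Inr 2]"
      by simp
    have "two_path_state ?V1 2 1 ?ts 2"
      unfolding two_path_state_def
    proof (intro conjI)
      show "distinct (flatten ?ts @ [Inr 2])"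
        unfolding f using *(1) by (simp add: *(2)) blast
      have A: "{1..m} - {1} = insert 2 (insert 3 (insert 4 (insert 5 ?A)))"
        using t by auto
      have B: "{1..n} = insert 1 (insert 2 (insert 3 ?B))"
        using t by auto
      have "?V1 = Inl ` ({1..m} - {1}) \<union> Inr ` {1..n}"
        by auto
      also have "\<dots> = insert (Inl 2) (insert (Inl 3) (insert (Inl 4) (insert (Inl 5) (Inl ` ?A)))) \<union>
          insert (Inr 1) (insert (Inr 2) (insert (Inr 3) (Inr ` ?B)))"
        by (subst A, subst B) (simp only: image_insert)
      finally have V1: "?V1 = insert (Inl 2) (insert (Inl 3) (insert (Inl 4) (insert (Inl 5) (Inl ` ?A)))) \<union>
          insert (Inr 1) (insert (Inr 2) (insert (Inr 3) (Inr ` ?B)))" .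
      show "set (flatten ?ts @ [Inr 2]) = ?V1"
        unfolding V1 f list.set set_append *(2) by blast
      show "path_edges bipartite (flatten ?ts)"
        using *(3) by simp
    qed auto
    moreover have "length ?ts = t"
      using *(4,5) t by simp
    ultimately show ?thesis
      by blast
  qed
  then obtain ts0 where ts0: "two_path_state ?V1 2 1 ts0 2" "length ts0 = t"
    by blast
  have "\<exists>ts. two_path_state ?V1 2 b ts h \<and> length ts = t \<and> homologous_pm bipartite ?V1 t (join_paths (flatten ts) unit_chain) (join_paths (flatten ts0) unit_chain)"
    if "b \<in> {1..n}" "h \<in> {1..n}" "b \<noteq> h" for b h
    using two_path_state_all[OF fin ts0(1), of b h] that ts0(2) by auto
  then obtain ts where ts: "\<And>b h. b \<in> {1..n} \<Longrightarrow> h \<in> {1..n} \<Longrightarrow> b \<noteq> h \<Longrightarrow> two_path_state ?V1 2 b (ts b h) h"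
    "\<And>b h. b \<in> {1..n} \<Longrightarrow> h \<in> {1..n} \<Longrightarrow> b \<noteq> h \<Longrightarrow> homologous_pm bipartite ?V1 t (join_paths (flatten (ts b h)) unit_chain) (join_paths (flatten ts0) unit_chain)"
    by metis
  have card: "card ?V1 = 3 * t + 1"
  proof -
    have "card ?V = m + n"
      by (subst card_Un_disjoint) (auto simp: card_image)
    then show ?thesis
      using t by (simp add: card_Diff_singleton)
  qed
  have "\<exists>f. dual_system (matchings_on bipartite (?V1 - {Inr h})) t 3 (Inr ` ({1..n} - {h})) (\<lambda>b :: nat + nat. path_cycle (flatten (ts (projr b) h))) f"
    if h: "h \<in> {1..n}" for h
  proof -
    have "\<exists>f. dual_system (matchings_on bipartite (?V1 - {Inr h})) (Suc k) 3 (Inr ` ({1..n} - {h})) (\<lambda>b :: nat + nat. path_cycle (flatten (ts (projr b) h))) f"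
    proof (rule star_dual_system[where i="Inl 2" and L="\<lambda>v. flatten (ts (projr v) h)"])
      show "card (?V1 - {Inr h}) = 3 * k + 3"
        using card h t by (subst card_Diff_singleton) (auto simp: k_def)
      fix v :: "nat + nat" assume "v \<in> Inr ` ({1..n} - {h})"
      then obtain b where b: "v = Inr b" "b \<in> {1..n}" "b \<noteq> h"
        by blast
      have g: "two_path_state ?V1 2 b (ts b h) h"
        using ts(1) b h by simp
      then show "\<exists>a r. flatten (ts (projr v) h) = Inl 2 # v # a # r"
        by (auto simp: two_path_state_def b(1))
      have D: "distinct (flatten (ts b h) @ [Inr h])" "set (flatten (ts b h) @ [Inr h]) = ?V1" "path_edges bipartite (flatten (ts b h))"
        using g by (simp_all only: two_path_state_def)
      have nm: "distinct xs" "set xs = set (xs @ [v]) - {v}" if "distinct (xs @ [v])" for xs and v :: "nat + nat"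
        using that by auto
      show "distinct (flatten (ts (projr v) h)) \<and> set (flatten (ts (projr v) h)) = ?V1 - {Inr h} \<and> path_edges bipartite (flatten (ts (projr v) h))"
        unfolding b(1) sum.sel using nm[OF D(1)] D(3) unfolding D(2) by (intro conjI)
    qed (use fin t bipartite_pairs in \<open>auto simp: k_def\<close>)
    then show ?thesis
      using t by (simp add: k_def)
  qed
  then obtain F where F: "\<And>h. h \<in> {1..n} \<Longrightarrow> dual_system (matchings_on bipartite (?V1 - {Inr h})) t 3
      (Inr ` ({1..n} - {h})) (\<lambda>b :: nat + nat. path_cycle (flatten (ts (projr b) h))) (F h)"
    by metis
  let ?J = "Sigma {1..n} (\<lambda>h. {1..n} - {h})"
  have "card ?J \<le> homology_rank (matchings_on bipartite ?V) (Suc t) + 1"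
  proof (rule rank_of_links[where e="\<lambda>j. {Inl 1, Inr (fst j)}" and x="\<lambda>j. path_cycle (flatten (ts (snd j) (fst j)))"
        and f="\<lambda>j. F (fst j) (Inr (snd j))" and z="join_paths (flatten ts0) unit_chain" and i="Inl 1" and p=3])
    fix j assume "j \<in> ?J"
    then have j: "fst j \<in> {1..n}" "snd j \<in> {1..n}" "snd j \<noteq> fst j"
      by auto
    show "{Inl 1, Inr (fst j)} \<in> bipartite" "{Inl 1, Inr (fst j)} \<subseteq> ?V" "Inl 1 \<in> {Inl 1, Inr (fst j)}"
      using j t by auto
    have eq: "?V - {Inl 1, Inr (fst j)} = ?V1 - {Inr (fst j)}"
      by auto
    show "path_cycle (flatten (ts (snd j) (fst j))) \<in> Cyc (matchings_on bipartite (?V - {Inl 1, Inr (fst j)})) t"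
      "functional (matchings_on bipartite (?V - {Inl 1, Inr (fst j)})) t 3 (F (fst j) (Inr (snd j)))"
      unfolding eq using F[OF j(1)] j by (auto simp: dual_system_def)
    show "\<exists>m. path_cycle (flatten (ts (snd j) (fst j))) - m \<odot> join_paths (flatten ts0) unit_chain \<in> Bd (matchings_on bipartite ?V1) t"
      unfolding path_cycle_eq by (rule homologous_pm_multiple[OF ts(2)[OF j(2,1,3)]])
  next
    fix j j' assume "j \<in> ?J" "j' \<in> ?J" and "{Inl 1 :: nat + nat, Inr (fst j)} = {Inl 1, Inr (fst j')}"
    then have j: "fst j \<in> {1..n}" "snd j \<in> {1..n}" "snd j \<noteq> fst j" "snd j' \<in> {1..n}" "snd j' \<noteq> fst j" "fst j' = fst j"
      by (auto simp: doubleton_eq_iff)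
    have "Inr (snd j) \<in> Inr ` ({1..n} - {fst j})" "Inr (snd j') \<in> Inr ` ({1..n} - {fst j})"
      using j by auto
    from dual_systemD[OF F[OF j(1)] this]
    show "[F (fst j) (Inr (snd j)) (path_cycle (flatten (ts (snd j') (fst j')))) = of_bool (j = j')] (mod 3)"
      using j(6) by (simp add: prod_eq_iff)
  qed auto
  moreover have "card ?J = n * (n - 1)"
  proof -
    have "card ?J = (\<Sum>h\<in>{1..n}. card ({1..n} - {h}))"
      by (rule card_SigmaI) auto
    also have "\<dots> = (\<Sum>h\<in>{1..n}. n - 1)"
      by (intro sum.cong refl) simp
    finally show ?thesis
      by simp
  qed
  moreover have "min m (min n ((m + n + 1) div 3)) = Suc t"
    using t by auto
  ultimately show ?thesis
    by (simp add: chessboard_rank_eq)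
qed

theorem mainTheorem9:
  shows "(\<forall>n::nat. [n = 2] (mod 3) \<and> n \<ge> 8 \<longrightarrow>
            int (matching_rank n) \<ge> (int n - 1) * int (matching_rank (n - 2)) - 1 \<and>
            (int n - 1) * int (matching_rank (n - 2)) - 1 \<ge> (int n - 1) * (int n - 3) - 1)
       \<and> (\<forall>m n::nat. m > 0 \<and> n > 0 \<and> [m + n = 0] (mod 3) \<and> m \<le> n \<and> int n \<le> 2 * int m - 3 \<longrightarrow>
            chessboard_rank m n \<ge> n)
       \<and> (\<forall>m n::nat. m > 0 \<and> n > 0 \<and> [m + n = 2] (mod 3) \<and> m \<le> n \<and> int n \<le> 2 * int m - 7 \<longrightarrow>
            int (chessboard_rank m n) \<ge> int n * (int n - 1) - 1)"
proof (intro conjI[of "\<forall>n. _ n"] conjI allI impI; elim conjE)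
  fix n :: nat assume n: "[n = 2] (mod 3)" "8 \<le> n"
  then have "n mod 3 = 2"
    by (simp add: cong_def)
  define k where "k = n div 3"
  have nk: "n = 3 * k + 2" "2 \<le> k"
    using \<open>n mod 3 = 2\<close> n(2) by (auto simp: k_def) presburger+
  have "int ((3 * k + 1) * matching_rank (3 * k)) \<le> int (matching_rank (3 * k + 2) + 1)"
    using matching_rank_step[OF nk(2)] by (simp only: of_nat_le_iff)
  then show "(int n - 1) * int (matching_rank (n - 2)) - 1 \<le> int (matching_rank n)"
    unfolding nk(1) by (simp add: algebra_simps)
  have "3 * (k - 1) + 2 \<le> matching_rank (3 * (k - 1) + 3)"
    using nk(2) by (intro matching_rank_lower_bound) simp
  moreover have "3 * (k - 1) + 3 = n - 2" "3 * (k - 1) + 2 = n - 3"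
    using nk by auto
  ultimately have "int n - 3 \<le> int (matching_rank (n - 2))"
    using nk by auto
  then have "(int n - 1) * (int n - 3) \<le> (int n - 1) * int (matching_rank (n - 2))"
    using n(2) by (intro mult_left_mono) auto
  then show "(int n - 1) * (int n - 3) - 1 \<le> (int n - 1) * int (matching_rank (n - 2)) - 1"
    by linarith
next
  fix m n :: nat
  assume mn: "0 < m" "0 < n" "[m + n = 0] (mod 3)" "m \<le> n" "int n \<le> 2 * int m - 3"
  then obtain t where t: "m + n = 3 * t"
    by (auto simp: cong_0_iff)
  show "n \<le> chessboard_rank m n"
    by (rule chessboard_rank_lower_bound[OF t]) (use mn t in auto)
next
  fix m n :: nat
  assume mn: "0 < m" "0 < n" "[m + n = 2] (mod 3)" "m \<le> n" "int n \<le> 2 * int m - 7"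
  define t where "t = (m + n) div 3"
  have "(m + n) mod 3 = 2"
    using mn(3) by (simp add: cong_def)
  then have t: "m + n = 3 * t + 2"
    unfolding t_def by presburger
  have "n * (n - 1) \<le> chessboard_rank m n + 1"
    by (rule chessboard_rank_step[OF t]) (use mn t in auto)
  then have "int (n * (n - 1)) \<le> int (chessboard_rank m n + 1)"
    by (simp only: of_nat_le_iff)
  then show "int n * (int n - 1) - 1 \<le> int (chessboard_rank m n)"
    using mn(2) by (simp add: of_nat_diff)
qed

end
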